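(* Let $G$ be a necklace graph with $|V|\ge3$. Then for every real $\alpha\neq1$ there is no minimiser for the functional $\overline{\lambda_1}^{(\alpha)}(\cdot,\cdot)$ on $\mathcal{A}_+(G)$. Moreover, if $\alpha\notin\{1/2,1\}$, then there is no extremal pair for the functional $\overline{\lambda_1}^{(\alpha)}(\cdot,\cdot)$.
   Context: A necklace graph is a graph $G=(V,E)$ with $V=\{v_1,\dots,v_n\}$ and $|E|=2(n-1)$ such that for each $j\in\{1,\dots,n-1\}$ there are exactly two edges, both connecting $v_j$ and $v_{j+1}$ (and no other edges). A metric on $G$ is a vector $g=(g_e)_{e\in E}\in\mathbb{R}_+^{|E|}$ of positive numbers; the edge $e$ has length $\ell_e=\sqrt{g_e}$ and is identified with $[0,\ell_e]$, making $(G,g)$ a compact metric graph. $G_0$ denotes $G$ with all edge lengths $1$, with coordinate $x\in[0,1]$ on each edge; functions on $(G,g)$ are identified with functions on $G_0$ by linear rescaling of each edge. $\mathcal{C}_+(G)$ is the set of densities: functions $\rho$, positive and smooth on each closed edge $[0,1]$ of $G_0$ (smooth up to the endpoints; no continuity across vertices required). $\mathcal{A}_+(G)=\mathbb{R}_+^{|E|}\times\mathcal{C}_+(G)$. For $(g,\rho)\in\mathcal{A}_+(G)$, $0=\lambda_0(g,\rho)<\lambda_1(g,\rho)\le\lambda_2(g,\rho)\le\cdots$ are the eigenvalues (with multiplicity) of: $-f''=\lambda\rho f$ on edges (derivatives in arclength of $(G,g)$); $f$ continuous on $(G,g)$; $\sum_{e\in E_v}f_e'(v)=0$ at every vertex $v$,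 where $E_v$ is the set of edges attached at $v$ and $f'_e(v)$ is the derivative at $v$ pointing out of $v$ into $e$. For $\alpha\in\mathbb{R}$, $$\overline{\lambda_1}^{(\alpha)}(g,\rho)=\lambda_1(g,\rho)\left(\sum_{e\in E}g_e^{1-\alpha}\right)\left(\sum_{e\in E}g_e^{\alpha}\int_0^1\rho_e\,dx\right).$$ A minimiser is a pair in $\mathcal{A}_+(G)$ at which the infimum over $\mathcal{A}_+(G)$ is attained. A pair $(g_*,\rho_* )\in\mathcal{A}_+(G)$ is extremal for $F:\mathcal{A}_+(G)\to\mathbb{R}$ if for every smooth one-parameter family $(g(t),\rho(t))\in\mathcal{A}_+(G)$ ($t$ in an open interval around $0$) with $(g(0),\rho(0))=(g_*,\rho_* )$, one has either $F(g(t),\rho(t))\le F(g_*,\rho_* )+o(t)$ as $t\to0$, or $F(g(t),\rho(t))\ge F(g_*,\rho_* )+o(t)$ as $t\to0$. *)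

theory Defs
  imports
    "HOL-Analysis.Analysis"
    "HOL-Library.Function_Algebras"
    "HOL-Library.Landau_Symbols"
    "Graph_Theory.Digraph"
begin

text \<open>
  A graph is a finite directed multigraph. The orientation of an edge \<open>e\<close> only records how \<open>e\<close> is
  identified with an interval: the coordinate is \<open>0\<close> at \<open>tail G e\<close> and maximal at \<open>head G e\<close>.
\<close>

definition necklace_graph :: "('v, 'e) pre_digraph \<Rightarrow> bool" where
  "necklace_graph G \<longleftrightarrow> fin_digraph G \<and>
     (\<exists>n v. bij_betw v {1..n} (verts G) \<and> card (arcs G) = 2 * (n - 1) \<and>
        (\<forall>j\<in>{1..<n}. card {e \<in> arcs G. {tail G e, head G e} = {v j, v (j + 1)}} = 2))"

type_synonym 'e metric = "'e \<Rightarrow> real"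
type_synonym 'e density = "'e \<Rightarrow> real \<Rightarrow> real"

text \<open>Infinitely often differentiable on \<open>S\<close>, with one-sided derivatives at endpoints in \<open>S\<close>.\<close>

definition smooth_on :: "real set \<Rightarrow> (real \<Rightarrow> real) \<Rightarrow> bool" where
  "smooth_on S f \<longleftrightarrow>
     (\<exists>D :: nat \<Rightarrow> real \<Rightarrow> real. D 0 = f \<and>
        (\<forall>k. \<forall>x\<in>S. (D k has_real_derivative D (Suc k) x) (at x within S)))"

text \<open>Joint smoothness in two variables; \<open>D i j\<close> is the partial derivative of order \<open>i\<close> in the first
  and \<open>j\<close> in the second variable.\<close>

definition smooth2_on :: "(real \<times> real) set \<Rightarrow> (real \<Rightarrow> real \<Rightarrow> real) \<Rightarrow> bool" where
  "smooth2_on S h \<longleftrightarrow>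
     (\<exists>D :: nat \<Rightarrow> nat \<Rightarrow> real \<Rightarrow> real \<Rightarrow> real. D 0 0 = h \<and>
        (\<forall>i j. \<forall>(t, x)\<in>S.
           ((\<lambda>(s, y). D i j s y) has_derivative
            (\<lambda>(ds, dy). D (Suc i) j t x * ds + D i (Suc j) t x * dy)) (at (t, x) within S)))"

text \<open>Values of \<open>g\<close> and \<open>\<rho>\<close> at non-edges, and of \<open>\<rho> e\<close> outside \<open>{0..1}\<close>, are irrelevant throughout.\<close>

definition densities :: "('v, 'e) pre_digraph \<Rightarrow> 'e density set" where
  "densities G = {\<rho>. \<forall>e\<in>arcs G. smooth_on {0..1} (\<rho> e) \<and> (\<forall>x\<in>{0..1}. \<rho> e x > 0)}"

definition admissible :: "('v, 'e) pre_digraph \<Rightarrow> ('e metric \<times> 'e density) set" where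
  "admissible G = {g. \<forall>e\<in>arcs G. g e > 0} \<times> densities G"

definition edge_length :: "'e metric \<Rightarrow> 'e \<Rightarrow> real" where
  "edge_length g e = sqrt (g e)"

text \<open>
  Functions on \<open>(G, g)\<close> are written in the arclength coordinate \<open>s \<in> {0..edge_length g e}\<close> of each
  edge and extended by \<open>0\<close>; in this coordinate the density is \<open>\<rho> e (s / edge_length g e)\<close>. The
  values at the vertices of a continuous function are given by \<open>\<phi>\<close>.
\<close>

definition eigenspace ::
  "('v, 'e) pre_digraph \<Rightarrow> 'e metric \<Rightarrow> 'e density \<Rightarrow> real \<Rightarrow> ('e \<Rightarrow> real \<Rightarrow> real) set" where
  "eigenspace G g \<rho> \<mu> =
     {f. (\<forall>e s. \<not> (e \<in> arcs G \<and> s \<in> {0..edge_length g e}) \<longrightarrow> f e s = 0) \<and>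
         (\<exists>\<phi>. \<forall>e\<in>arcs G. f e 0 = \<phi> (tail G e) \<and> f e (edge_length g e) = \<phi> (head G e)) \<and>
         (\<exists>f' f''.
            (\<forall>e\<in>arcs G. \<forall>s\<in>{0..edge_length g e}.
               (f e has_real_derivative f' e s) (at s within {0..edge_length g e}) \<and>
               (f' e has_real_derivative f'' e s) (at s within {0..edge_length g e}) \<and>
               - f'' e s = \<mu> * \<rho> e (s / edge_length g e) * f e s) \<and>
            (\<forall>v\<in>verts G.
               (\<Sum>e | e \<in> arcs G \<and> tail G e = v. f' e 0) +
               (\<Sum>e | e \<in> arcs G \<and> head G e = v. - f' e (edge_length g e)) = 0))}"

global_interpretation edge_fun: vector_space "\<lambda>(c::real) (f :: 'e \<Rightarrow> real \<Rightarrow> real) e s. c * f e s"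
  by unfold_locales (auto simp: fun_eq_iff algebra_simps)

definition multiplicity_of ::
  "('v, 'e) pre_digraph \<Rightarrow> 'e metric \<Rightarrow> 'e density \<Rightarrow> real \<Rightarrow> nat" where
  "multiplicity_of G g \<rho> \<mu> = edge_fun.dim (eigenspace G g \<rho> \<mu>)"

text \<open>
  The eigenvalues in nondecreasing order, repeated according to multiplicity and numbered from \<open>0\<close>:
  the one with index \<open>k\<close> is the least \<open>\<mu>\<close> such that the multiplicities of the eigenvalues up to \<open>\<mu>\<close>
  add up to more than \<open>k\<close>.
\<close>

definition eigval :: "('v, 'e) pre_digraph \<Rightarrow> 'e metric \<Rightarrow> 'e density \<Rightarrow> nat \<Rightarrow> real" where
  "eigval G g \<rho> k =
     Inf {\<mu>. \<exists>S. finite S \<and> S \<subseteq> {..\<mu>} \<and> k < (\<Sum>\<nu>\<in>S. multiplicity_of G g \<rho> \<nu>)}"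

lemma eigval_eq_enumeration:
  assumes mono: "mono (lam :: nat \<Rightarrow> real)"
    and fin: "\<And>\<mu>. finite {k. lam k = \<mu>}"
    and mult: "\<And>\<mu>. card {k. lam k = \<mu>} = multiplicity_of G g \<rho> \<mu>"
  shows "eigval G g \<rho> k = lam k"
proof -
  have count: "(\<Sum>\<nu>\<in>S. multiplicity_of G g \<rho> \<nu>) = card {j. lam j \<in> S}" if "finite S" for S
  proof -
    have "{j. lam j \<in> S} = (\<Union>\<nu>\<in>S. {j. lam j = \<nu>})" by auto
    also have "card \<dots> = (\<Sum>\<nu>\<in>S. card {j. lam j = \<nu>})"
      by (rule card_UN_disjoint) (use that fin in auto)
    finally show ?thesis by (simp add: mult)
  qed
  have finS: "finite {j. lam j \<in> S}" if "finite S" for S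
  proof -
    have "{j. lam j \<in> S} = (\<Union>\<nu>\<in>S. {j. lam j = \<nu>})" by auto
    then show ?thesis using that fin by simp
  qed
  have "(\<exists>S. finite S \<and> S \<subseteq> {..\<mu>} \<and> k < (\<Sum>\<nu>\<in>S. multiplicity_of G g \<rho> \<nu>)) \<longleftrightarrow> lam k \<le> \<mu>" for \<mu>
  proof
    assume "\<exists>S. finite S \<and> S \<subseteq> {..\<mu>} \<and> k < (\<Sum>\<nu>\<in>S. multiplicity_of G g \<rho> \<nu>)"
    then obtain S where S: "finite S" "S \<subseteq> {..\<mu>}" "k < card {j. lam j \<in> S}"
      using count by auto
    show "lam k \<le> \<mu>"
    proof (rule ccontr)
      assume "\<not> lam k \<le> \<mu>"
      then have "j < k" if "lam j \<in> S" for j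
        using that S(2) monoD[OF mono, of k j] by (cases "j < k") auto
      then have "{j. lam j \<in> S} \<subseteq> {..<k}" by auto
      then have "card {j. lam j \<in> S} \<le> k"
        using card_mono[of "{..<k}" "{j. lam j \<in> S}"] by simp
      with S(3) show False by simp
    qed
  next
    assume le: "lam k \<le> \<mu>"
    let ?S = "lam ` {..k}"
    have "card {..k} \<le> card {j. lam j \<in> ?S}"
      by (rule card_mono) (auto intro: finS)
    then have "k < (\<Sum>\<nu>\<in>?S. multiplicity_of G g \<rho> \<nu>)" by (simp add: count)
    moreover have "?S \<subseteq> {..\<mu>}" using le monoD[OF mono, of _ k] by (auto intro: order_trans)
    ultimately show "\<exists>S. finite S \<and> S \<subseteq> {..\<mu>} \<and> k < (\<Sum>\<nu>\<in>S. multiplicity_of G g \<rho> \<nu>)"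
      by (intro exI[of _ ?S]) auto
  qed
  then have "{\<mu>. \<exists>S. finite S \<and> S \<subseteq> {..\<mu>} \<and> k < (\<Sum>\<nu>\<in>S. multiplicity_of G g \<rho> \<nu>)} = {lam k..}"
    by auto
  then show ?thesis by (simp add: eigval_def)
qed

definition lambda1_bar ::
  "('v, 'e) pre_digraph \<Rightarrow> real \<Rightarrow> 'e metric \<times> 'e density \<Rightarrow> real" where
  "lambda1_bar G \<alpha> = (\<lambda>(g, \<rho>).
     eigval G g \<rho> 1 * (\<Sum>e\<in>arcs G. g e powr (1 - \<alpha>)) *
     (\<Sum>e\<in>arcs G. g e powr \<alpha> * integral {0..1} (\<rho> e)))"

definition minimiser ::
  "('v, 'e) pre_digraph \<Rightarrow> ('e metric \<times> 'e density \<Rightarrow> real) \<Rightarrow> 'e metric \<times> 'e density \<Rightarrow> bool" where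
  "minimiser G F p \<longleftrightarrow> p \<in> admissible G \<and> (\<forall>q\<in>admissible G. F p \<le> F q)"

definition smooth_family ::
  "('v, 'e) pre_digraph \<Rightarrow> real \<Rightarrow> real \<Rightarrow> (real \<Rightarrow> 'e metric) \<Rightarrow> (real \<Rightarrow> 'e density) \<Rightarrow> bool" where
  "smooth_family G a b g \<rho> \<longleftrightarrow>
     (\<forall>t\<in>{a<..<b}. (g t, \<rho> t) \<in> admissible G) \<and>
     (\<forall>e\<in>arcs G. smooth_on {a<..<b} (\<lambda>t. g t e) \<and>
                  smooth2_on ({a<..<b} \<times> {0..1}) (\<lambda>t x. \<rho> t e x))"

definition extremal ::
  "('v, 'e) pre_digraph \<Rightarrow> ('e metric \<times> 'e density \<Rightarrow> real) \<Rightarrow> 'e metric \<times> 'e density \<Rightarrow> bool" where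
  "extremal G F p \<longleftrightarrow> p \<in> admissible G \<and>
     (\<forall>a b g \<rho>. a < 0 \<and> 0 < b \<and> smooth_family G a b g \<rho> \<and> (g 0, \<rho> 0) = p \<longrightarrow>
        (\<exists>r \<in> o[at 0](\<lambda>t. t). \<forall>\<^sub>F t in at 0. F (g t, \<rho> t) \<le> F p + r t) \<or>
        (\<exists>r \<in> o[at 0](\<lambda>t. t). \<forall>\<^sub>F t in at 0. F (g t, \<rho> t) \<ge> F p + r t))"

end

theory Submission
  imports Defs "HOL-Complex_Analysis.Great_Picard"
begin

text \<open>
  Along a family of metrics and densities the normalised first eigenvalue has one-sided derivatives that
  are extreme values of a quadratic form on the eigenspace, so a pair is not extremal as soon as one
  direction makes this form definite. If no direction does, a convexity argument yields eigenfunctions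
  \<open>u\<^sub>1, \<dots>, u\<^sub>d\<close> for which the trace of the form vanishes in every direction. The density directions
  give \<open>\<Sum> u\<^sub>i\<^sup>2 = c g\<^sub>e powr (\<alpha> - 1/2)\<close> on each edge, so by continuity all \<open>g\<^sub>e\<close> agree when \<open>\<alpha> \<noteq> 1/2\<close>
  and the edges are mapped to great circle arcs of constant speed; the metric directions give
  equal speeds \<open>\<omega>\<close> when \<open>\<alpha> \<noteq> 1\<close>. At a terminal vertex the two arcs leave in opposite directions and
  end at the same point, so \<open>sin \<omega> = 0\<close>, while a test function supported near the two terminal
  vertices shows \<open>0 < \<omega>\<^sup>2 \<le> 3\<close>. At a minimiser the form vanishes identically; already its density part
  forces an eigenfunction to have constant modulus on each edge, which is absurd for every \<open>\<alpha>\<close>.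
\<close>

subsection \<open>Continuously differentiable functions on the unit interval\<close>

text \<open>A multiple eigenvalue need not be differentiable along a family, so only one-sided
  information is available. Upper bounds are elementary: an eigenfunction of the unperturbed problem
  serves as test function. Lower bounds come from eigenfunctions of the perturbed problems and need
  strong convergence of their derivatives. No operator theory enters: the eigenvalue is the minimum
  of the Rayleigh quotient on mean-zero functions, and compactness is Arzela-Ascoli for functions of
  bounded energy. Points of the convex hull are represented by tuples of eigenfunctions. Since two
  initial values per edge determine an eigenfunction, twice the number of edges suffices as length,
  and a fixed length makes a closest point exist. The direction so found has a merely continuous
  density part, while families must be smooth; polynomials replace it, with an error uniform over
  normalised eigenfunctions. The bound 3 is the quotient of energy 4 and mass 4/3, up to common
  weights, of the function with values 1 and -1 at the terminal vertices. Three vertices keep the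
  two ends apart, and 3 is below \<open>pi^2\<close>.\<close>

definition C1 :: "(real \<Rightarrow> real) \<Rightarrow> (real \<Rightarrow> real) \<Rightarrow> bool" where
  "C1 u u' \<longleftrightarrow> (\<forall>x\<in>{0..1}. (u has_real_derivative u' x) (at x within {0..1})) \<and>
     continuous_on {0..1} u'"

lemma C1_deriv: "C1 u u' \<Longrightarrow> x \<in> {0..1} \<Longrightarrow> (u has_real_derivative u' x) (at x within {0..1})"
  by (simp add: C1_def)

lemma C1_cont_deriv: "C1 u u' \<Longrightarrow> continuous_on {0..1} u'"
  by (simp add: C1_def)

lemma C1_cont: "C1 u u' \<Longrightarrow> continuous_on {0..1} u"
  unfolding C1_def by (auto intro: DERIV_continuous_on)

lemma C1_const: "C1 (\<lambda>x. c) (\<lambda>x. 0)"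
  by (auto simp: C1_def)

lemma C1_lin:
  assumes "C1 u u'" "C1 v v'"
  shows "C1 (\<lambda>x. c * u x + d * v x) (\<lambda>x. c * u' x + d * v' x)"
  using assms unfolding C1_def by (auto intro!: derivative_eq_intros continuous_intros)

lemma C1_affine: "C1 (\<lambda>x. p + x * q) (\<lambda>x. q)"
  by (auto simp: C1_def intro!: derivative_eq_intros)

lemma C1_sum:
  assumes "\<And>i. i \<in> I \<Longrightarrow> C1 (u i) (u' i)"
  shows "C1 (\<lambda>x. \<Sum>i\<in>I. c i * u i x) (\<lambda>x. \<Sum>i\<in>I. c i * u' i x)"
  using assms unfolding C1_def
  by (auto intro!: derivative_eq_intros continuous_intros simp: mult.commute)

lemma integrable01: "continuous_on {0..1::real} (f :: real \<Rightarrow> real) \<Longrightarrow> f integrable_on {0..1}"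
  by (rule integrable_continuous_real)

lemma integral01_lin:
  fixes f g :: "real \<Rightarrow> real"
  assumes "continuous_on {0..1} f" "continuous_on {0..1} g"
  shows "integral {0..1} (\<lambda>x. c * f x + d * g x) = c * integral {0..1} f + d * integral {0..1} g"
proof -
  have "((\<lambda>x. c * f x + d * g x) has_integral c * integral {0..1} f + d * integral {0..1} g) {0..1}"
    by (intro has_integral_add has_integral_mult_right integrable_integral integrable01 assms)
  then show ?thesis by (rule integral_unique)
qed

lemma integral01_sum:
  fixes f :: "'i \<Rightarrow> real \<Rightarrow> real"
  assumes "finite I" "\<And>i. i \<in> I \<Longrightarrow> continuous_on {0..1} (f i)"
  shows "integral {0..1} (\<lambda>x. \<Sum>i\<in>I. c i * f i x) = (\<Sum>i\<in>I. c i * integral {0..1} (f i))"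
proof -
  have "((\<lambda>x. \<Sum>i\<in>I. c i * f i x) has_integral (\<Sum>i\<in>I. c i * integral {0..1} (f i))) {0..1}"
    by (intro has_integral_sum has_integral_mult_right integrable_integral integrable01 assms)
  then show ?thesis by (rule integral_unique)
qed

lemma integral01_mono:
  fixes f g :: "real \<Rightarrow> real"
  assumes "continuous_on {0..1} f" "continuous_on {0..1} g" "\<And>x. x \<in> {0..1} \<Longrightarrow> f x \<le> g x"
  shows "integral {0..1} f \<le> integral {0..1} g"
  by (intro integral_le integrable01 assms)

lemma integral01_nonneg:
  fixes f :: "real \<Rightarrow> real"
  assumes "continuous_on {0..1} f" "\<And>x. x \<in> {0..1} \<Longrightarrow> 0 \<le> f x"
  shows "0 \<le> integral {0..1} f"
  by (intro integral_nonneg integrable01 assms)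

lemma integral01_eq_0_iff:
  fixes f :: "real \<Rightarrow> real"
  assumes "continuous_on {0..1} f" "\<And>x. x \<in> {0..1} \<Longrightarrow> 0 \<le> f x"
  shows "integral {0..1} f = 0 \<longleftrightarrow> (\<forall>x\<in>{0..1}. f x = 0)"
  using assms by (intro integral_eq_0_iff) auto

lemma integral01_by_parts:
  assumes u: "C1 u u'" and v: "C1 v v'"
  shows "integral {0..1} (\<lambda>x. u' x * v x) = u 1 * v 1 - u 0 * v 0 - integral {0..1} (\<lambda>x. u x * v' x)"
proof -
  have "((\<lambda>x. u' x * v x + u x * v' x) has_integral (u 1 * v 1 - u 0 * v 0)) {0..1}"
  proof (rule fundamental_theorem_of_calculus)
    fix x :: real assume "x \<in> {0..1}"
    with u v have "((\<lambda>x. u x * v x) has_real_derivative u' x * v x + u x * v' x) (at x within {0..1})"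
      by (auto simp: C1_def intro!: derivative_eq_intros)
    then show "((\<lambda>x. u x * v x) has_vector_derivative u' x * v x + u x * v' x) (at x within {0..1})"
      by (simp add: has_real_derivative_iff_has_vector_derivative)
  qed simp
  moreover have "integral {0..1} (\<lambda>x. 1 * (u' x * v x) + 1 * (u x * v' x)) =
      1 * integral {0..1} (\<lambda>x. u' x * v x) + 1 * integral {0..1} (\<lambda>x. u x * v' x)"
    by (intro integral01_lin continuous_on_mult C1_cont[OF u] C1_cont[OF v] C1_cont_deriv[OF u] C1_cont_deriv[OF v])
  ultimately show ?thesis by (simp add: integral_unique)
qed

text \<open>Solves the Dirichlet problem \<open>h'' = c\<close>: integrate twice, then correct the
  end values by an affine function. In \<open>weak_limit\<close> it provides both the comparison
  solution and the test function.\<close>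

lemma double_antiderivative:
  fixes c :: "real \<Rightarrow> real"
  assumes c: "continuous_on {0..1} c"
  obtains h h' where "C1 h h'" "C1 h' c" "h 0 = p" "h 1 = q"
proof -
  define k' where "k' x = integral {0..x} c" for x
  have k': "C1 k' c"
    unfolding C1_def k'_def using c by (auto intro: integral_has_real_derivative)
  define k where "k x = integral {0..x} k'" for x
  have k: "C1 k k'"
    unfolding C1_def k_def using C1_cont[OF k'] by (auto intro: integral_has_real_derivative)
  have "C1 (\<lambda>x. 1 * k x + 1 * (p + x * (q - p - k 1))) (\<lambda>x. 1 * k' x + 1 * (q - p - k 1))"
    by (rule C1_lin[OF k C1_affine])
  moreover have "C1 (\<lambda>x. 1 * k' x + 1 * (q - p - k 1)) (\<lambda>x. 1 * c x + 1 * 0)"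
    by (rule C1_lin[OF k' C1_const])
  moreover have "k 0 = 0" by (simp add: k_def)
  ultimately show ?thesis by (intro that[of "\<lambda>x. k x + (p + x * (q - p - k 1))"]) auto
qed

text \<open>Young's inequality replaces Cauchy--Schwarz in the Hoelder estimate.\<close>

lemma C1_modulus:
  assumes u: "C1 u u'" and C: "integral {0..1} (\<lambda>x. (u' x)\<^sup>2) \<le> C" and xy: "x \<in> {0..1}" "y \<in> {0..1}"
  shows "\<bar>u x - u y\<bar> \<le> sqrt \<bar>x - y\<bar> * (C + 1)"
proof -
  have *: "\<bar>u y - u x\<bar> \<le> sqrt (y - x) * (C + 1)" if "x < y" and xy: "x \<in> {0..1}" "y \<in> {0..1}" for x y
  proof -
    \<comment> \<open>This \<open>s\<close> balances the two terms of the bound below: over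
      \<open>{x..y}\<close> the constant \<open>1 / s\<close> integrates to
      \<open>(y - x) / s = s\<close>.\<close>
    define s where "s = sqrt (y - x)"
    have s: "s > 0" "s * s = y - x" using that by (auto simp: s_def)
    have sub: "{x..y} \<subseteq> {0..1}" using xy by auto
    have cont: "continuous_on {x..y} u'" using u sub by (meson C1_cont_deriv continuous_on_subset)
    have ft: "(u' has_integral (u y - u x)) {x..y}"
    proof (rule fundamental_theorem_of_calculus)
      fix z assume "z \<in> {x..y}"
      then have "(u has_real_derivative u' z) (at z within {x..y})"
        using u sub unfolding C1_def by (meson DERIV_subset subsetD)
      then show "(u has_vector_derivative u' z) (at z within {x..y})"
        by (simp add: has_real_derivative_iff_has_vector_derivative)
    qed (use that in simp)
    have young: "\<bar>z\<bar> \<le> s * z\<^sup>2 + 1 / s" for z :: real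
    proof -
      have "0 \<le> (s * \<bar>z\<bar> - 1)\<^sup>2" by simp
      then have "2 * (s * \<bar>z\<bar>) \<le> s\<^sup>2 * z\<^sup>2 + 1" by (simp add: power2_diff power_mult_distrib)
      moreover have "0 \<le> s * \<bar>z\<bar>" using s by simp
      moreover have "s * (s * z\<^sup>2 + 1 / s) = s\<^sup>2 * z\<^sup>2 + 1"
        using s by (simp add: distrib_left power2_eq_square mult.assoc)
      ultimately have "s * \<bar>z\<bar> \<le> s * (s * z\<^sup>2 + 1 / s)" by linarith
      then show ?thesis using s by simp
    qed
    have i1: "(\<lambda>z. s * (u' z)\<^sup>2 + 1 / s) integrable_on {x..y}"
      by (intro integrable_continuous_real continuous_intros cont)
    have "\<bar>u y - u x\<bar> = norm (integral {x..y} u')" using integral_unique[OF ft] by simp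
    also have "\<dots> \<le> integral {x..y} (\<lambda>z. s * (u' z)\<^sup>2 + 1 / s)"
      by (rule integral_norm_bound_integral) (use i1 ft young in \<open>auto intro: has_integral_integrable\<close>)
    also have "\<dots> = s * integral {x..y} (\<lambda>z. (u' z)\<^sup>2) + (y - x) / s"
    proof -
      have "((\<lambda>z. s * (u' z)\<^sup>2 + 1 / s) has_integral
          (s * integral {x..y} (\<lambda>z. (u' z)\<^sup>2) + measure lborel {x..y} *\<^sub>R (1 / s))) {x..y}"
        by (intro has_integral_add has_integral_mult_right integrable_integral has_integral_const_real
            integrable_continuous_real continuous_intros cont)
      then show ?thesis using that by (simp add: integral_unique)
    qed
    also have "(y - x) / s = s" using s by (simp add: field_simps)
    also have "integral {x..y} (\<lambda>z. (u' z)\<^sup>2) \<le> integral {0..1} (\<lambda>z. (u' z)\<^sup>2)"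
      by (intro integral_subset_le integrable_continuous_real continuous_intros cont C1_cont_deriv[OF u] sub) auto
    finally have "\<bar>u y - u x\<bar> \<le> s * integral {0..1} (\<lambda>z. (u' z)\<^sup>2) + s" using s by simp
    also have "\<dots> \<le> s * C + s" using C s by simp
    finally show ?thesis by (simp add: s_def algebra_simps)
  qed
  consider "x < y" | "x = y" | "y < x" by linarith
  then show ?thesis
    by cases (use *[of x y] *[of y x] xy in \<open>auto simp: abs_minus_commute abs_if split: if_splits\<close>)
qed

section \<open>Compactness and uniform limits on the unit interval\<close>

text \<open>Arzela-Ascoli for one index after the other, each time thinning out the previous
  subsequence; finitely many edges leave one subsequence for all. The modulus
  \<open>sqrt |x - y| * C\<close> is the one of \<open>C1_modulus\<close>.\<close>

lemma finite_family_subsequence: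
  fixes U :: "nat \<Rightarrow> 'i \<Rightarrow> real \<Rightarrow> real"
  assumes "finite I"
    and bd: "\<And>k i x. i \<in> I \<Longrightarrow> x \<in> {0..1} \<Longrightarrow> \<bar>U k i x\<bar> \<le> M"
    and eq: "\<And>k i x y. i \<in> I \<Longrightarrow> x \<in> {0..1} \<Longrightarrow> y \<in> {0..1} \<Longrightarrow> \<bar>U k i x - U k i y\<bar> \<le> sqrt \<bar>x - y\<bar> * C"
  shows "\<exists>r u. strict_mono (r :: nat \<Rightarrow> nat) \<and>
           (\<forall>i\<in>I. continuous_on {0..1} (u i) \<and> uniform_limit {0..1} (\<lambda>k. U (r k) i) (u i) sequentially)"
  using assms(1) bd eq
proof (induction I)
  case empty
  show ?case by (rule exI[of _ id]) (auto simp: strict_mono_def)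
next
  case (insert j I)
  have "\<exists>r u. strict_mono (r :: nat \<Rightarrow> nat) \<and>
           (\<forall>i\<in>I. continuous_on {0..1} (u i) \<and> uniform_limit {0..1} (\<lambda>k. U (r k) i) (u i) sequentially)"
    by (rule insert.IH) (use insert.prems in auto)
  then obtain r u where r: "strict_mono (r :: nat \<Rightarrow> nat)"
    and u: "\<And>i. i \<in> I \<Longrightarrow> continuous_on {0..1} (u i)"
      "\<And>i. i \<in> I \<Longrightarrow> uniform_limit {0..1} (\<lambda>k. U (r k) i) (u i) sequentially" by blast
  obtain v s where v: "continuous_on {0..1::real} v" and s: "strict_mono (s :: nat \<Rightarrow> nat)"
    and lim: "\<And>e. 0 < e \<Longrightarrow> \<exists>N. \<forall>n x. n \<ge> N \<and> x \<in> {0..1} \<longrightarrow> norm (U (r (s n)) j x - v x) < e"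
  proof (rule Arzela_Ascoli[of "{0..1::real}" "\<lambda>n. U (r n) j" M])
    show "norm (U (r n) j x) \<le> M" if "x \<in> {0..1}" for n x
      using insert.prems(1)[of j x] that by auto
    show "\<exists>d>0. \<forall>n y. y \<in> {0..1} \<and> norm (x - y) < d \<longrightarrow> norm (U (r n) j x - U (r n) j y) < e"
      if x: "x \<in> {0..1}" and e: "0 < e" for x e :: real
    proof (intro exI conjI allI impI)
      \<comment> \<open>\<open>C\<close> has no prescribed sign, so \<open>\<bar>C\<bar> + 1\<close>
        bounds it and is a safe divisor.\<close>
      define d where "d = (e / (\<bar>C\<bar> + 1))\<^sup>2"
      show "d > 0" using e by (simp add: d_def)
      fix n y assume y: "y \<in> {0..1} \<and> norm (x - y) < d"
      have "sqrt \<bar>x - y\<bar> < e / (\<bar>C\<bar> + 1)"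
        using y e unfolding d_def real_norm_def by (intro real_less_lsqrt) auto
      then have "sqrt \<bar>x - y\<bar> * (\<bar>C\<bar> + 1) < e" by (simp add: field_simps)
      moreover have "sqrt \<bar>x - y\<bar> * C \<le> sqrt \<bar>x - y\<bar> * (\<bar>C\<bar> + 1)" by (intro mult_left_mono) auto
      ultimately show "norm (U (r n) j x - U (r n) j y) < e"
        using insert.prems(2)[of j x y "r n"] x y by auto
    qed
  qed (auto)
  have "uniform_limit {0..1} (\<lambda>n. U (r (s n)) j) v sequentially"
    unfolding uniform_limit_sequentially_iff dist_norm using lim by blast
  moreover have "uniform_limit {0..1} (\<lambda>n. U (r (s n)) i) (u i) sequentially" if "i \<in> I" for i
    using filterlim_compose[OF u(2)[OF that] filterlim_subseq[OF s]]
    by simp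
  ultimately have "\<forall>i\<in>insert j I. continuous_on {0..1} ((u(j := v)) i) \<and>
      uniform_limit {0..1} (\<lambda>k. U ((r \<circ> s) k) i) ((u(j := v)) i) sequentially"
    using u(1) v insert.hyps(2) by simp
  then show ?case using strict_mono_o[OF r s] by blast
qed

lemma integral01_uniform_limit:
  fixes f :: "nat \<Rightarrow> real \<Rightarrow> real"
  assumes "uniform_limit {0..1} f g sequentially" "\<And>n. continuous_on {0..1} (f n)"
  shows "(\<lambda>n. integral {0..1} (f n)) \<longlonglongrightarrow> integral {0..1} g"
proof -
  obtain I J where "\<And>n. (f n has_integral I n) {0..1}" "(g has_integral J) {0..1}" "I \<longlonglongrightarrow> J"
    using uniform_limit_integral[OF assms] by auto
  moreover from this(1) have "I = (\<lambda>n. integral {0..1} (f n))"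
    by (intro ext integral_unique[symmetric])
  ultimately show ?thesis by (simp add: integral_unique)
qed

lemma uniform_limit_mult01:
  fixes f h :: "nat \<Rightarrow> real \<Rightarrow> real"
  assumes "uniform_limit {0..1} f g sequentially" "uniform_limit {0..1} h k sequentially"
    and "continuous_on {0..1} g" "continuous_on {0..1} k"
  shows "uniform_limit {0..1} (\<lambda>n x. f n x * h n x) (\<lambda>x. g x * k x) sequentially"
  by (intro uniform_lim_mult assms compact_imp_bounded compact_continuous_image) auto

text \<open>Gronwall: the energy \<open>f\<^sup>2 + f'\<^sup>2\<close> grows at most exponentially.\<close>

lemma linear_ode_unique:
  fixes f f' c :: "real \<Rightarrow> real"
  assumes f: "C1 f f'" and f': "C1 f' (\<lambda>x. c x * f x)" and c: "continuous_on {0..1} c"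
    and init: "f 0 = 0" "f' 0 = 0" and x: "x \<in> {0..1}"
  shows "f x = 0 \<and> f' x = 0"
proof -
  obtain K where K: "\<And>x. x \<in> {0..1} \<Longrightarrow> \<bar>c x\<bar> \<le> K"
    using compact_imp_bounded[OF compact_continuous_image[OF c]] by (force simp: bounded_iff)
  \<comment> \<open>\<open>L\<close> is the growth rate: the energy \<open>f^2 + f'^2\<close> has
    derivative \<open>2 f f' + 2 c f f'\<close>, and \<open>2 |f f'|\<close> never exceeds the
    energy. Hence \<open>H\<close> is nonincreasing.\<close>
  define L where "L = 1 + K"
  define H where "H x = exp (- L * x) * ((f x)\<^sup>2 + (f' x)\<^sup>2)" for x
  define H' where "H' x = exp (- L * x) * (2 * (f x * f' x) + 2 * (f' x * (c x * f x))
      - L * ((f x)\<^sup>2 + (f' x)\<^sup>2))" for x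
  have dH: "(H has_real_derivative H' y) (at y within {0..1})" if "y \<in> {0..1}" for y
    unfolding H_def H'_def using C1_deriv[OF f that] C1_deriv[OF f' that]
    by (auto intro!: derivative_eq_intros simp: algebra_simps)
  have neg: "H' y \<le> 0" if y: "y \<in> {0..1}" for y
  proof -
    have a: "2 * \<bar>f y * f' y\<bar> \<le> (f y)\<^sup>2 + (f' y)\<^sup>2"
      using sum_squares_bound[of "\<bar>f y\<bar>" "\<bar>f' y\<bar>"] by (simp add: abs_mult)
    have "2 * (f' y * (c y * f y)) \<le> \<bar>c y\<bar> * (2 * \<bar>f y * f' y\<bar>)"
      using abs_ge_self[of "2 * (f' y * (c y * f y))"] by (simp add: abs_mult algebra_simps)
    also have "\<dots> \<le> K * ((f y)\<^sup>2 + (f' y)\<^sup>2)"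
      using K[OF y] a by (intro mult_mono) auto
    finally have "2 * (f' y * (c y * f y)) \<le> K * ((f y)\<^sup>2 + (f' y)\<^sup>2)" .
    moreover have "2 * (f y * f' y) \<le> (f y)\<^sup>2 + (f' y)\<^sup>2" using a by (simp add: sum_squares_bound)
    ultimately have "2 * (f y * f' y) + 2 * (f' y * (c y * f y)) - L * ((f y)\<^sup>2 + (f' y)\<^sup>2) \<le> 0"
      unfolding L_def by (simp add: algebra_simps)
    then show ?thesis unfolding H'_def by (simp add: mult_nonneg_nonpos)
  qed
  have "H x \<le> H 0"
  proof (rule DERIV_nonpos_imp_decreasing_open[of 0 x H])
    have "continuous_on {0..1} H" using dH by (rule DERIV_continuous_on)
    then show "continuous_on {0..x} H" by (rule continuous_on_subset) (use x in auto)
    fix y assume "0 < y" "y < x"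
    then show "\<exists>z. (H has_real_derivative z) (at y) \<and> z \<le> 0"
      using dH[of y] neg[of y] x at_within_Icc_at[of 0 y 1] by (intro exI[of _ "H' y"]) auto
  qed (use x in auto)
  then have "(f x)\<^sup>2 + (f' x)\<^sup>2 \<le> 0" using init by (simp add: H_def mult_le_0_iff)
  then show ?thesis by (metis sum_power2_le_zero_iff)
qed

subsection \<open>Energy and mass forms\<close>

text \<open>Connectedness enters as the statement that a vertex function without jumps across edges
  is constant. In this form it identifies the functions of zero energy and later makes all edge
  lengths equal.\<close>

locale quantum_graph = fin_digraph G for G :: "('v, 'e) pre_digraph" +
  assumes arcs_nonempty: "arcs G \<noteq> {}"
    and connected_graph: "\<And>\<phi> :: 'v \<Rightarrow> real. (\<And>e. e \<in> arcs G \<Longrightarrow> \<phi> (tail G e) = \<phi> (head G e)) \<Longrightarrow>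
      \<exists>c. \<forall>e\<in>arcs G. \<phi> (tail G e) = c"
begin

text \<open>The derivative is an explicit second argument, so the forms below need no derivative
  operator. The existence of \<open>\<phi>\<close> is continuity at the vertices.\<close>

definition test_fun :: "('e \<Rightarrow> real \<Rightarrow> real) \<Rightarrow> ('e \<Rightarrow> real \<Rightarrow> real) \<Rightarrow> bool" where
  "test_fun u u' \<longleftrightarrow> (\<forall>e\<in>arcs G. C1 (u e) (u' e)) \<and>
     (\<exists>\<phi>. \<forall>e\<in>arcs G. u e 0 = \<phi> (tail G e) \<and> u e 1 = \<phi> (head G e))"

definition energy :: "('e \<Rightarrow> real) \<Rightarrow> ('e \<Rightarrow> real \<Rightarrow> real) \<Rightarrow> ('e \<Rightarrow> real \<Rightarrow> real) \<Rightarrow> real" where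
  "energy a p q = (\<Sum>e\<in>arcs G. a e * integral {0..1} (\<lambda>x. p e x * q e x))"

definition mass :: "('e \<Rightarrow> real \<Rightarrow> real) \<Rightarrow> ('e \<Rightarrow> real \<Rightarrow> real) \<Rightarrow> ('e \<Rightarrow> real \<Rightarrow> real) \<Rightarrow> real" where
  "mass w u v = (\<Sum>e\<in>arcs G. integral {0..1} (\<lambda>x. w e x * (u e x * v e x)))"

definition weights :: "('e \<Rightarrow> real) \<Rightarrow> ('e \<Rightarrow> real \<Rightarrow> real) \<Rightarrow> bool" where
  "weights a w \<longleftrightarrow> (\<forall>e\<in>arcs G. 0 < a e \<and> continuous_on {0..1} (w e) \<and> (\<forall>x\<in>{0..1}. 0 < w e x))"

text \<open>This is the equation \<open>(a u')' = - \<mu> w u\<close> with \<open>a\<close> constant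
  on each edge; \<open>a e * u'\<close> is the flux, and the last clause is the Kirchhoff
  condition.\<close>

definition eigfun ::
  "('e \<Rightarrow> real) \<Rightarrow> ('e \<Rightarrow> real \<Rightarrow> real) \<Rightarrow> real \<Rightarrow> ('e \<Rightarrow> real \<Rightarrow> real) \<Rightarrow> ('e \<Rightarrow> real \<Rightarrow> real) \<Rightarrow> bool" where
  "eigfun a w \<mu> u u' \<longleftrightarrow> test_fun u u' \<and>
     (\<forall>e\<in>arcs G. C1 (u' e) (\<lambda>x. - (\<mu> / a e) * (w e x * u e x))) \<and>
     (\<forall>v\<in>verts G. (\<Sum>e | e \<in> arcs G \<and> tail G e = v. a e * u' e 0) +
                  (\<Sum>e | e \<in> arcs G \<and> head G e = v. - (a e * u' e 1)) = 0)"

abbreviation edge_cont :: "('e \<Rightarrow> real \<Rightarrow> real) \<Rightarrow> bool" where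
  "edge_cont f \<equiv> \<forall>e\<in>arcs G. continuous_on {0..1} (f e)"

lemma test_fun_cont: "test_fun u u' \<Longrightarrow> edge_cont u"
  by (auto simp: test_fun_def intro: C1_cont)

lemma test_fun_cont_deriv: "test_fun u u' \<Longrightarrow> edge_cont u'"
  by (auto simp: test_fun_def intro: C1_cont_deriv)

lemma weights_cont: "weights a w \<Longrightarrow> edge_cont w"
  by (auto simp: weights_def)

lemma eigfun_test: "eigfun a w \<mu> u u' \<Longrightarrow> test_fun u u'"
  by (simp add: eigfun_def)

lemma test_fun_const: "test_fun (\<lambda>e x. c) (\<lambda>e x. 0)"
  by (auto simp: test_fun_def C1_const)

lemma test_fun_lin:
  assumes "test_fun u u'" "test_fun v v'"
  shows "test_fun (\<lambda>e x. c * u e x + d * v e x) (\<lambda>e x. c * u' e x + d * v' e x)"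
proof -
  obtain \<phi> \<psi> where "\<forall>e\<in>arcs G. u e 0 = \<phi> (tail G e) \<and> u e 1 = \<phi> (head G e)"
    "\<forall>e\<in>arcs G. v e 0 = \<psi> (tail G e) \<and> v e 1 = \<psi> (head G e)"
    using assms by (auto simp: test_fun_def)
  then show ?thesis using assms unfolding test_fun_def
    by (auto intro!: C1_lin exI[of _ "\<lambda>x. c * \<phi> x + d * \<psi> x"])
qed

lemma test_fun_vertex: "test_fun (\<lambda>e x. \<phi> (tail G e) + x * (\<phi> (head G e) - \<phi> (tail G e)))
    (\<lambda>e x. \<phi> (head G e) - \<phi> (tail G e))"
  unfolding test_fun_def by (auto intro: C1_affine)

lemma energy_commute: "energy a p q = energy a q p"
  by (simp add: energy_def mult.commute)

lemma mass_commute: "mass w u v = mass w v u"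
  by (simp add: mass_def mult.commute)

lemma energy_lin:
  assumes "edge_cont p" "edge_cont q" "edge_cont r"
  shows "energy a (\<lambda>e x. c * p e x + d * q e x) r = c * energy a p r + d * energy a q r"
proof -
  have "integral {0..1} (\<lambda>x. (c * p e x + d * q e x) * r e x) =
      c * integral {0..1} (\<lambda>x. p e x * r e x) + d * integral {0..1} (\<lambda>x. q e x * r e x)"
    if "e \<in> arcs G" for e
    using assms that
    by (subst integral01_lin[symmetric]) (auto intro!: continuous_intros simp: algebra_simps)
  then show ?thesis
    by (simp add: energy_def sum_distrib_left sum.distrib[symmetric] algebra_simps)
qed

lemma mass_lin:
  assumes "edge_cont w" "edge_cont p" "edge_cont q" "edge_cont r"
  shows "mass w (\<lambda>e x. c * p e x + d * q e x) r = c * mass w p r + d * mass w q r"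
proof -
  have "integral {0..1} (\<lambda>x. w e x * ((c * p e x + d * q e x) * r e x)) =
      c * integral {0..1} (\<lambda>x. w e x * (p e x * r e x)) + d * integral {0..1} (\<lambda>x. w e x * (q e x * r e x))"
    if "e \<in> arcs G" for e
    using assms that
    by (subst integral01_lin[symmetric]) (auto intro!: continuous_intros simp: algebra_simps)
  then show ?thesis
    by (simp add: mass_def sum_distrib_left sum.distrib[symmetric])
qed

lemma energy_quadratic:
  assumes "edge_cont p" "edge_cont q"
  shows "energy a (\<lambda>e x. c * p e x + d * q e x) (\<lambda>e x. c * p e x + d * q e x) =
    c\<^sup>2 * energy a p p + 2 * c * d * energy a p q + d\<^sup>2 * energy a q q"
proof -
  have 0: "edge_cont (\<lambda>e x. c * p e x + d * q e x)" using assms by (auto intro!: continuous_intros)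
  show ?thesis
    unfolding energy_lin[OF assms 0]
      energy_commute[of a p "\<lambda>e x. c * p e x + d * q e x"] energy_commute[of a q "\<lambda>e x. c * p e x + d * q e x"]
      energy_lin[OF assms assms(1)] energy_lin[OF assms assms(2)] energy_commute[of a q p]
    by (simp add: power2_eq_square algebra_simps)
qed

lemma mass_quadratic:
  assumes "edge_cont w" "edge_cont p" "edge_cont q"
  shows "mass w (\<lambda>e x. c * p e x + d * q e x) (\<lambda>e x. c * p e x + d * q e x) =
    c\<^sup>2 * mass w p p + 2 * c * d * mass w p q + d\<^sup>2 * mass w q q"
proof -
  have 0: "edge_cont (\<lambda>e x. c * p e x + d * q e x)" using assms by (auto intro!: continuous_intros)
  show ?thesis
    unfolding mass_lin[OF assms 0]
      mass_commute[of w p "\<lambda>e x. c * p e x + d * q e x"] mass_commute[of w q "\<lambda>e x. c * p e x + d * q e x"]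
      mass_lin[OF assms assms(2)] mass_lin[OF assms assms(3)] mass_commute[of w q p]
    by (simp add: power2_eq_square algebra_simps)
qed

lemma energy_nonneg:
  assumes "weights a w" "edge_cont p" shows "0 \<le> energy a p p"
  using assms unfolding energy_def weights_def
  by (intro sum_nonneg mult_nonneg_nonneg[OF _ integral01_nonneg]) (auto intro!: continuous_intros simp: less_imp_le)

lemma mass_nonneg:
  assumes "weights a w" "edge_cont p" shows "0 \<le> mass w p p"
  using assms unfolding mass_def weights_def
  by (intro sum_nonneg integral01_nonneg) (auto intro!: continuous_intros simp: less_imp_le)

lemma energy_eq_0D:
  assumes "weights a w" "edge_cont p" "energy a p p = 0" "e \<in> arcs G" "x \<in> {0..1}"
  shows "p e x = 0"
proof -
  have nn: "0 \<le> integral {0..1} (\<lambda>x. p e x * p e x)" if "e \<in> arcs G" for e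
    using assms(2) that by (intro integral01_nonneg) (auto intro!: continuous_intros)
  have "a e * integral {0..1} (\<lambda>x. p e x * p e x) = 0"
    using assms(1,3,4) nn unfolding energy_def weights_def
    by (subst (asm) sum_nonneg_eq_0_iff) (auto simp: less_imp_le)
  then have "integral {0..1} (\<lambda>x. p e x * p e x) = 0" using assms(1,4) by (auto simp: weights_def)
  then show ?thesis using assms(2,4,5)
    by (subst (asm) integral01_eq_0_iff) (auto intro!: continuous_intros)
qed

lemma mass_eq_0D:
  assumes "weights a w" "edge_cont p" "mass w p p = 0" "e \<in> arcs G" "x \<in> {0..1}"
  shows "p e x = 0"
proof -
  have nn: "0 \<le> integral {0..1} (\<lambda>x. w e x * (p e x * p e x))" if "e \<in> arcs G" for e
    using assms(1,2) that unfolding weights_def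
    by (intro integral01_nonneg) (auto intro!: continuous_intros simp: less_imp_le)
  have "integral {0..1} (\<lambda>x. w e x * (p e x * p e x)) = 0"
    using assms(3,4) nn unfolding mass_def
    by (subst (asm) sum_nonneg_eq_0_iff) auto
  then have "w e x * (p e x * p e x) = 0" using assms(1,2,4,5) unfolding weights_def
    by (subst (asm) integral01_eq_0_iff) (auto intro!: continuous_intros simp: less_imp_le)
  moreover have "w e x > 0" using assms by (auto simp: weights_def)
  ultimately show ?thesis by simp
qed

lemma mass_one_pos:
  assumes "weights a w" shows "0 < mass w (\<lambda>e x. 1) (\<lambda>e x. 1)"
proof -
  have "0 \<le> mass w (\<lambda>e x. 1) (\<lambda>e x. 1)" by (rule mass_nonneg[OF assms]) auto
  moreover have "mass w (\<lambda>e x. 1) (\<lambda>e x. 1) \<noteq> 0"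
    using mass_eq_0D[OF assms, of "\<lambda>e x. 1" _ 0] arcs_nonempty by auto
  ultimately show ?thesis by linarith
qed

lemma sum_heads: "(\<Sum>e\<in>arcs G. c e * \<phi> (head G e)) =
    (\<Sum>v\<in>verts G. \<phi> v * (\<Sum>e | e \<in> arcs G \<and> head G e = v. c e :: real))"
proof -
  have "(\<Sum>e\<in>arcs G. c e * \<phi> (head G e)) =
      (\<Sum>v\<in>verts G. \<Sum>e | e \<in> arcs G \<and> head G e = v. c e * \<phi> (head G e))"
    by (rule sum.group[symmetric]) auto
  then show ?thesis by (simp add: sum_distrib_left mult.commute)
qed

lemma sum_tails: "(\<Sum>e\<in>arcs G. c e * \<phi> (tail G e)) =
    (\<Sum>v\<in>verts G. \<phi> v * (\<Sum>e | e \<in> arcs G \<and> tail G e = v. c e :: real))"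
proof -
  have "(\<Sum>e\<in>arcs G. c e * \<phi> (tail G e)) =
      (\<Sum>v\<in>verts G. \<Sum>e | e \<in> arcs G \<and> tail G e = v. c e * \<phi> (tail G e))"
    by (rule sum.group[symmetric]) auto
  then show ?thesis by (simp add: sum_distrib_left mult.commute)
qed

text \<open>Summation by parts: the boundary terms of all edges are regrouped by vertices, and the
  bracket is the total flux out of \<open>v\<close>.\<close>

lemma kirchhoff_sum:
  "(\<Sum>e\<in>arcs G. a e * (p e 1 * \<phi> (head G e) - p e 0 * \<phi> (tail G e))) =
   - (\<Sum>v\<in>verts G. \<phi> v * ((\<Sum>e | e \<in> arcs G \<and> tail G e = v. a e * p e 0) +
                           (\<Sum>e | e \<in> arcs G \<and> head G e = v. - (a e * p e (1::real) :: real))))"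
  using sum_heads[of "\<lambda>e. a e * p e 1" \<phi>] sum_tails[of "\<lambda>e. a e * p e 0" \<phi>]
  by (simp add: algebra_simps sum_subtractf sum_negf sum.distrib)

text \<open>Integration by parts on one edge. The boundary terms stay, since they cancel only after
  summation over the edges at a vertex.\<close>

lemma edge_energy_parts:
  assumes \<phi>: "C1 \<phi> \<phi>'" and u: "C1 u' (\<lambda>x. - (\<mu> / a) * (w x * u x))" and a: "a \<noteq> 0"
    and cont: "continuous_on {0..1} w" "continuous_on {0..1} u"
  shows "a * integral {0..1} (\<lambda>x. u' x * \<phi>' x) =
    a * (u' 1 * \<phi> 1 - u' 0 * \<phi> 0) + \<mu> * integral {0..1} (\<lambda>x. w x * (u x * \<phi> x))"
proof -
  have "integral {0..1} (\<lambda>x. \<phi>' x * u' x) = \<phi> 1 * u' 1 - \<phi> 0 * u' 0 -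
      integral {0..1} (\<lambda>x. \<phi> x * (- (\<mu> / a) * (w x * u x)))"
    by (rule integral01_by_parts[OF \<phi> u])
  also have "(\<lambda>x. \<phi> x * (- (\<mu> / a) * (w x * u x))) = (\<lambda>x. - (\<mu> / a) * (w x * (u x * \<phi> x)))"
    by (auto simp: fun_eq_iff)
  also have "integral {0..1} \<dots> = - (\<mu> / a) * integral {0..1} (\<lambda>x. w x * (u x * \<phi> x))"
    by simp
  finally show ?thesis using a by (simp add: field_simps)
qed

text \<open>The boundary terms left by \<open>edge_energy_parts\<close> cancel at every vertex,
  because \<open>\<phi>\<close> has one value there and the fluxes of \<open>u\<close> add up to
  zero.\<close>

lemma eigfun_weak:
  assumes wt: "weights a w" and u: "eigfun a w \<mu> u u'" and \<phi>: "test_fun \<phi> \<phi>'"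
  shows "energy a u' \<phi>' = \<mu> * mass w u \<phi>"
proof -
  obtain f where f: "\<And>e. e \<in> arcs G \<Longrightarrow> \<phi> e 0 = f (tail G e)" "\<And>e. e \<in> arcs G \<Longrightarrow> \<phi> e 1 = f (head G e)"
    using \<phi> by (auto simp: test_fun_def)
  have "energy a u' \<phi>' = (\<Sum>e\<in>arcs G. a e * (u' e 1 * \<phi> e 1 - u' e 0 * \<phi> e 0) +
      \<mu> * integral {0..1} (\<lambda>x. w e x * (u e x * \<phi> e x)))"
    unfolding energy_def
    by (intro sum.cong refl edge_energy_parts)
      (use wt u \<phi> test_fun_cont[OF eigfun_test[OF u]] in \<open>auto simp: eigfun_def test_fun_def weights_def\<close>)
  also have "\<dots> = (\<Sum>e\<in>arcs G. a e * (u' e 1 * f (head G e) - u' e 0 * f (tail G e))) + \<mu> * mass w u \<phi>"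
    by (simp add: mass_def sum.distrib sum_distrib_left f)
  also have "(\<Sum>e\<in>arcs G. a e * (u' e 1 * f (head G e) - u' e 0 * f (tail G e))) = 0"
    unfolding kirchhoff_sum using u by (simp add: eigfun_def)
  finally show ?thesis by simp
qed

section \<open>Limits of asymptotically weak solutions\<close>

lemma mass_limit:
  assumes "\<And>e. e \<in> arcs G \<Longrightarrow> uniform_limit {0..1} (\<lambda>k. W k e) (w e) sequentially"
    and "\<And>e. e \<in> arcs G \<Longrightarrow> uniform_limit {0..1} (\<lambda>k. U k e) (u e) sequentially"
    and "\<And>e. e \<in> arcs G \<Longrightarrow> uniform_limit {0..1} (\<lambda>k. V k e) (v e) sequentially"
    and "\<And>k. edge_cont (W k)" "\<And>k. edge_cont (U k)" "\<And>k. edge_cont (V k)"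
    and "edge_cont w" "edge_cont u" "edge_cont v"
  shows "(\<lambda>k. mass (W k) (U k) (V k)) \<longlonglongrightarrow> mass w u v"
  unfolding mass_def
proof (intro tendsto_sum integral01_uniform_limit)
  fix e assume e: "e \<in> arcs G"
  show "uniform_limit {0..1} (\<lambda>k x. W k e x * (U k e x * V k e x)) (\<lambda>x. w e x * (u e x * v e x)) sequentially"
    by (intro uniform_limit_mult01 assms e) (use assms e in \<open>auto intro!: continuous_intros\<close>)
  show "continuous_on {0..1} (\<lambda>x. W k e x * (U k e x * V k e x))" for k
    using assms e by (auto intro!: continuous_intros)
qed

text \<open>A uniform limit of asymptotically weak solutions is a classical solution: on each edge compare
  the limit \<open>u\<close> with the classical solution \<open>h\<close> of the Dirichlet problem and test with the function
  solving \<open>\<phi>'' = u - h\<close> that vanishes at the vertices.\<close>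

lemma weak_limit:
  assumes wt: "weights a w"
    and U: "\<And>k. test_fun (U k) (U' k)"
    and Ul: "\<And>e. e \<in> arcs G \<Longrightarrow> uniform_limit {0..1} (\<lambda>k. U k e) (u e) sequentially"
    and A: "\<And>e. e \<in> arcs G \<Longrightarrow> (\<lambda>k. A k e) \<longlonglongrightarrow> a e"
    and W: "\<And>e. e \<in> arcs G \<Longrightarrow> uniform_limit {0..1} (\<lambda>k. W k e) (w e) sequentially" "\<And>k. edge_cont (W k)"
    and M: "M \<longlonglongrightarrow> \<mu>"
    and lim: "\<And>\<phi> \<phi>' \<phi>''. test_fun \<phi> \<phi>' \<Longrightarrow> (\<And>e. e \<in> arcs G \<Longrightarrow> C1 (\<phi>' e) (\<phi>'' e)) \<Longrightarrow>
      (\<lambda>k. energy (A k) (U' k) \<phi>' - M k * mass (W k) (U k) \<phi>) \<longlonglongrightarrow> 0"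
  obtains u' where "eigfun a w \<mu> u u'"
    and "\<And>\<phi>' \<phi>'' e. e \<in> arcs G \<Longrightarrow> C1 \<phi>' \<phi>'' \<Longrightarrow>
      (\<lambda>k. integral {0..1} (\<lambda>x. U' k e x * \<phi>' x)) \<longlonglongrightarrow> integral {0..1} (\<lambda>x. u' e x * \<phi>' x)"
proof -
  have Uc: "edge_cont (U k)" for k by (rule test_fun_cont[OF U])
  have uc: "edge_cont u"
  proof
    fix e assume e: "e \<in> arcs G"
    show "continuous_on {0..1} (u e)"
      by (rule uniform_limit_theorem[OF _ Ul[OF e]]) (use Uc e in auto)
  qed
  have wc: "edge_cont w" using wt by (rule weights_cont)
  have pt: "(\<lambda>k. U k e x) \<longlonglongrightarrow> u e x" if "e \<in> arcs G" "x \<in> {0..1}" for e x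
    using tendsto_uniform_limitI[OF Ul[OF that(1)] that(2)] .
  have "\<exists>\<phi>. \<forall>k. \<forall>e\<in>arcs G. U k e 0 = \<phi> k (tail G e) \<and> U k e 1 = \<phi> k (head G e)"
    using U unfolding test_fun_def by metis
  then obtain F where F: "\<And>k e. e \<in> arcs G \<Longrightarrow> U k e 0 = F k (tail G e)"
    "\<And>k e. e \<in> arcs G \<Longrightarrow> U k e 1 = F k (head G e)" by auto
  \<comment> \<open>Away from the ends of edges \<open>F k v\<close> need not converge;
    \<open>lim\<close> is then unspecified, but \<open>uv\<close> evaluates \<open>f\<close> only at
    ends of edges.\<close>
  define f where "f v = lim (\<lambda>k. F k v)" for v
  have uv: "u e 0 = f (tail G e)" "u e 1 = f (head G e)" if "e \<in> arcs G" for e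
    using pt[OF that, of 0] pt[OF that, of 1] F[OF that] unfolding f_def by (auto simp: limI)
  \<comment> \<open>The derivatives \<open>U' k\<close> are not known to converge pointwise.
    Integration by parts moves the derivative to the smooth factor, and uniform convergence of
    \<open>U k\<close> suffices.\<close>
  have partlim: "(\<lambda>k. integral {0..1} (\<lambda>x. U' k e x * \<phi>' x)) \<longlonglongrightarrow>
      u e 1 * \<phi>' 1 - u e 0 * \<phi>' 0 - integral {0..1} (\<lambda>x. u e x * \<phi>'' x)"
    if e: "e \<in> arcs G" and \<phi>: "C1 \<phi>' \<phi>''" for e \<phi>' \<phi>''
  proof -
    have "integral {0..1} (\<lambda>x. U' k e x * \<phi>' x) =
        U k e 1 * \<phi>' 1 - U k e 0 * \<phi>' 0 - integral {0..1} (\<lambda>x. U k e x * \<phi>'' x)" for k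
      by (rule integral01_by_parts) (use U e \<phi> in \<open>auto simp: test_fun_def\<close>)
    moreover have "(\<lambda>k. U k e 1 * \<phi>' 1 - U k e 0 * \<phi>' 0 - integral {0..1} (\<lambda>x. U k e x * \<phi>'' x)) \<longlonglongrightarrow>
      u e 1 * \<phi>' 1 - u e 0 * \<phi>' 0 - integral {0..1} (\<lambda>x. u e x * \<phi>'' x)"
      by (intro tendsto_intros pt e integral01_uniform_limit uniform_limit_mult01 Ul)
        (use uc Uc e C1_cont_deriv[OF \<phi>] in \<open>auto intro!: continuous_intros uniform_limit_const\<close>)
    ultimately show ?thesis by simp
  qed
  \<comment> \<open>A very weak form of the limit equation: \<open>u\<close> is not yet known to be
    differentiable, so all derivatives stand on \<open>\<phi>\<close>.\<close>
  have weak: "(\<Sum>e\<in>arcs G. a e * (u e 1 * \<phi>' e 1 - u e 0 * \<phi>' e 0 - integral {0..1} (\<lambda>x. u e x * \<phi>'' e x)))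
      = \<mu> * mass w u \<phi>"
    if \<phi>: "test_fun \<phi> \<phi>'" "\<And>e. e \<in> arcs G \<Longrightarrow> C1 (\<phi>' e) (\<phi>'' e)" for \<phi> \<phi>' \<phi>''
  proof -
    have "(\<lambda>k. mass (W k) (U k) \<phi>) \<longlonglongrightarrow> mass w u \<phi>"
      by (rule mass_limit[where V = "\<lambda>k. \<phi>"])
        (use W Ul Uc wc uc test_fun_cont[OF \<phi>(1)] in \<open>auto intro!: uniform_limit_const\<close>)
    moreover have "(\<lambda>k. energy (A k) (U' k) \<phi>') \<longlonglongrightarrow>
       (\<Sum>e\<in>arcs G. a e * (u e 1 * \<phi>' e 1 - u e 0 * \<phi>' e 0 - integral {0..1} (\<lambda>x. u e x * \<phi>'' e x)))"
      unfolding energy_def by (intro tendsto_sum tendsto_mult A partlim \<phi>(2))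
    ultimately have "(\<lambda>k. energy (A k) (U' k) \<phi>' - M k * mass (W k) (U k) \<phi>) \<longlonglongrightarrow>
       (\<Sum>e\<in>arcs G. a e * (u e 1 * \<phi>' e 1 - u e 0 * \<phi>' e 0 - integral {0..1} (\<lambda>x. u e x * \<phi>'' e x))) -
       \<mu> * mass w u \<phi>" by (intro tendsto_diff tendsto_mult M)
    from LIMSEQ_unique[OF this lim[OF \<phi>]] show ?thesis by simp
  qed
  have "\<exists>u'. C1 (u e) u' \<and> C1 u' (\<lambda>x. - (\<mu> / a e) * (w e x * u e x))" if e: "e \<in> arcs G" for e
  proof -
    have ae: "a e > 0" using wt e by (auto simp: weights_def)
    have cc: "continuous_on {0..1} (u e)" "continuous_on {0..1} (w e)" using uc wc e by auto
    obtain h h' where h: "C1 h h'" "C1 h' (\<lambda>x. - (\<mu> / a e) * (w e x * u e x))" "h 0 = u e 0" "h 1 = u e 1"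
      by (rule double_antiderivative[of "\<lambda>x. - (\<mu> / a e) * (w e x * u e x)" "u e 0" "u e 1"])
        (use cc ae in \<open>auto intro!: continuous_intros\<close>)
    have hc: "continuous_on {0..1} h" by (rule C1_cont[OF h(1)])
    obtain \<psi> \<psi>' where \<psi>: "C1 \<psi> \<psi>'" "C1 \<psi>' (\<lambda>x. u e x - h x)" "\<psi> 0 = 0" "\<psi> 1 = 0"
      by (rule double_antiderivative[of "\<lambda>x. u e x - h x" 0 0]) (use cc hc in \<open>auto intro!: continuous_intros\<close>)
    define \<Phi> where "\<Phi> = (\<lambda>e' x. if e' = e then \<psi> x else 0)"
    define \<Phi>' where "\<Phi>' = (\<lambda>e' x. if e' = e then \<psi>' x else 0)"
    define \<Phi>'' where "\<Phi>'' = (\<lambda>e' x. if e' = e then u e x - h x else 0)"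
    have "C1 (\<Phi> e') (\<Phi>' e')" for e'
      using \<psi> C1_const[of 0] by (cases "e' = e") (auto simp: \<Phi>_def \<Phi>'_def)
    then have "test_fun \<Phi> \<Phi>'" unfolding test_fun_def
      using \<psi> by (auto simp: \<Phi>_def intro!: exI[of _ "\<lambda>_. 0"])
    moreover have "C1 (\<Phi>' e') (\<Phi>'' e')" for e'
      using \<psi> C1_const[of 0] by (cases "e' = e") (auto simp: \<Phi>'_def \<Phi>''_def)
    ultimately have eq: "(\<Sum>e\<in>arcs G. a e * (u e 1 * \<Phi>' e 1 - u e 0 * \<Phi>' e 0 - integral {0..1} (\<lambda>x. u e x * \<Phi>'' e x)))
      = \<mu> * mass w u \<Phi>" by (rule weak)
    have "(\<Sum>e'\<in>arcs G. a e' * (u e' 1 * \<Phi>' e' 1 - u e' 0 * \<Phi>' e' 0 - integral {0..1} (\<lambda>x. u e' x * \<Phi>'' e' x))) =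
      (\<Sum>e'\<in>arcs G. if e' = e then a e * (u e 1 * \<psi>' 1 - u e 0 * \<psi>' 0 - integral {0..1} (\<lambda>x. u e x * (u e x - h x))) else 0)"
      by (rule sum.cong) (auto simp: \<Phi>'_def \<Phi>''_def)
    moreover have "mass w u \<Phi> = (\<Sum>e'\<in>arcs G. if e' = e then integral {0..1} (\<lambda>x. w e x * (u e x * \<psi> x)) else 0)"
      unfolding mass_def by (rule sum.cong) (auto simp: \<Phi>_def)
    ultimately have 1: "a e * (u e 1 * \<psi>' 1 - u e 0 * \<psi>' 0 - integral {0..1} (\<lambda>x. u e x * (u e x - h x))) =
      \<mu> * integral {0..1} (\<lambda>x. w e x * (u e x * \<psi> x))"
      using eq e by (simp add: sum.delta)
    have 2: "a e * integral {0..1} (\<lambda>x. h' x * \<psi>' x) = \<mu> * integral {0..1} (\<lambda>x. w e x * (u e x * \<psi> x))"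
      using edge_energy_parts[OF \<psi>(1) h(2)] ae cc \<psi>(3,4) by auto
    have 3: "integral {0..1} (\<lambda>x. h' x * \<psi>' x) =
        u e 1 * \<psi>' 1 - u e 0 * \<psi>' 0 - integral {0..1} (\<lambda>x. h x * (u e x - h x))"
      using integral01_by_parts[OF h(1) \<psi>(2)] h(3,4) by simp
    \<comment> \<open>By the three preceding identities \<open>u e\<close> and \<open>h\<close> have
      the same integral against the second derivative \<open>u e - h\<close> of the test function,
      so the integral of \<open>(u e - h)^2\<close> vanishes.\<close>
    have "integral {0..1} (\<lambda>x. u e x * (u e x - h x)) = integral {0..1} (\<lambda>x. h x * (u e x - h x))"
    proof -
      have "a e * (u e 1 * \<psi>' 1 - u e 0 * \<psi>' 0 - integral {0..1} (\<lambda>x. u e x * (u e x - h x))) =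
          a e * integral {0..1} (\<lambda>x. h' x * \<psi>' x)" unfolding 1 2 ..
      then have "u e 1 * \<psi>' 1 - u e 0 * \<psi>' 0 - integral {0..1} (\<lambda>x. u e x * (u e x - h x)) =
          integral {0..1} (\<lambda>x. h' x * \<psi>' x)" using ae by (subst (asm) mult_cancel_left) auto
      then show ?thesis unfolding 3 by linarith
    qed
    moreover have "integral {0..1} (\<lambda>x. 1 * (u e x * (u e x - h x)) + (-1) * (h x * (u e x - h x))) =
      1 * integral {0..1} (\<lambda>x. u e x * (u e x - h x)) + (-1) * integral {0..1} (\<lambda>x. h x * (u e x - h x))"
      by (rule integral01_lin) (use cc hc in \<open>auto intro!: continuous_intros\<close>)
    moreover have "(\<lambda>x. 1 * (u e x * (u e x - h x)) + (-1) * (h x * (u e x - h x))) = (\<lambda>x. (u e x - h x)\<^sup>2)"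
      by (auto simp: fun_eq_iff power2_eq_square algebra_simps)
    ultimately have "integral {0..1} (\<lambda>x. (u e x - h x)\<^sup>2) = 0" by simp
    then have uh: "u e x = h x" if "x \<in> {0..1}" for x
      using that cc hc by (subst (asm) integral01_eq_0_iff) (auto intro!: continuous_intros)
    have "C1 (u e) h'" unfolding C1_def
    proof (intro conjI ballI)
      fix x :: real assume x: "x \<in> {0..1}"
      show "(u e has_real_derivative h' x) (at x within {0..1})"
        by (rule has_field_derivative_transform_within[OF C1_deriv[OF h(1) x] zero_less_one x]) (use uh in auto)
    qed (rule C1_cont_deriv[OF h(1)])
    with h(2) show ?thesis by blast
  qed
  then obtain u' where u': "\<And>e. e \<in> arcs G \<Longrightarrow> C1 (u e) (u' e)"
    "\<And>e. e \<in> arcs G \<Longrightarrow> C1 (u' e) (\<lambda>x. - (\<mu> / a e) * (w e x * u e x))" by metis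
  have tu: "test_fun u u'" using u'(1) uv by (auto simp: test_fun_def)
  have kir: "(\<Sum>e | e \<in> arcs G \<and> tail G e = v. a e * u' e 0) +
             (\<Sum>e | e \<in> arcs G \<and> head G e = v. - (a e * u' e 1)) = 0" if v: "v \<in> verts G" for v
  proof -
    \<comment> \<open>The piecewise affine hat function at \<open>v\<close> isolates the flux
      balance of this single vertex.\<close>
    define \<delta> where "\<delta> z = (if z = v then 1 else (0::real))" for z
    define \<Phi> where "\<Phi> = (\<lambda>e x. \<delta> (tail G e) + x * (\<delta> (head G e) - \<delta> (tail G e)))"
    define \<Phi>' where "\<Phi>' = (\<lambda>e (x::real). \<delta> (head G e) - \<delta> (tail G e))"
    have t: "test_fun \<Phi> \<Phi>'" unfolding \<Phi>_def \<Phi>'_def by (rule test_fun_vertex)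
    have c: "C1 (\<Phi>' e) (\<lambda>x. 0)" for e unfolding \<Phi>'_def by (rule C1_const)
    have "a e * (u e 1 * \<Phi>' e 1 - u e 0 * \<Phi>' e 0 - integral {0..1} (\<lambda>x. u e x * 0)) =
        a e * (u' e 1 * \<Phi> e 1 - u' e 0 * \<Phi> e 0) + \<mu> * integral {0..1} (\<lambda>x. w e x * (u e x * \<Phi> e x))"
      if e: "e \<in> arcs G" for e
    proof -
      have "integral {0..1} (\<lambda>x. u' e x * \<Phi>' e x) =
          u e 1 * \<Phi>' e 1 - u e 0 * \<Phi>' e 0 - integral {0..1} (\<lambda>x. u e x * 0)"
        by (rule integral01_by_parts[OF u'(1)[OF e] c])
      moreover have "a e * integral {0..1} (\<lambda>x. u' e x * \<Phi>' e x) = a e * (u' e 1 * \<Phi> e 1 - u' e 0 * \<Phi> e 0) +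
          \<mu> * integral {0..1} (\<lambda>x. w e x * (u e x * \<Phi> e x))"
        by (rule edge_energy_parts)
          (use t u' e wc uc wt in \<open>auto simp: test_fun_def weights_def\<close>)
      ultimately show ?thesis by simp
    qed
    then have "(\<Sum>e\<in>arcs G. a e * (u e 1 * \<Phi>' e 1 - u e 0 * \<Phi>' e 0 - integral {0..1} (\<lambda>x. u e x * 0))) =
       (\<Sum>e\<in>arcs G. a e * (u' e 1 * \<Phi> e 1 - u' e 0 * \<Phi> e 0)) + \<mu> * mass w u \<Phi>"
      by (simp add: mass_def sum.distrib sum_distrib_left)
    then have "(\<Sum>e\<in>arcs G. a e * (u' e 1 * \<Phi> e 1 - u' e 0 * \<Phi> e 0)) = 0"
      using weak[OF t c] by simp
    then have "(\<Sum>e\<in>arcs G. a e * (u' e 1 * \<delta> (head G e) - u' e 0 * \<delta> (tail G e))) = 0"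
      by (simp add: \<Phi>_def)
    then have "(\<Sum>z\<in>verts G. \<delta> z * ((\<Sum>e | e \<in> arcs G \<and> tail G e = z. a e * u' e 0) +
             (\<Sum>e | e \<in> arcs G \<and> head G e = z. - (a e * u' e 1)))) = 0"
      unfolding kirchhoff_sum by simp
    moreover have "(\<Sum>z\<in>verts G. \<delta> z * H z) = H v" for H :: "'v \<Rightarrow> real"
    proof -
      have "(\<Sum>z\<in>verts G. \<delta> z * H z) = (\<Sum>z\<in>verts G. if z = v then H v else 0)"
        by (rule sum.cong) (auto simp: \<delta>_def)
      then show ?thesis using v by (simp add: sum.delta)
    qed
    ultimately show ?thesis by simp
  qed
  show thesis
  proof (rule that[of u'])
    show "eigfun a w \<mu> u u'" unfolding eigfun_def using tu u'(2) kir by blast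
    fix \<phi>' \<phi>'' e assume e: "e \<in> arcs G" and \<phi>: "C1 \<phi>' \<phi>''"
    show "(\<lambda>k. integral {0..1} (\<lambda>x. U' k e x * \<phi>' x)) \<longlonglongrightarrow> integral {0..1} (\<lambda>x. u' e x * \<phi>' x)"
      using partlim[OF e \<phi>] integral01_by_parts[OF u'(1)[OF e] \<phi>] by simp
  qed
qed

subsection \<open>The first positive eigenvalue\<close>

lemma weights_lower_bound:
  assumes wt: "weights a w"
  obtains c where "0 < c" "\<And>e. e \<in> arcs G \<Longrightarrow> c \<le> a e"
    "\<And>e x. e \<in> arcs G \<Longrightarrow> x \<in> {0..1} \<Longrightarrow> c \<le> w e x"
proof -
  have "\<exists>m>0. m \<le> a e \<and> (\<forall>x\<in>{0..1}. m \<le> w e x)" if e: "e \<in> arcs G" for e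
  proof -
    obtain y where y: "y \<in> {0..1}" "\<And>z. z \<in> {0..1} \<Longrightarrow> w e y \<le> w e z"
      using continuous_attains_inf[of "{0..1::real}" "w e"] wt e by (auto simp: weights_def)
    then show ?thesis using wt e by (intro exI[of _ "min (a e) (w e y)"]) (auto simp: weights_def min_le_iff_disj)
  qed
  then obtain m where m: "\<And>e. e \<in> arcs G \<Longrightarrow> 0 < m e \<and> m e \<le> a e \<and> (\<forall>x\<in>{0..1}. m e \<le> w e x)"
    by metis
  define c where "c = Min (m ` arcs G)"
  have le: "c \<le> m e" if "e \<in> arcs G" for e using that by (simp add: c_def)
  have "0 < c" using m arcs_nonempty by (auto simp: c_def)
  then show thesis
  proof (intro that[of c])
    fix e assume e: "e \<in> arcs G"
    show "c \<le> a e" using le[OF e] m[OF e] by linarith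
    show "c \<le> w e x" if "x \<in> {0..1}" for x using le[OF e] m[OF e] that by fastforce
  qed
qed

text \<open>The mass bound forces \<open>(v e y)^2 \<le> K / c\<close> at some point of the edge,
  and the energy bound limits the oscillation away from that point.\<close>

lemma edge_bounds:
  assumes wt: "weights a w" and v: "test_fun v v'" and c: "0 < c"
    and ac: "\<And>e. e \<in> arcs G \<Longrightarrow> c \<le> a e"
    and wc: "\<And>e x. e \<in> arcs G \<Longrightarrow> x \<in> {0..1} \<Longrightarrow> c \<le> w e x"
    and K: "energy a v' v' \<le> K" "mass w v v \<le> K" and e: "e \<in> arcs G"
  shows "integral {0..1} (\<lambda>x. (v' e x)\<^sup>2) \<le> K / c"
    and "x \<in> {0..1} \<Longrightarrow> \<bar>v e x\<bar> \<le> 2 * (K / c + 1)"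
proof -
  have cv: "edge_cont v" "edge_cont v'" using v test_fun_cont test_fun_cont_deriv by auto
  have ca: "edge_cont w" using wt by (rule weights_cont)
  have nn: "0 \<le> integral {0..1} (\<lambda>x. v' e x * v' e x)" if "e \<in> arcs G" for e
    using cv that by (intro integral01_nonneg) (auto intro!: continuous_intros)
  have "c * integral {0..1} (\<lambda>x. v' e x * v' e x) \<le> a e * integral {0..1} (\<lambda>x. v' e x * v' e x)"
    using nn[OF e] ac[OF e] by (rule mult_right_mono[rotated])
  also have "\<dots> \<le> energy a v' v'" unfolding energy_def
    by (rule member_le_sum[OF e]) (use nn wt in \<open>auto simp: weights_def less_imp_le\<close>)
  finally have "c * integral {0..1} (\<lambda>x. v' e x * v' e x) \<le> K" using K by linarith
  then show I: "integral {0..1} (\<lambda>x. (v' e x)\<^sup>2) \<le> K / c" using c by (simp add: field_simps power2_eq_square)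
  have mn: "0 \<le> integral {0..1} (\<lambda>x. w e x * (v e x * v e x))" if "e \<in> arcs G" for e
    using cv ca wt that by (intro integral01_nonneg) (auto simp: weights_def less_imp_le intro!: continuous_intros)
  have me: "integral {0..1} (\<lambda>x. w e x * (v e x * v e x)) \<le> K"
    using member_le_sum[OF e, of "\<lambda>e. integral {0..1} (\<lambda>x. w e x * (v e x * v e x))"] mn K(2)
    unfolding mass_def by auto
  have "\<exists>y\<in>{0..1}. (v e y)\<^sup>2 \<le> K / c"
  proof (rule ccontr)
    assume "\<not> ?thesis"
    then have gt: "K / c < (v e y)\<^sup>2" if "y \<in> {0..1}" for y using that by (auto simp: not_le)
    have "continuous_on {0..1} (\<lambda>x. w e x * (v e x * v e x))"
      using cv ca e by (auto intro!: continuous_intros)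
    then obtain y where y: "y \<in> {0..1}" "\<And>z. z \<in> {0..1} \<Longrightarrow> w e y * (v e y * v e y) \<le> w e z * (v e z * v e z)"
      using continuous_attains_inf[of "{0..1::real}" "\<lambda>x. w e x * (v e x * v e x)"] by auto
    have "K < c * (v e y)\<^sup>2" using gt[OF y(1)] c by (simp add: field_simps)
    also have "\<dots> \<le> w e y * (v e y * v e y)"
      using wc[OF e y(1)] by (simp add: power2_eq_square mult_right_mono)
    also have "\<dots> = integral {0..1::real} (\<lambda>z. w e y * (v e y * v e y))" by simp
    also have "\<dots> \<le> integral {0..1} (\<lambda>x. w e x * (v e x * v e x))"
      by (rule integral01_mono) (use y cv ca e in \<open>auto intro!: continuous_intros\<close>)
    finally show False using me by linarith
  qed
  then obtain y where y: "y \<in> {0..1}" "(v e y)\<^sup>2 \<le> K / c" by auto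
  have "\<bar>v e y\<bar> \<le> K / c + 1"
  proof -
    have "0 \<le> (\<bar>v e y\<bar> - 1)\<^sup>2" by simp
    then have "2 * \<bar>v e y\<bar> \<le> (v e y)\<^sup>2 + 1" by (simp add: power2_diff)
    then show ?thesis using y by simp
  qed
  moreover have "\<bar>v e x - v e y\<bar> \<le> K / c + 1" if "x \<in> {0..1}" for x
  proof -
    have "\<bar>v e x - v e y\<bar> \<le> sqrt \<bar>x - y\<bar> * (K / c + 1)"
      by (rule C1_modulus[OF _ I that y(1)]) (use v e in \<open>auto simp: test_fun_def\<close>)
    also have "\<dots> \<le> 1 * (K / c + 1)"
      using that y order_trans[OF zero_le_power2 y(2)] by (intro mult_right_mono) auto
    finally show ?thesis by simp
  qed
  ultimately show "\<bar>v e x\<bar> \<le> 2 * (K / c + 1)" if "x \<in> {0..1}" using that by fastforce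
qed

text \<open>The weights may vary with \<open>k\<close>, so that one statement serves a minimising
  sequence for fixed weights as well as eigenfunctions of perturbed weights. The common lower bound
  \<open>c\<close> makes the functions equicontinuous.\<close>

lemma weak_compactness:
  assumes wt: "weights a w" and wtk: "\<And>k. weights (A k) (W k)"
    and U: "\<And>k. test_fun (U k) (U' k)" and c: "0 < c"
    and Ac: "\<And>k e. e \<in> arcs G \<Longrightarrow> c \<le> A k e"
    and Wc: "\<And>k e x. e \<in> arcs G \<Longrightarrow> x \<in> {0..1} \<Longrightarrow> c \<le> W k e x"
    and K: "\<And>k. energy (A k) (U' k) (U' k) \<le> K" "\<And>k. mass (W k) (U k) (U k) \<le> K"
    and A: "\<And>e. e \<in> arcs G \<Longrightarrow> (\<lambda>k. A k e) \<longlonglongrightarrow> a e"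
    and W: "\<And>e. e \<in> arcs G \<Longrightarrow> uniform_limit {0..1} (\<lambda>k. W k e) (w e) sequentially"
    and M: "M \<longlonglongrightarrow> \<mu>"
    and lim: "\<And>\<phi> \<phi>'. test_fun \<phi> \<phi>' \<Longrightarrow>
      (\<lambda>k. energy (A k) (U' k) \<phi>' - M k * mass (W k) (U k) \<phi>) \<longlonglongrightarrow> 0"
  obtains r u u' where "strict_mono (r :: nat \<Rightarrow> nat)" "eigfun a w \<mu> u u'"
    and "\<And>e. e \<in> arcs G \<Longrightarrow> uniform_limit {0..1} (\<lambda>k. U (r k) e) (u e) sequentially"
    and "\<And>\<phi>' \<phi>'' e. e \<in> arcs G \<Longrightarrow> C1 \<phi>' \<phi>'' \<Longrightarrow>
      (\<lambda>k. integral {0..1} (\<lambda>x. U' (r k) e x * \<phi>' x)) \<longlonglongrightarrow> integral {0..1} (\<lambda>x. u' e x * \<phi>' x)"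
proof -
  have "\<exists>r u. strict_mono (r :: nat \<Rightarrow> nat) \<and>
     (\<forall>e\<in>arcs G. continuous_on {0..1} (u e) \<and> uniform_limit {0..1} (\<lambda>k. U (r k) e) (u e) sequentially)"
  proof (rule finite_family_subsequence)
    fix k e and x y :: real assume e: "e \<in> arcs G" and x: "x \<in> {0..1}"
    show "\<bar>U k e x\<bar> \<le> 2 * (K / c + 1)"
      by (rule edge_bounds(2)[OF wtk U c Ac Wc K e x])
    assume y: "y \<in> {0..1}"
    show "\<bar>U k e x - U k e y\<bar> \<le> sqrt \<bar>x - y\<bar> * (K / c + 1)"
      by (rule C1_modulus[OF _ edge_bounds(1)[OF wtk U c Ac Wc K e] x y]) (use U e in \<open>auto simp: test_fun_def\<close>)
  qed simp
  then obtain r u where r: "strict_mono (r :: nat \<Rightarrow> nat)"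
    and Ul: "\<And>e. e \<in> arcs G \<Longrightarrow> uniform_limit {0..1} (\<lambda>k. U (r k) e) (u e) sequentially" by blast
  note sub = filterlim_subseq[OF r]
  obtain u' where "eigfun a w \<mu> u u'"
    and "\<And>\<phi>' \<phi>'' e. e \<in> arcs G \<Longrightarrow> C1 \<phi>' \<phi>'' \<Longrightarrow>
      (\<lambda>k. integral {0..1} (\<lambda>x. U' (r k) e x * \<phi>' x)) \<longlonglongrightarrow> integral {0..1} (\<lambda>x. u' e x * \<phi>' x)"
  proof (rule weak_limit[OF wt, where U = "\<lambda>k. U (r k)" and U' = "\<lambda>k. U' (r k)" and A = "\<lambda>k. A (r k)"
          and W = "\<lambda>k. W (r k)" and M = "\<lambda>k. M (r k)" and u = u and \<mu> = \<mu>])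
    show "(\<lambda>k. A (r k) e) \<longlonglongrightarrow> a e" if "e \<in> arcs G" for e
      by (rule filterlim_compose[OF A[OF that] sub])
    show "uniform_limit {0..1} (\<lambda>k. W (r k) e) (w e) sequentially" if "e \<in> arcs G" for e
      by (rule filterlim_compose[OF W[OF that] sub])
    show "(\<lambda>k. M (r k)) \<longlonglongrightarrow> \<mu>" by (rule filterlim_compose[OF M sub])
    show "edge_cont (W (r k))" for k by (rule weights_cont[OF wtk])
    show "(\<lambda>k. energy (A (r k)) (U' (r k)) \<phi>' - M (r k) * mass (W (r k)) (U (r k)) \<phi>) \<longlonglongrightarrow> 0"
      if "test_fun \<phi> \<phi>'" for \<phi> \<phi>'
      by (rule filterlim_compose[OF lim[OF that] sub])
  qed (use U Ul in auto)
  with r Ul show thesis using that[of r u u'] by blast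
qed

text \<open>For eigenfunctions the energy is \<open>M k\<close> times the mass, so the energies
  converge to that of the limit; weak convergence together with convergence of norms is strong
  convergence. Convergence on each edge separately is needed because the first variation weights the
  edges differently.\<close>

lemma eigfun_compactness:
  assumes wt: "weights a w" and wtk: "\<And>k. weights (A k) (W k)"
    and U: "\<And>k. eigfun (A k) (W k) (M k) (U k) (U' k)" and c: "0 < c"
    and Ac: "\<And>k e. e \<in> arcs G \<Longrightarrow> c \<le> A k e"
    and Wc: "\<And>k e x. e \<in> arcs G \<Longrightarrow> x \<in> {0..1} \<Longrightarrow> c \<le> W k e x"
    and K: "\<And>k. mass (W k) (U k) (U k) \<le> K"
    and A: "\<And>e. e \<in> arcs G \<Longrightarrow> (\<lambda>k. A k e) \<longlonglongrightarrow> a e"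
    and W: "\<And>e. e \<in> arcs G \<Longrightarrow> uniform_limit {0..1} (\<lambda>k. W k e) (w e) sequentially"
    and M: "M \<longlonglongrightarrow> \<mu>"
  obtains r u u' where "strict_mono (r :: nat \<Rightarrow> nat)" "eigfun a w \<mu> u u'"
    and "\<And>e. e \<in> arcs G \<Longrightarrow> uniform_limit {0..1} (\<lambda>k. U (r k) e) (u e) sequentially"
    and "\<And>e. e \<in> arcs G \<Longrightarrow>
      (\<lambda>k. integral {0..1} (\<lambda>x. U' (r k) e x * U' (r k) e x)) \<longlonglongrightarrow> integral {0..1} (\<lambda>x. u' e x * u' e x)"
proof -
  have tU: "test_fun (U k) (U' k)" for k by (rule eigfun_test[OF U])
  obtain L where L: "\<And>k. \<bar>M k\<bar> \<le> L" using convergent_imp_Bseq[OF convergentI[OF M]] by (auto simp: Bseq_def)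
  have wk: "energy (A k) (U' k) \<phi>' = M k * mass (W k) (U k) \<phi>" if "test_fun \<phi> \<phi>'" for k \<phi> \<phi>'
    by (rule eigfun_weak[OF wtk U that])
  define K' where "K' = max (L * K) K"
  have m0: "0 \<le> mass (W k) (U k) (U k)" for k by (rule mass_nonneg[OF wtk test_fun_cont[OF tU]])
  have E: "energy (A k) (U' k) (U' k) \<le> K'" for k
  proof -
    have "energy (A k) (U' k) (U' k) = M k * mass (W k) (U k) (U k)" by (rule wk[OF tU])
    also have "\<dots> \<le> \<bar>M k\<bar> * mass (W k) (U k) (U k)" using m0 by (intro mult_right_mono) auto
    also have "\<dots> \<le> L * K" using L[of k] K[of k] m0[of k] by (intro mult_mono) auto
    finally show ?thesis by (simp add: K'_def)
  qed
  have K2: "mass (W k) (U k) (U k) \<le> K'" for k using K[of k] by (simp add: K'_def)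
  obtain r u u' where r: "strict_mono (r :: nat \<Rightarrow> nat)" and u: "eigfun a w \<mu> u u'"
    and Ul: "\<And>e. e \<in> arcs G \<Longrightarrow> uniform_limit {0..1} (\<lambda>k. U (r k) e) (u e) sequentially"
    and dl: "\<And>\<phi>' \<phi>'' e. e \<in> arcs G \<Longrightarrow> C1 \<phi>' \<phi>'' \<Longrightarrow>
      (\<lambda>k. integral {0..1} (\<lambda>x. U' (r k) e x * \<phi>' x)) \<longlonglongrightarrow> integral {0..1} (\<lambda>x. u' e x * \<phi>' x)"
    by (rule weak_compactness[OF wt wtk tU c Ac Wc E K2 A W M]) (simp_all add: wk)
  note sub = filterlim_subseq[OF r]
  have tu: "test_fun u u'" by (rule eigfun_test[OF u])
  have c': "edge_cont u'" "\<And>k. edge_cont (U' k)" using tu tU test_fun_cont_deriv by auto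
  define X where "X k e = integral {0..1} (\<lambda>x. U' (r k) e x * U' (r k) e x)" for k e
  define Y where "Y k e = integral {0..1} (\<lambda>x. U' (r k) e x * u' e x)" for k e
  define Z where "Z e = integral {0..1} (\<lambda>x. u' e x * u' e x)" for e
  have Y: "(\<lambda>k. Y k e) \<longlonglongrightarrow> Z e" if e: "e \<in> arcs G" for e
    unfolding Y_def Z_def by (rule dl[OF e]) (use u e in \<open>auto simp: eigfun_def\<close>)
  have Ar: "(\<lambda>k. A (r k) e) \<longlonglongrightarrow> a e" if "e \<in> arcs G" for e
    by (rule filterlim_compose[OF A[OF that] sub])
  \<comment> \<open>Squared \<open>L^2\<close> distance of the derivatives. Only the total energy is
    known to converge, which makes the weighted sum of the \<open>D k e\<close> tend to zero; all
    terms are nonnegative with coefficients at least \<open>c\<close>, so each of them tends to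
    zero.\<close>
  define D where "D k e = integral {0..1} (\<lambda>x. (U' (r k) e x - u' e x)\<^sup>2)" for k e
  have D: "D k e = X k e - 2 * Y k e + Z e" if e: "e \<in> arcs G" for k e
  proof -
    have "integral {0..1} (\<lambda>x. 1 * (1 * (U' (r k) e x * U' (r k) e x) + (-2) * (U' (r k) e x * u' e x)) + 1 * (u' e x * u' e x))
       = 1 * (1 * X k e + (-2) * Y k e) + 1 * Z e"
    proof -
      have cc: "continuous_on {0..1} (\<lambda>x. U' (r k) e x * U' (r k) e x)"
        "continuous_on {0..1} (\<lambda>x. U' (r k) e x * u' e x)" "continuous_on {0..1} (\<lambda>x. u' e x * u' e x)"
        using c' e by (auto intro!: continuous_intros)
      have "continuous_on {0..1} (\<lambda>x. 1 * (U' (r k) e x * U' (r k) e x) + (-2) * (U' (r k) e x * u' e x))"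
        by (intro continuous_intros) (use c' e in auto)
      from integral01_lin[OF this cc(3), of 1 1] integral01_lin[OF cc(1,2), of 1 "-2"]
      show ?thesis by (simp add: X_def Y_def Z_def)
    qed
    moreover have "(\<lambda>x. 1 * (1 * (U' (r k) e x * U' (r k) e x) + (-2) * (U' (r k) e x * u' e x)) + 1 * (u' e x * u' e x))
       = (\<lambda>x. (U' (r k) e x - u' e x)\<^sup>2)"
      by (auto simp: fun_eq_iff power2_eq_square algebra_simps)
    ultimately show ?thesis by (simp add: D_def)
  qed
  have Dn: "0 \<le> D k e" if "e \<in> arcs G" for k e
    unfolding D_def by (rule integral01_nonneg) (use c' that in \<open>auto intro!: continuous_intros\<close>)
  have "(\<lambda>k. energy (A (r k)) (U' (r k)) (U' (r k))) \<longlonglongrightarrow> \<mu> * mass w u u"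
    unfolding wk[OF tU]
    by (intro tendsto_mult filterlim_compose[OF M sub] mass_limit Ul filterlim_compose[OF W sub])
      (use weights_cont[OF wtk] weights_cont[OF wt] test_fun_cont[OF tU] test_fun_cont[OF tu] in auto)
  also have "\<mu> * mass w u u = (\<Sum>e\<in>arcs G. a e * Z e)"
    using eigfun_weak[OF wt u tu] by (simp add: energy_def Z_def)
  finally have EX: "(\<lambda>k. \<Sum>e\<in>arcs G. A (r k) e * X k e) \<longlonglongrightarrow> (\<Sum>e\<in>arcs G. a e * Z e)"
    by (simp add: energy_def X_def)
  have "(\<lambda>k. (\<Sum>e\<in>arcs G. A (r k) e * X k e) - (\<Sum>e\<in>arcs G. A (r k) e * (2 * Y k e - Z e))) \<longlonglongrightarrow>
     (\<Sum>e\<in>arcs G. a e * Z e) - (\<Sum>e\<in>arcs G. a e * (2 * Z e - Z e))"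
    by (intro tendsto_intros EX Ar Y)
  moreover have "(\<Sum>e\<in>arcs G. A (r k) e * X k e) - (\<Sum>e\<in>arcs G. A (r k) e * (2 * Y k e - Z e)) =
      (\<Sum>e\<in>arcs G. A (r k) e * D k e)" for k
    by (simp add: sum_subtractf[symmetric] D algebra_simps)
  ultimately have SD: "(\<lambda>k. \<Sum>e\<in>arcs G. A (r k) e * D k e) \<longlonglongrightarrow> 0" by simp
  have D0: "(\<lambda>k. D k e) \<longlonglongrightarrow> 0" if e: "e \<in> arcs G" for e
  proof (rule tendsto_sandwich)
    show "\<forall>\<^sub>F k in sequentially. 0 \<le> D k e" using Dn[OF e] by simp
    have "D k e \<le> (1 / c) * (\<Sum>e\<in>arcs G. A (r k) e * D k e)" for k
    proof -
      have "c * D k e \<le> A (r k) e * D k e" using Ac[OF e, of "r k"] Dn[OF e] by (rule mult_right_mono)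
      also have "\<dots> \<le> (\<Sum>e\<in>arcs G. A (r k) e * D k e)"
        by (rule member_le_sum[OF e]) (use Dn wtk in \<open>auto simp: weights_def less_imp_le\<close>)
      finally show ?thesis using c by (simp add: field_simps)
    qed
    then show "\<forall>\<^sub>F k in sequentially. D k e \<le> (1 / c) * (\<Sum>e\<in>arcs G. A (r k) e * D k e)" by simp
    show "(\<lambda>k. (1 / c) * (\<Sum>e\<in>arcs G. A (r k) e * D k e)) \<longlonglongrightarrow> 0"
      using tendsto_mult[OF tendsto_const[of "1 / c"] SD] by simp
  qed simp
  have "(\<lambda>k. X k e) \<longlonglongrightarrow> Z e" if e: "e \<in> arcs G" for e
  proof -
    have "(\<lambda>k. D k e + 2 * Y k e - Z e) \<longlonglongrightarrow> 0 + 2 * Z e - Z e"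
      by (intro tendsto_intros D0 Y e)
    then show ?thesis by (simp add: D[OF e])
  qed
  with r u Ul show thesis using that[of r u u'] by (simp add: X_def Z_def)
qed

section \<open>Existence of the first positive eigenvalue\<close>

text \<open>Both faces of the first positive eigenvalue in one predicate: an eigenfunction that
  attains it, and the lower bound for Rayleigh quotients of mean-zero functions.\<close>

definition first_eig :: "('e \<Rightarrow> real) \<Rightarrow> ('e \<Rightarrow> real \<Rightarrow> real) \<Rightarrow> real \<Rightarrow> bool" where
  "first_eig a w \<mu> \<longleftrightarrow> 0 < \<mu> \<and> (\<exists>u u'. eigfun a w \<mu> u u' \<and> mass w u u = 1) \<and>
     (\<forall>v v'. test_fun v v' \<longrightarrow> mass w v (\<lambda>e x. 1) = 0 \<longrightarrow> \<mu> * mass w v v \<le> energy a v' v')"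

lemma constant_if_energy_0:
  assumes wt: "weights a w" and u: "test_fun u u'" and "energy a u' u' = 0"
  obtains c where "\<And>e x. e \<in> arcs G \<Longrightarrow> x \<in> {0..1} \<Longrightarrow> u e x = c"
proof -
  have z: "u' e x = 0" if "e \<in> arcs G" "x \<in> {0..1}" for e x
    by (rule energy_eq_0D[OF wt test_fun_cont_deriv[OF u] assms(3) that])
  obtain f where f: "\<And>e. e \<in> arcs G \<Longrightarrow> u e 0 = f (tail G e)" "\<And>e. e \<in> arcs G \<Longrightarrow> u e 1 = f (head G e)"
    using u by (auto simp: test_fun_def)
  have const: "u e x = u e 0" if e: "e \<in> arcs G" and x: "x \<in> {0..1}" for e x
  proof -
    have C: "C1 (u e) (u' e)" using u e by (simp add: test_fun_def)
    have "integral {0..1} (\<lambda>x. (u' e x)\<^sup>2) = 0"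
      using z[OF e] integral_cong[of "{0..1}" "\<lambda>x. (u' e x)\<^sup>2" "\<lambda>x. 0"] by simp
    then show ?thesis
    proof -
      have "(u e has_real_derivative 0) (at y within {0..1})" if "y \<in> {0..1}" for y
        using C1_deriv[OF C that] z[OF e that] by simp
      then obtain k where "\<And>y. y \<in> {0..1} \<Longrightarrow> u e y = k"
        using has_field_derivative_zero_constant[of "{0..1::real}" "u e"] by auto
      then show ?thesis using x by auto
    qed
  qed
  have "f (tail G e) = f (head G e)" if "e \<in> arcs G" for e
    using const[OF that, of 1] f[OF that] by simp
  then obtain c where "\<forall>e\<in>arcs G. f (tail G e) = c" using connected_graph[of f] by auto
  then show thesis using const f(1) by (intro that[of c]) auto
qed

text \<open>Orthogonal projection off the constants; the second identity is Pythagoras. The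
  redundant factors \<open>1\<close> match the shape of \<open>mass_lin\<close> and
  \<open>test_fun_lin\<close>.\<close>

lemma mass_center:
  assumes wt: "weights a w" and v: "edge_cont v"
  defines "m \<equiv> mass w v (\<lambda>e x. 1) / mass w (\<lambda>e x. 1) (\<lambda>e x. 1)"
  shows "mass w (\<lambda>e x. 1 * v e x + (- m) * 1) (\<lambda>e x. 1) = 0"
    and "mass w (\<lambda>e x. 1 * v e x + (- m) * 1) (\<lambda>e x. 1 * v e x + (- m) * 1) =
      mass w v v - (mass w v (\<lambda>e x. 1))\<^sup>2 / mass w (\<lambda>e x. 1) (\<lambda>e x. 1)"
proof -
  let ?o = "\<lambda>(e::'e) (x::real). 1::real"
  have o: "edge_cont ?o" by auto
  have p: "mass w ?o ?o > 0" by (rule mass_one_pos[OF wt])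
  note wc = weights_cont[OF wt]
  show "mass w (\<lambda>e x. 1 * v e x + (- m) * 1) ?o = 0"
    unfolding mass_lin[OF wc v o o] m_def using p by simp
  show "mass w (\<lambda>e x. 1 * v e x + (- m) * 1) (\<lambda>e x. 1 * v e x + (- m) * 1) =
      mass w v v - (mass w v ?o)\<^sup>2 / mass w ?o ?o"
    unfolding mass_quadratic[OF wc v o] m_def using p
    by (simp add: power2_eq_square field_simps)
qed

text \<open>Eigenfunctions of one set of weights lose their zero mean under other weights, so the
  Rayleigh bound is needed with an explicit correction for the mean. In the applications this
  correction is of second order.\<close>

lemma first_eig_ineq:
  assumes wt: "weights a w" and f: "first_eig a w \<mu>" and v: "test_fun v v'"
  shows "\<mu> * (mass w v v - (mass w v (\<lambda>e x. 1))\<^sup>2 / mass w (\<lambda>e x. 1) (\<lambda>e x. 1)) \<le> energy a v' v'"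
proof -
  define m where "m = mass w v (\<lambda>e x. 1) / mass w (\<lambda>e x. 1) (\<lambda>e x. 1)"
  have t: "test_fun (\<lambda>e x. 1 * v e x + (- m) * 1) (\<lambda>e x. 1 * v' e x + (- m) * 0)"
    by (rule test_fun_lin[OF v test_fun_const])
  have "\<mu> * mass w (\<lambda>e x. 1 * v e x + (- m) * 1) (\<lambda>e x. 1 * v e x + (- m) * 1) \<le>
     energy a (\<lambda>e x. 1 * v' e x + (- m) * 0) (\<lambda>e x. 1 * v' e x + (- m) * 0)"
    using f t mass_center(1)[OF wt test_fun_cont[OF v]] unfolding first_eig_def m_def by blast
  then show ?thesis
    unfolding m_def mass_center(2)[OF wt test_fun_cont[OF v]] by simp
qed

text \<open>Makes the set of competitors nonempty. A bump on one edge extends by zero; after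
  subtraction of a constant its values at \<open>0\<close> and \<open>1/2\<close> still differ, so
  its mass can be normalised.\<close>

lemma nonconstant_test_fun:
  assumes wt: "weights a w"
  obtains v v' where "test_fun v v'" "mass w v (\<lambda>e x. 1) = 0" "mass w v v = 1"
proof -
  obtain e0 where e0: "e0 \<in> arcs G" using arcs_nonempty by auto
  define b where "b = (\<lambda>e (x::real). if e = e0 then x * (1 - x) else 0)"
  define b' where "b' = (\<lambda>e (x::real). if e = e0 then 1 - 2 * x else 0)"
  have "C1 (\<lambda>x. x * (1 - x)) (\<lambda>x. 1 - 2 * x)"
    unfolding C1_def by (auto intro!: derivative_eq_intros continuous_intros)
  then have "C1 (b e) (b' e)" for e
    using C1_const[of 0] by (cases "e = e0") (auto simp: b_def b'_def)
  then have tb: "test_fun b b'" unfolding test_fun_def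
    by (auto simp: b_def intro!: exI[of _ "\<lambda>_. 0"])
  define m where "m = mass w b (\<lambda>e x. 1) / mass w (\<lambda>e x. 1) (\<lambda>e x. 1)"
  define v where "v = (\<lambda>e x. 1 * b e x + (- m) * 1)"
  have tv: "test_fun v (\<lambda>e x. 1 * b' e x + (- m) * 0)"
    unfolding v_def by (rule test_fun_lin[OF tb test_fun_const])
  have m0: "mass w v (\<lambda>e x. 1) = 0"
    unfolding v_def m_def by (rule mass_center(1)[OF wt test_fun_cont[OF tb]])
  have vc: "edge_cont v" by (rule test_fun_cont[OF tv])
  have "mass w v v \<noteq> 0"
  proof
    assume 0: "mass w v v = 0"
    have "v e0 0 = 0" "v e0 (1/2) = 0"
      using mass_eq_0D[OF wt vc 0 e0, of 0] mass_eq_0D[OF wt vc 0 e0, of "1/2"] by auto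
    then show False by (simp add: v_def b_def)
  qed
  with mass_nonneg[OF wt vc] have pos: "mass w v v > 0" by linarith
  define s where "s = 1 / sqrt (mass w v v)"
  have ts: "test_fun (\<lambda>e x. s * v e x + 0 * v e x)
     (\<lambda>e x. s * (1 * b' e x + (- m) * 0) + 0 * (1 * b' e x + (- m) * 0))"
    by (rule test_fun_lin[OF tv tv])
  moreover have "mass w (\<lambda>e x. s * v e x + 0 * v e x) (\<lambda>e x. 1) = 0"
    by (subst mass_lin[OF weights_cont[OF wt] vc vc]) (auto simp: m0)
  moreover have "mass w (\<lambda>e x. s * v e x + 0 * v e x) (\<lambda>e x. s * v e x + 0 * v e x) = 1"
    by (subst mass_quadratic[OF weights_cont[OF wt] vc vc]) (use pos in \<open>simp add: s_def power_divide\<close>)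
  ultimately show thesis by (rule that)
qed

text \<open>The direct method: a minimising sequence for the Rayleigh quotient satisfies the weak
  equation asymptotically, and its limit is an eigenfunction whose eigenvalue is the
  infimum.\<close>

lemma first_eig_exists:
  assumes wt: "weights a w"
  obtains \<mu> where "first_eig a w \<mu>"
proof -
  let ?o = "\<lambda>(e::'e) (x::real). 1::real"
  have oc: "edge_cont ?o" by auto
  note wc = weights_cont[OF wt]
  define S where "S = {energy a v' v' | v v'. test_fun v v' \<and> mass w v ?o = 0 \<and> mass w v v = 1}"
  define \<mu> where "\<mu> = Inf S"
  have bdd: "bdd_below S" unfolding S_def bdd_below_def
    using energy_nonneg[OF wt test_fun_cont_deriv] by (intro exI[of _ 0]) auto
  have ne: "S \<noteq> {}"
  proof -
    obtain v v' where "test_fun v v'" "mass w v ?o = 0" "mass w v v = 1"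
      by (rule nonconstant_test_fun[OF wt])
    then have "energy a v' v' \<in> S" unfolding S_def by blast
    then show ?thesis by blast
  qed
  have ray: "\<mu> * mass w v v \<le> energy a v' v'" if v: "test_fun v v'" and m: "mass w v ?o = 0" for v v'
  proof (cases "mass w v v = 0")
    case True then show ?thesis using energy_nonneg[OF wt test_fun_cont_deriv[OF v]] by simp
  next
    case False
    have vc: "edge_cont v" "edge_cont v'" using v test_fun_cont test_fun_cont_deriv by auto
    with False mass_nonneg[OF wt vc(1)] have pos: "mass w v v > 0" by linarith
    define s where "s = 1 / sqrt (mass w v v)"
    have "test_fun (\<lambda>e x. s * v e x + 0 * v e x) (\<lambda>e x. s * v' e x + 0 * v' e x)"
      by (rule test_fun_lin[OF v v])
    moreover have "mass w (\<lambda>e x. s * v e x + 0 * v e x) ?o = 0"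
      by (subst mass_lin[OF wc vc(1) vc(1) oc]) (auto simp: m)
    moreover have "mass w (\<lambda>e x. s * v e x + 0 * v e x) (\<lambda>e x. s * v e x + 0 * v e x) = 1"
      by (subst mass_quadratic[OF wc vc(1) vc(1)]) (use pos in \<open>simp add: s_def power_divide\<close>)
    ultimately have "energy a (\<lambda>e x. s * v' e x + 0 * v' e x) (\<lambda>e x. s * v' e x + 0 * v' e x) \<in> S"
      unfolding S_def by blast
    then have "\<mu> \<le> energy a (\<lambda>e x. s * v' e x + 0 * v' e x) (\<lambda>e x. s * v' e x + 0 * v' e x)"
      unfolding \<mu>_def using bdd by (rule cInf_lower)
    also have "\<dots> = energy a v' v' / mass w v v"
      by (subst energy_quadratic[OF vc(2) vc(2)]) (use pos in \<open>simp add: s_def power_divide\<close>)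
    finally show ?thesis using pos by (simp add: field_simps)
  qed
  have "\<exists>v v'. test_fun v v' \<and> mass w v ?o = 0 \<and> mass w v v = 1 \<and> energy a v' v' < \<mu> + inverse (real (Suc k))" for k
  proof -
    have "Inf S < \<mu> + inverse (real (Suc k))" by (simp add: \<mu>_def)
    then obtain z where "z \<in> S" "z < \<mu> + inverse (real (Suc k))" using cInf_lessD[OF ne] by blast
    then show ?thesis unfolding S_def by blast
  qed
  then obtain U U' where U: "\<And>k. test_fun (U k) (U' k)" and U0: "\<And>k. mass w (U k) ?o = 0"
    and U1: "\<And>k. mass w (U k) (U k) = 1"
    and UE: "\<And>k. energy a (U' k) (U' k) < \<mu> + inverse (real (Suc k))" by metis
  have Uc: "edge_cont (U k)" "edge_cont (U' k)" for k
    using test_fun_cont[OF U] test_fun_cont_deriv[OF U] by auto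
  have lim: "(\<lambda>k. energy a (U' k) \<phi>' - \<mu> * mass w (U k) \<phi>) \<longlonglongrightarrow> 0" if \<phi>: "test_fun \<phi> \<phi>'" for \<phi> \<phi>'
  proof -
    \<comment> \<open>The test function is centred first, so that \<open>U k\<close> plus a multiple
      of it remains a mean-zero competitor.\<close>
    define m where "m = mass w \<phi> ?o / mass w ?o ?o"
    define \<psi> where "\<psi> = (\<lambda>e x. 1 * \<phi> e x + (- m) * 1)"
    have t: "test_fun \<psi> (\<lambda>e x. 1 * \<phi>' e x + (- m) * 0)"
      unfolding \<psi>_def by (rule test_fun_lin[OF \<phi> test_fun_const])
    then have t: "test_fun \<psi> \<phi>'" by simp
    have \<psi>0: "mass w \<psi> ?o = 0"
      unfolding \<psi>_def m_def by (rule mass_center(1)[OF wt test_fun_cont[OF \<phi>]])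
    have \<psi>c: "edge_cont \<psi>" "edge_cont \<phi>'" using t test_fun_cont test_fun_cont_deriv by auto
    define b where "b k = energy a (U' k) \<phi>' - \<mu> * mass w (U k) \<phi>" for k
    define q where "q = energy a \<phi>' \<phi>' - \<mu> * mass w \<psi> \<psi>"
    have mU: "mass w (U k) \<psi> = mass w (U k) \<phi>" for k
      unfolding \<psi>_def mass_commute[of w "U k"] mass_lin[OF wc test_fun_cont[OF \<phi>] oc Uc(1)]
      using U0[of k] by (simp add: mass_commute[of w ?o])
    \<comment> \<open>\<open>U k\<close> misses the infimum by less than
      \<open>inverse (real (Suc k))\<close>, so no competitor can undercut it by more. Nonnegativity
      for all \<open>t\<close> forces the linear coefficient \<open>b k\<close> to be small.\<close>
    have quad: "0 \<le> inverse (real (Suc k)) + 2 * t * b k + t\<^sup>2 * q" for k t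
    proof -
      have "test_fun (\<lambda>e x. 1 * U k e x + t * \<psi> e x) (\<lambda>e x. 1 * U' k e x + t * \<phi>' e x)"
        by (rule test_fun_lin[OF U t])
      moreover have "mass w (\<lambda>e x. 1 * U k e x + t * \<psi> e x) ?o = 0"
        unfolding mass_lin[OF wc Uc(1) \<psi>c(1) oc] using U0 \<psi>0 by simp
      ultimately have "\<mu> * mass w (\<lambda>e x. 1 * U k e x + t * \<psi> e x) (\<lambda>e x. 1 * U k e x + t * \<psi> e x) \<le>
         energy a (\<lambda>e x. 1 * U' k e x + t * \<phi>' e x) (\<lambda>e x. 1 * U' k e x + t * \<phi>' e x)" by (rule ray)
      then have "\<mu> * (1 + 2 * t * mass w (U k) \<phi> + t\<^sup>2 * mass w \<psi> \<psi>) \<le>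
         energy a (U' k) (U' k) + 2 * t * energy a (U' k) \<phi>' + t\<^sup>2 * energy a \<phi>' \<phi>'"
        unfolding mass_quadratic[OF wc Uc(1) \<psi>c(1)] energy_quadratic[OF Uc(2) \<psi>c(2)] mU U1 by simp
      then show ?thesis using UE[of k] by (simp add: b_def q_def algebra_simps)
    qed
    have bnd: "\<bar>b k\<bar> \<le> (1 + \<bar>q\<bar>) * sqrt (inverse (real (Suc k)))" for k
    proof -
      \<comment> \<open>With \<open>t\<close> of this size the constant and the quadratic term are
        comparable, which gives the decay of \<open>b k\<close>.\<close>
      define s where "s = sqrt (inverse (real (Suc k)))"
      have s: "s > 0" "inverse (real (Suc k)) = s * s" by (auto simp: s_def)
      have qq: "s * s * q \<le> s * s * \<bar>q\<bar>" by (intro mult_left_mono) auto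
      have "0 \<le> s * s + 2 * s * b k + s * s * q" "0 \<le> s * s - 2 * s * b k + s * s * q"
        using quad[of k s] quad[of k "- s"] unfolding s(2) by (simp_all add: power2_eq_square)
      then have "2 * s * \<bar>b k\<bar> \<le> s * s + s * s * q" by (auto simp: abs_if)
      also have "\<dots> \<le> s * s + s * s * \<bar>q\<bar>" using qq by simp
      also have "\<dots> \<le> 2 * s * ((1 + \<bar>q\<bar>) * s)" using s by (simp add: algebra_simps)
      finally show ?thesis unfolding s_def[symmetric] using s by simp
    qed
    have "(\<lambda>k. (1 + \<bar>q\<bar>) * sqrt (inverse (real (Suc k)))) \<longlonglongrightarrow> (1 + \<bar>q\<bar>) * sqrt 0"
      by (intro tendsto_intros LIMSEQ_inverse_real_of_nat)
    then have "(\<lambda>k. (1 + \<bar>q\<bar>) * sqrt (inverse (real (Suc k)))) \<longlonglongrightarrow> 0" by simp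
    moreover have "\<forall>\<^sub>F k in sequentially. norm (b k) \<le> (1 + \<bar>q\<bar>) * sqrt (inverse (real (Suc k)))"
      unfolding real_norm_def by (intro always_eventually allI bnd)
    ultimately have "b \<longlonglongrightarrow> 0" by (rule Lim_null_comparison[rotated])
    then show ?thesis by (simp add: b_def[abs_def])
  qed
  obtain c where c: "0 < c" "\<And>e. e \<in> arcs G \<Longrightarrow> c \<le> a e"
    "\<And>e x. e \<in> arcs G \<Longrightarrow> x \<in> {0..1} \<Longrightarrow> c \<le> w e x"
    using weights_lower_bound[OF wt] by blast
  have UK: "energy a (U' k) (U' k) \<le> max 1 (\<mu> + 1)" "mass w (U k) (U k) \<le> max 1 (\<mu> + 1)" for k
  proof -
    have "inverse (real (Suc k)) \<le> 1" by (simp add: inverse_le_1_iff)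
    then show "energy a (U' k) (U' k) \<le> max 1 (\<mu> + 1)" using UE[of k] by linarith
  qed (simp add: U1)
  obtain r u u' where r: "strict_mono (r :: nat \<Rightarrow> nat)" and u: "eigfun a w \<mu> u u'"
    and Ul: "\<And>e. e \<in> arcs G \<Longrightarrow> uniform_limit {0..1} (\<lambda>k. U (r k) e) (u e) sequentially"
    and "\<And>\<phi>' \<phi>'' e. e \<in> arcs G \<Longrightarrow> C1 \<phi>' \<phi>'' \<Longrightarrow>
      (\<lambda>k. integral {0..1} (\<lambda>x. U' (r k) e x * \<phi>' x)) \<longlonglongrightarrow> integral {0..1} (\<lambda>x. u' e x * \<phi>' x)"
    by (rule weak_compactness[OF wt wt U c UK tendsto_const uniform_limit_const tendsto_const lim]) simp_all
  have uc: "edge_cont u" by (rule test_fun_cont[OF eigfun_test[OF u]])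
  have "(\<lambda>k. mass w (U (r k)) (U (r k))) \<longlonglongrightarrow> mass w u u"
    by (rule mass_limit) (use Ul Uc uc wc in \<open>auto intro: uniform_limit_const\<close>)
  then have u1: "mass w u u = 1" using U1 by (simp add: LIMSEQ_const_iff)
  have "(\<lambda>k. mass w (U (r k)) ?o) \<longlonglongrightarrow> mass w u ?o"
    by (rule mass_limit) (use Ul Uc uc wc in \<open>auto intro: uniform_limit_const\<close>)
  then have u0: "mass w u ?o = 0" using U0 by (simp add: LIMSEQ_const_iff)
  have "\<mu> = energy a u' u'" using eigfun_weak[OF wt u eigfun_test[OF u]] u1 by simp
  \<comment> \<open>Zero energy would make \<open>u\<close> constant, and a constant of mean zero
    cannot have mass \<open>1\<close>. This is what makes \<open>\<mu>\<close> positive.\<close>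
  moreover have "energy a u' u' \<noteq> 0"
  proof
    assume "energy a u' u' = 0"
    then obtain c where c: "\<And>e x. e \<in> arcs G \<Longrightarrow> x \<in> {0..1} \<Longrightarrow> u e x = c"
      using constant_if_energy_0[OF wt eigfun_test[OF u]] by blast
    have "mass w u v = c * mass w ?o v" for v
      unfolding mass_def sum_distrib_left
    proof (rule sum.cong[OF refl])
      fix e assume e: "e \<in> arcs G"
      have "integral {0..1} (\<lambda>x. w e x * (u e x * v e x)) = integral {0..1} (\<lambda>x. c * (w e x * (1 * v e x)))"
        by (rule integral_cong) (use c[OF e] in auto)
      then show "integral {0..1} (\<lambda>x. w e x * (u e x * v e x)) = c * integral {0..1} (\<lambda>x. w e x * (1 * v e x))"
        by simp
    qed
    from this[of u] this[of ?o] u0 u1 mass_one_pos[OF wt] show False by auto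
  qed
  ultimately have "\<mu> > 0" using energy_nonneg[OF wt test_fun_cont_deriv[OF eigfun_test[OF u]]] by linarith
  then show thesis using u u1 ray by (intro that[of \<mu>]) (auto simp: first_eig_def)
qed

end

subsection \<open>Eigenspaces\<close>

text \<open>Gaussian elimination: an equation with a nonzero coefficient at \<open>p\<close> is
  solved for that unknown, and the remaining system has one equation and one unknown less.\<close>

lemma homogeneous_system:
  fixes m :: "'j \<Rightarrow> 'i \<Rightarrow> real"
  assumes "finite J" "finite I" "card J < card I"
  shows "\<exists>c. (\<exists>i\<in>I. c i \<noteq> 0) \<and> (\<forall>j\<in>J. (\<Sum>i\<in>I. m j i * c i) = 0)"
  using assms
proof (induction J arbitrary: I m rule: finite_induct)
  case empty
  then obtain i where "i \<in> I" by (cases "I = {}") auto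
  then show ?case by (intro exI[of _ "\<lambda>_. 1"]) auto
next
  case (insert j J)
  show ?case
  proof (cases "\<forall>i\<in>I. m j i = 0")
    case True
    have "card J < card I" using insert by simp
    from insert.IH[OF insert.prems(1) this, of m] True show ?thesis by auto
  next
    case False
    then obtain p where p: "p \<in> I" "m j p \<noteq> 0" by auto
    define I' where "I' = I - {p}"
    have I': "finite I'" "card J < card I'" "p \<notin> I'" "I = insert p I'"
      using insert p by (auto simp: I'_def)
    obtain c where c: "\<exists>i\<in>I'. c i \<noteq> 0"
      "\<And>k. k \<in> J \<Longrightarrow> (\<Sum>i\<in>I'. (m k i - m k p * m j i / m j p) * c i) = 0"
      using insert.IH[OF I'(1,2), of "\<lambda>k i. m k i - m k p * m j i / m j p"] by blast
    define d where "d = c(p := - (\<Sum>i\<in>I'. m j i * c i) / m j p)"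
    have dI: "(\<Sum>i\<in>I'. m k i * d i) = (\<Sum>i\<in>I'. m k i * c i)" for k
      by (rule sum.cong) (use I'(3) in \<open>auto simp: d_def\<close>)
    have s: "(\<Sum>i\<in>I. m k i * d i) = m k p * d p + (\<Sum>i\<in>I'. m k i * c i)" for k
      using I' dI by simp
    have "(\<Sum>i\<in>I. m j i * d i) = 0" unfolding s using p by (simp add: d_def)
    moreover have "(\<Sum>i\<in>I. m k i * d i) = 0" if "k \<in> J" for k
    proof -
      have "(\<Sum>i\<in>I'. (m k i - m k p * m j i / m j p) * c i) =
          (\<Sum>i\<in>I'. m k i * c i) - m k p / m j p * (\<Sum>i\<in>I'. m j i * c i)"
        by (simp add: sum_distrib_left sum_subtractf[symmetric] algebra_simps)
      then show ?thesis unfolding s using c(2)[OF that] by (simp add: d_def)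
    qed
    moreover have "\<exists>i\<in>I. d i \<noteq> 0" using c(1) I' by (auto simp: d_def)
    ultimately show ?thesis by (intro exI[of _ d]) auto
  qed
qed

text \<open>The linear combinations below are the first rows of the Householder reflection that maps the
  unit vector \<open>c\<close> of relations to the last coordinate vector.\<close>

lemma householder_squares:
  fixes f c :: "nat \<Rightarrow> real"
  assumes "(\<Sum>i<d. (c i)\<^sup>2) = 1 - z\<^sup>2" "(\<Sum>i<d. c i * f i) = - (z * y)" "z \<le> 0"
  shows "(\<Sum>i<d. (f i + c i / (1 - z) * y)\<^sup>2) = (\<Sum>i<d. (f i)\<^sup>2) + y\<^sup>2"
proof -
  define k where "k = 1 / (1 - z)"
  \<comment> \<open>The sign condition \<open>z \<le> 0\<close> keeps the denominator
    \<open>1 - z\<close> away from zero.\<close>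
  have k: "k * (1 - z) = 1" using assms(3) by (simp add: k_def)
  have "(\<Sum>i<d. (f i + c i / (1 - z) * y)\<^sup>2) =
      (\<Sum>i<d. (f i)\<^sup>2 + 2 * k * y * (c i * f i) + (k * y)\<^sup>2 * (c i)\<^sup>2)"
  proof (rule sum.cong[OF refl])
    fix i
    have "f i + c i / (1 - z) * y = f i + k * y * c i" by (simp add: k_def)
    then show "(f i + c i / (1 - z) * y)\<^sup>2 = (f i)\<^sup>2 + 2 * k * y * (c i * f i) + (k * y)\<^sup>2 * (c i)\<^sup>2"
      by (simp add: power2_eq_square algebra_simps)
  qed
  also have "\<dots> = (\<Sum>i<d. (f i)\<^sup>2) + 2 * k * y * (- (z * y)) + (k * y)\<^sup>2 * (1 - z\<^sup>2)"
    unfolding sum.distrib sum_distrib_left[symmetric] assms(1,2) ..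
  also have "\<dots> = (\<Sum>i<d. (f i)\<^sup>2) + y\<^sup>2 * (k * (k * (1 - z)) * (1 + z) - 2 * k * z)"
    by (simp add: power2_eq_square algebra_simps)
  also have "k * (k * (1 - z)) * (1 + z) - 2 * k * z = k * (1 - z)"
    by (subst k) (simp add: algebra_simps)
  finally show ?thesis unfolding k by simp
qed

context quantum_graph
begin

section \<open>Linear relations between eigenfunctions\<close>

lemma eigfun_unique:
  assumes wt: "weights a w" and u: "eigfun a w \<mu> u u'"
    and init: "\<And>e. e \<in> arcs G \<Longrightarrow> u e 0 = 0 \<and> u' e 0 = 0" and e: "e \<in> arcs G" and x: "x \<in> {0..1}"
  shows "u e x = 0" "u' e x = 0"
proof -
  have *: "C1 (u' e) (\<lambda>x. (- (\<mu> / a e) * w e x) * u e x)"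
    using u e by (simp add: eigfun_def mult.assoc)
  have "u e x = 0 \<and> u' e x = 0"
    by (rule linear_ode_unique[OF _ * _ _ _ x])
      (use u e init wt in \<open>auto simp: eigfun_def test_fun_def weights_def intro!: continuous_intros\<close>)
  then show "u e x = 0" "u' e x = 0" by auto
qed

lemma eigfun_sum:
  assumes u: "\<And>i. i \<in> I \<Longrightarrow> eigfun a w \<mu> (u i) (u' i)"
  shows "eigfun a w \<mu> (\<lambda>e x. \<Sum>i\<in>I. c i * u i e x) (\<lambda>e x. \<Sum>i\<in>I. c i * u' i e x)"
proof -
  have "\<forall>i\<in>I. \<exists>\<phi>. \<forall>e\<in>arcs G. u i e 0 = \<phi> (tail G e) \<and> u i e 1 = \<phi> (head G e)"
    using u by (auto simp: eigfun_def test_fun_def)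
  then obtain \<phi> where \<phi>: "\<And>i e. i \<in> I \<Longrightarrow> e \<in> arcs G \<Longrightarrow> u i e 0 = \<phi> i (tail G e) \<and> u i e 1 = \<phi> i (head G e)"
    by metis
  have "test_fun (\<lambda>e x. \<Sum>i\<in>I. c i * u i e x) (\<lambda>e x. \<Sum>i\<in>I. c i * u' i e x)"
    unfolding test_fun_def
  proof (intro conjI ballI)
    show "C1 (\<lambda>x. \<Sum>i\<in>I. c i * u i e x) (\<lambda>x. \<Sum>i\<in>I. c i * u' i e x)" if "e \<in> arcs G" for e
      by (rule C1_sum) (use u that in \<open>auto simp: eigfun_def test_fun_def\<close>)
    show "\<exists>\<phi>. \<forall>e\<in>arcs G. (\<Sum>i\<in>I. c i * u i e 0) = \<phi> (tail G e) \<and> (\<Sum>i\<in>I. c i * u i e 1) = \<phi> (head G e)"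
      by (rule exI[of _ "\<lambda>v. \<Sum>i\<in>I. c i * \<phi> i v"]) (auto intro!: sum.cong simp: \<phi>)
  qed
  moreover have "C1 (\<lambda>x. \<Sum>i\<in>I. c i * u' i e x) (\<lambda>x. - (\<mu> / a e) * (w e x * (\<Sum>i\<in>I. c i * u i e x)))"
    if e: "e \<in> arcs G" for e
  proof -
    have "C1 (\<lambda>x. \<Sum>i\<in>I. c i * u' i e x) (\<lambda>x. \<Sum>i\<in>I. c i * (- (\<mu> / a e) * (w e x * u i e x)))"
      by (rule C1_sum) (use u e in \<open>auto simp: eigfun_def\<close>)
    moreover have "(\<lambda>x. \<Sum>i\<in>I. c i * (- (\<mu> / a e) * (w e x * u i e x))) =
        (\<lambda>x. - (\<mu> / a e) * (w e x * (\<Sum>i\<in>I. c i * u i e x)))"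
      by (auto simp: fun_eq_iff sum_distrib_left intro!: sum.cong)
    ultimately show ?thesis by simp
  qed
  moreover have "(\<Sum>e | e \<in> arcs G \<and> tail G e = v. a e * (\<Sum>i\<in>I. c i * u' i e 0)) +
      (\<Sum>e | e \<in> arcs G \<and> head G e = v. - (a e * (\<Sum>i\<in>I. c i * u' i e 1))) = 0" if v: "v \<in> verts G" for v
  proof -
    have "(\<Sum>e\<in>S. a e * (\<Sum>i\<in>I. c i * u' i e x)) = (\<Sum>i\<in>I. c i * (\<Sum>e\<in>S. a e * u' i e x))" for S x
      unfolding sum_distrib_left by (subst sum.swap) (auto intro!: sum.cong)
    then have "(\<Sum>e | e \<in> arcs G \<and> tail G e = v. a e * (\<Sum>i\<in>I. c i * u' i e 0)) +
      (\<Sum>e | e \<in> arcs G \<and> head G e = v. - (a e * (\<Sum>i\<in>I. c i * u' i e 1))) =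
      (\<Sum>i\<in>I. c i * ((\<Sum>e | e \<in> arcs G \<and> tail G e = v. a e * u' i e 0) +
        (\<Sum>e | e \<in> arcs G \<and> head G e = v. - (a e * u' i e 1))))"
      by (simp add: sum_negf distrib_left right_diff_distrib sum.distrib sum_subtractf)
    also have "\<dots> = 0" by (rule sum.neutral) (use u v in \<open>auto simp: eigfun_def\<close>)
    finally show ?thesis .
  qed
  ultimately show ?thesis unfolding eigfun_def by blast
qed

lemma eigfun_scale_add:
  assumes u: "eigfun a w \<mu> u u'" and v: "eigfun a w \<mu> v v'"
  shows "eigfun a w \<mu> (\<lambda>e x. c * u e x + d * v e x) (\<lambda>e x. c * u' e x + d * v' e x)"
  using eigfun_sum[of "{True, False}" a w \<mu> "\<lambda>i. if i then u else v" "\<lambda>i. if i then u' else v'"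
      "\<lambda>i. if i then c else d"] u v by simp

text \<open>A combination vanishes as soon as its initial value and initial derivative vanish on
  every edge, which is a linear system of twice as many equations as edges. The relation is recorded
  for the derivatives too, because both sums of squares have to be reduced later.\<close>

lemma eigfun_dependent:
  assumes wt: "weights a w" and I: "finite I" "2 * card (arcs G) < card I"
    and u: "\<And>i. i \<in> I \<Longrightarrow> eigfun a w \<mu> (u i) (u' i)"
  shows "\<exists>c. (\<exists>i\<in>I. c i \<noteq> 0) \<and>
    (\<forall>e\<in>arcs G. \<forall>x\<in>{0..1}. (\<Sum>i\<in>I. c i * u i e x) = 0 \<and> (\<Sum>i\<in>I. c i * u' i e x) = 0)"
proof -
  \<comment> \<open>The flag selects value or derivative, so this product indexes the
    equations.\<close>
  have "card (arcs G \<times> (UNIV :: bool set)) < card I" using I by (simp add: card_cartesian_product)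
  then obtain c where c: "\<exists>i\<in>I. c i \<noteq> 0"
    "\<And>e b. e \<in> arcs G \<Longrightarrow> (\<Sum>i\<in>I. (if b then u i e 0 else u' i e 0) * c i) = 0"
    using homogeneous_system[of "arcs G \<times> (UNIV :: bool set)" I "\<lambda>(e, b) i. if b then u i e 0 else u' i e 0"]
      I by auto
  have "(\<Sum>i\<in>I. c i * u i e 0) = 0 \<and> (\<Sum>i\<in>I. c i * u' i e 0) = 0" if "e \<in> arcs G" for e
    using c(2)[OF that, of True] c(2)[OF that, of False] by (simp add: mult.commute)
  from eigfun_unique[OF wt eigfun_sum[where c = c, OF u] this] c(1) show ?thesis
    by (intro exI[of _ c]) auto
qed

lemma eigfun_reduce_squares:
  assumes wt: "weights a w" and d: "2 * card (arcs G) \<le> d"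
    and u: "\<And>i. i \<le> d \<Longrightarrow> eigfun a w \<mu> (u i) (u' i)"
  obtains v v' where "\<And>i. i < d \<Longrightarrow> eigfun a w \<mu> (v i) (v' i)"
    and "\<And>e x. e \<in> arcs G \<Longrightarrow> x \<in> {0..1} \<Longrightarrow> (\<Sum>i<d. (v i e x)\<^sup>2) = (\<Sum>i<d. (u i e x)\<^sup>2) + (u d e x)\<^sup>2"
    and "\<And>e x. e \<in> arcs G \<Longrightarrow> x \<in> {0..1} \<Longrightarrow> (\<Sum>i<d. (v' i e x)\<^sup>2) = (\<Sum>i<d. (u' i e x)\<^sup>2) + (u' d e x)\<^sup>2"
proof -
  obtain b where "(\<exists>i\<in>{..d}. b i \<noteq> 0) \<and> (\<forall>e\<in>arcs G. \<forall>x\<in>{0..1}.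
      (\<Sum>i\<le>d. b i * u i e x) = 0 \<and> (\<Sum>i\<le>d. b i * u' i e x) = 0)"
    using eigfun_dependent[OF wt, of "{..d}" \<mu> u u'] d u by auto
  then have b: "\<exists>i\<in>{..d}. b i \<noteq> 0"
    "\<And>e x. e \<in> arcs G \<Longrightarrow> x \<in> {0..1} \<Longrightarrow> (\<Sum>i\<le>d. b i * u i e x) = 0"
    "\<And>e x. e \<in> arcs G \<Longrightarrow> x \<in> {0..1} \<Longrightarrow> (\<Sum>i\<le>d. b i * u' i e x) = 0" by auto
  define n where "n = (\<Sum>i\<le>d. (b i)\<^sup>2)"
  obtain j where "j \<le> d" "b j \<noteq> 0" using b(1) by auto
  then have n: "n > 0" unfolding n_def by (intro sum_pos2[of _ j]) auto
  \<comment> \<open>Normalises the relation and chooses the sign with \<open>c d \<le> 0\<close>, as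
    \<open>householder_squares\<close> requires.\<close>
  define s where "s = (if b d \<le> 0 then 1 else -1) / sqrt n"
  define c where "c i = s * b i" for i
  have cd: "c d \<le> 0" using n by (auto simp: c_def s_def divide_nonpos_pos mult_nonneg_nonpos)
  have "(\<Sum>i\<le>d. (c i)\<^sup>2) = s\<^sup>2 * n" by (simp add: c_def n_def sum_distrib_left power_mult_distrib)
  also have "\<dots> = 1" using n by (auto simp: s_def power_divide)
  finally have c2: "(\<Sum>i<d. (c i)\<^sup>2) = 1 - (c d)\<^sup>2" by (simp add: lessThan_Suc_atMost[symmetric])
  have rel: "(\<Sum>i<d. c i * f i) = - (c d * f d)" if "(\<Sum>i\<le>d. b i * f i) = 0" for f :: "nat \<Rightarrow> real"
  proof -
    have "(\<Sum>i\<le>d. c i * f i) = s * (\<Sum>i\<le>d. b i * f i)" by (simp add: c_def sum_distrib_left mult.assoc)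
    then show ?thesis using that by (simp add: lessThan_Suc_atMost[symmetric])
  qed
  show thesis
  proof (rule that[of "\<lambda>i e x. u i e x + c i / (1 - c d) * u d e x" "\<lambda>i e x. u' i e x + c i / (1 - c d) * u' d e x"])
    show "eigfun a w \<mu> (\<lambda>e x. u i e x + c i / (1 - c d) * u d e x) (\<lambda>e x. u' i e x + c i / (1 - c d) * u' d e x)"
      if "i < d" for i
      using eigfun_scale_add[OF u[of i] u[of d], of 1 "c i / (1 - c d)"] that by simp
  next
    fix e x assume "e \<in> arcs G" "x \<in> {0..1::real}"
    note b(2,3)[OF this]
    then show "(\<Sum>i<d. (u i e x + c i / (1 - c d) * u d e x)\<^sup>2) = (\<Sum>i<d. (u i e x)\<^sup>2) + (u d e x)\<^sup>2"
      "(\<Sum>i<d. (u' i e x + c i / (1 - c d) * u' d e x)\<^sup>2) = (\<Sum>i<d. (u' i e x)\<^sup>2) + (u' d e x)\<^sup>2"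
      by (intro householder_squares c2 cd rel; simp)+
  qed
qed

section \<open>From arclength to the unit interval\<close>

text \<open>Stretching an edge of length \<open>sqrt (g e)\<close> to the unit interval multiplies
  the Dirichlet integral by \<open>1 / sqrt (g e)\<close> and the mass by
  \<open>sqrt (g e)\<close>.\<close>

definition conductance :: "'e metric \<Rightarrow> 'e \<Rightarrow> real" where
  "conductance g e = 1 / sqrt (g e)"

definition mass_density :: "'e metric \<Rightarrow> 'e density \<Rightarrow> 'e density" where
  "mass_density g \<rho> e x = sqrt (g e) * \<rho> e x"

lemma densities_cont:
  assumes "\<rho> \<in> densities G" shows "edge_cont \<rho>"
proof
  fix e assume "e \<in> arcs G"
  then obtain D :: "nat \<Rightarrow> real \<Rightarrow> real" where "D 0 = \<rho> e"
    "\<And>k x. x \<in> {0..1} \<Longrightarrow> (D k has_real_derivative D (Suc k) x) (at x within {0..1})"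
    using assms by (auto simp: densities_def smooth_on_def)
  then show "continuous_on {0..1} (\<rho> e)" by (metis DERIV_continuous_on)
qed

lemma admissible_weights:
  assumes "(g, \<rho>) \<in> admissible G"
  shows "weights (conductance g) (mass_density g \<rho>)"
  using assms densities_cont[of \<rho>]
  by (auto simp: weights_def conductance_def mass_density_def admissible_def densities_def
      intro!: continuous_intros)

lemma eigenspace_eigfun:
  assumes adm: "(g, \<rho>) \<in> admissible G" and f: "f \<in> eigenspace G g \<rho> \<mu>"
  obtains u' where "eigfun (conductance g) (mass_density g \<rho>) \<mu> (\<lambda>e x. f e (sqrt (g e) * x)) u'"
proof -
  obtain f' f'' \<phi> where
    \<phi>: "\<And>e. e \<in> arcs G \<Longrightarrow> f e 0 = \<phi> (tail G e) \<and> f e (sqrt (g e)) = \<phi> (head G e)" and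
    f1: "\<And>e s. e \<in> arcs G \<Longrightarrow> s \<in> {0..sqrt (g e)} \<Longrightarrow> (f e has_real_derivative f' e s) (at s within {0..sqrt (g e)})" and
    f2: "\<And>e s. e \<in> arcs G \<Longrightarrow> s \<in> {0..sqrt (g e)} \<Longrightarrow> (f' e has_real_derivative f'' e s) (at s within {0..sqrt (g e)})" and
    f3: "\<And>e s. e \<in> arcs G \<Longrightarrow> s \<in> {0..sqrt (g e)} \<Longrightarrow> - f'' e s = \<mu> * \<rho> e (s / sqrt (g e)) * f e s" and
    kir: "\<And>v. v \<in> verts G \<Longrightarrow> (\<Sum>e | e \<in> arcs G \<and> tail G e = v. f' e 0) +
               (\<Sum>e | e \<in> arcs G \<and> head G e = v. - f' e (sqrt (g e))) = 0"
    using f unfolding eigenspace_def edge_length_def by blast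
  have l: "sqrt (g e) > 0" if "e \<in> arcs G" for e using adm that by (auto simp: admissible_def)
  have resc: "((\<lambda>x. F (l * x)) has_real_derivative l * F' (l * x)) (at x within {0..1})"
    if l: "l > 0" and F: "\<And>s. s \<in> {0..l} \<Longrightarrow> (F has_real_derivative F' s) (at s within {0..l})" and x: "x \<in> {0..1}"
    for F F' :: "real \<Rightarrow> real" and l x
  proof -
    have im: "(\<lambda>x. l * x) ` {0..1} \<subseteq> {0..l}" using l by auto
    have "((\<lambda>x. l * x) has_real_derivative l) (at x within {0..1})" by (auto intro!: derivative_eq_intros)
    moreover have "(F has_real_derivative F' (l * x)) (at (l * x) within (\<lambda>x. l * x) ` {0..1})"
      by (rule DERIV_subset[OF F im]) (use x l in auto)
    ultimately show ?thesis using DERIV_image_chain[of F "F' (l * x)" "\<lambda>x. l * x" x "{0..1}" l]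
      by (simp add: o_def mult.commute)
  qed
  \<comment> \<open>With this \<open>u'\<close> the flux \<open>conductance g e * u' e x\<close>
    equals the arclength derivative \<open>f' e (sqrt (g e) * x)\<close>, so the vertex conditions
    carry over.\<close>
  define u' where "u' e x = sqrt (g e) * f' e (sqrt (g e) * x)" for e x
  have d1: "((\<lambda>x. f e (sqrt (g e) * x)) has_real_derivative u' e x) (at x within {0..1})"
    if "e \<in> arcs G" "x \<in> {0..1}" for e x
    unfolding u'_def by (rule resc[OF l[OF that(1)] f1[OF that(1)] that(2)])
  have d2: "(u' e has_real_derivative - (\<mu> / conductance g e) * (mass_density g \<rho> e x * f e (sqrt (g e) * x)))
      (at x within {0..1})" if e: "e \<in> arcs G" and x: "x \<in> {0..1}" for e x
  proof -
    have "(u' e has_real_derivative sqrt (g e) * (sqrt (g e) * f'' e (sqrt (g e) * x))) (at x within {0..1})"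
      unfolding u'_def[abs_def] by (rule DERIV_cmult[OF resc[OF l[OF e] f2[OF e] x]])
    moreover have "- f'' e (sqrt (g e) * x) = \<mu> * \<rho> e x * f e (sqrt (g e) * x)"
      using f3[OF e, of "sqrt (g e) * x"] x l[OF e] by (auto simp: mult_left_le)
    then have "f'' e (sqrt (g e) * x) = - (\<mu> * \<rho> e x * f e (sqrt (g e) * x))" by linarith
    then have "sqrt (g e) * (sqrt (g e) * f'' e (sqrt (g e) * x)) =
        - (\<mu> / conductance g e) * (mass_density g \<rho> e x * f e (sqrt (g e) * x))"
      unfolding conductance_def mass_density_def by simp
    ultimately show ?thesis by simp
  qed
  have c0: "continuous_on {0..1} (u' e)" if "e \<in> arcs G" for e
    using d2[OF that] by (rule DERIV_continuous_on)
  have c00: "continuous_on {0..1} (\<lambda>x. f e (sqrt (g e) * x))" if "e \<in> arcs G" for e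
    using d1[OF that] by (rule DERIV_continuous_on)
  have wc: "edge_cont (mass_density g \<rho>)" by (rule weights_cont[OF admissible_weights[OF adm]])
  have "eigfun (conductance g) (mass_density g \<rho>) \<mu> (\<lambda>e x. f e (sqrt (g e) * x)) u'"
    unfolding eigfun_def test_fun_def
  proof (intro conjI ballI)
    fix e assume e: "e \<in> arcs G"
    show "C1 (\<lambda>x. f e (sqrt (g e) * x)) (u' e)" using d1[OF e] c0[OF e] by (auto simp: C1_def)
    show "C1 (u' e) (\<lambda>x. - (\<mu> / conductance g e) * (mass_density g \<rho> e x * f e (sqrt (g e) * x)))"
      unfolding C1_def using d2[OF e] c00[OF e] wc e
      by (auto intro!: continuous_intros simp: conductance_def)
  next
    show "\<exists>\<phi>. \<forall>e\<in>arcs G. f e (sqrt (g e) * 0) = \<phi> (tail G e) \<and> f e (sqrt (g e) * 1) = \<phi> (head G e)"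
      using \<phi> by auto
  next
    fix v assume v: "v \<in> verts G"
    have "conductance g e * u' e x = f' e (sqrt (g e) * x)" if "e \<in> arcs G" for e x
      using l[OF that] by (simp add: conductance_def u'_def)
    then show "(\<Sum>e | e \<in> arcs G \<and> tail G e = v. conductance g e * u' e 0) +
       (\<Sum>e | e \<in> arcs G \<and> head G e = v. - (conductance g e * u' e 1)) = 0"
      using kir[OF v] by simp
  qed
  then show thesis by (rule that)
qed

lemma eigfun_eigenspace:
  assumes adm: "(g, \<rho>) \<in> admissible G"
    and u: "eigfun (conductance g) (mass_density g \<rho>) \<mu> u u'"
  shows "(\<lambda>e s. if e \<in> arcs G \<and> s \<in> {0..sqrt (g e)} then u e (s / sqrt (g e)) else 0) \<in> eigenspace G g \<rho> \<mu>"
proof -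
  have l: "sqrt (g e) > 0" if "e \<in> arcs G" for e using adm that by (auto simp: admissible_def)
  have resc: "((\<lambda>s. F (s / l)) has_real_derivative F' (s / l) / l) (at s within {0..l})"
    if l: "l > 0" and F: "\<And>x. x \<in> {0..1} \<Longrightarrow> (F has_real_derivative F' x) (at x within {0..1})" and s: "s \<in> {0..l}"
    for F F' :: "real \<Rightarrow> real" and l s
  proof -
    have im: "(\<lambda>s. s / l) ` {0..l} \<subseteq> {0..1}" using l by auto
    have "((\<lambda>s. s / l) has_real_derivative 1 / l) (at s within {0..l})"
      using l by (auto intro!: derivative_eq_intros)
    moreover have "(F has_real_derivative F' (s / l)) (at (s / l) within (\<lambda>s. s / l) ` {0..l})"
      by (rule DERIV_subset[OF F im]) (use s l in auto)
    ultimately show ?thesis using DERIV_image_chain[of F "F' (s / l)" "\<lambda>s. s / l" s "{0..l}" "1 / l"]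
      by (simp add: o_def)
  qed
  define f where "f = (\<lambda>e s. if e \<in> arcs G \<and> s \<in> {0..sqrt (g e)} then u e (s / sqrt (g e)) else 0)"
  define f' where "f' = (\<lambda>e s. u' e (s / sqrt (g e)) / sqrt (g e))"
  define f'' where "f'' = (\<lambda>e s. - (\<mu> * \<rho> e (s / sqrt (g e)) * f e s))"
  obtain \<phi> where \<phi>: "\<And>e. e \<in> arcs G \<Longrightarrow> u e 0 = \<phi> (tail G e) \<and> u e 1 = \<phi> (head G e)"
    using u by (auto simp: eigfun_def test_fun_def)
  have u1: "\<And>e x. e \<in> arcs G \<Longrightarrow> x \<in> {0..1} \<Longrightarrow> (u e has_real_derivative u' e x) (at x within {0..1})"
    using u by (auto simp: eigfun_def test_fun_def C1_def)
  have u2: "\<And>e x. e \<in> arcs G \<Longrightarrow> x \<in> {0..1} \<Longrightarrow> (u' e has_real_derivative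
      - (\<mu> / conductance g e) * (mass_density g \<rho> e x * u e x)) (at x within {0..1})"
    using u by (auto simp: eigfun_def C1_def)
  have "\<forall>e s. \<not> (e \<in> arcs G \<and> s \<in> {0..edge_length g e}) \<longrightarrow> f e s = 0"
    by (auto simp: f_def edge_length_def)
  moreover have "\<forall>e\<in>arcs G. f e 0 = \<phi> (tail G e) \<and> f e (edge_length g e) = \<phi> (head G e)"
  proof
    fix e assume e: "e \<in> arcs G"
    then have "g e > 0" using l[OF e] by simp
    then show "f e 0 = \<phi> (tail G e) \<and> f e (edge_length g e) = \<phi> (head G e)"
      using \<phi>[OF e] e by (simp add: f_def edge_length_def)
  qed
  moreover have "\<forall>e\<in>arcs G. \<forall>s\<in>{0..edge_length g e}.
               (f e has_real_derivative f' e s) (at s within {0..edge_length g e}) \<and>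
               (f' e has_real_derivative f'' e s) (at s within {0..edge_length g e}) \<and>
               - f'' e s = \<mu> * \<rho> e (s / edge_length g e) * f e s"
  proof (intro ballI conjI)
    fix e s assume e: "e \<in> arcs G" and s': "s \<in> {0..edge_length g e}"
    then have s: "s \<in> {0..sqrt (g e)}" by (simp add: edge_length_def)
    have "((\<lambda>s. u e (s / sqrt (g e))) has_real_derivative f' e s) (at s within {0..sqrt (g e)})"
      unfolding f'_def by (rule resc[OF l[OF e] u1[OF e] s])
    then show "(f e has_real_derivative f' e s) (at s within {0..edge_length g e})"
      unfolding edge_length_def
      by (rule has_field_derivative_transform_within[OF _ zero_less_one s]) (use e in \<open>auto simp: f_def\<close>)
    have "((\<lambda>s. u' e (s / sqrt (g e)) / sqrt (g e)) has_real_derivative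
        (- (\<mu> / conductance g e) * (mass_density g \<rho> e (s / sqrt (g e)) * u e (s / sqrt (g e)))) / sqrt (g e) / sqrt (g e))
        (at s within {0..sqrt (g e)})"
      by (rule DERIV_cdivide[OF resc[OF l[OF e] u2[OF e] s]])
    moreover have "(- (\<mu> / conductance g e) * (mass_density g \<rho> e (s / sqrt (g e)) * u e (s / sqrt (g e)))) / sqrt (g e) / sqrt (g e) = f'' e s"
      using l[OF e] e s by (simp add: f''_def f_def conductance_def mass_density_def)
    ultimately show "(f' e has_real_derivative f'' e s) (at s within {0..edge_length g e})"
      by (simp add: f'_def edge_length_def)
    show "- f'' e s = \<mu> * \<rho> e (s / edge_length g e) * f e s" by (simp add: f''_def edge_length_def)
  qed
  moreover have "\<forall>v\<in>verts G. (\<Sum>e | e \<in> arcs G \<and> tail G e = v. f' e 0) +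
               (\<Sum>e | e \<in> arcs G \<and> head G e = v. - f' e (edge_length g e)) = 0"
  proof
    fix v assume v: "v \<in> verts G"
    have "f' e 0 = conductance g e * u' e 0" "f' e (edge_length g e) = conductance g e * u' e 1"
      if "e \<in> arcs G" for e
      using l[OF that] by (auto simp: f'_def conductance_def edge_length_def)
    then show "(\<Sum>e | e \<in> arcs G \<and> tail G e = v. f' e 0) +
               (\<Sum>e | e \<in> arcs G \<and> head G e = v. - f' e (edge_length g e)) = 0"
      using u v by (simp add: eigfun_def)
  qed
  ultimately show ?thesis unfolding eigenspace_def f_def[symmetric] by blast
qed

text \<open>An eigenfunction for \<open>\<nu> \<noteq> 0\<close> has mean zero, and its Rayleigh
  quotient \<open>\<nu>\<close> would undercut the minimum \<open>\<mu>\<close>. Negative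
  \<open>\<nu>\<close> are covered as well.\<close>

lemma first_eig_least:
  assumes wt: "weights a w" and f: "first_eig a w \<mu>" and u: "eigfun a w \<nu> u u'"
    and \<nu>: "\<nu> \<noteq> 0" "\<nu> < \<mu>" and e: "e \<in> arcs G" and x: "x \<in> {0..1}"
  shows "u e x = 0"
proof -
  note t = eigfun_test[OF u]
  have "\<nu> * mass w u (\<lambda>e x. 1) = 0"
    using eigfun_weak[OF wt u test_fun_const[of 1]] by (simp add: energy_def)
  then have "mass w u (\<lambda>e x. 1) = 0" using \<nu> by simp
  then have "\<mu> * mass w u u \<le> \<nu> * mass w u u"
    using f t eigfun_weak[OF wt u t] unfolding first_eig_def by metis
  then have "mass w u u \<le> 0" using \<nu> by (auto simp: mult_le_cancel_right)
  with mass_nonneg[OF wt test_fun_cont[OF t]] have "mass w u u = 0" by linarith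
  then show ?thesis using mass_eq_0D[OF wt test_fun_cont[OF t] _ e x] by blast
qed

lemma sum_edge_fun:
  "(\<Sum>b\<in>I. (\<lambda>e s. c b * b e s)) = (\<lambda>(e::'e) (s::real). \<Sum>b\<in>I. c b * b e s :: real)"
  by (induction I rule: infinite_finite_induct) (auto simp: fun_eq_iff)

text \<open>Below \<open>\<mu>\<close> the only multiplicity is that of \<open>0\<close>, which is
  one by connectedness, and at \<open>\<mu>\<close> there is at least one more. So the accumulated
  multiplicity exceeds \<open>1\<close> exactly from \<open>\<mu>\<close> on.\<close>

lemma eigval_1_eq_first_eig:
  assumes adm: "(g, \<rho>) \<in> admissible G"
    and first: "first_eig (conductance g) (mass_density g \<rho>) \<mu>"
  shows "eigval G g \<rho> 1 = \<mu>"
proof -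
  let ?a = "conductance g" and ?w = "mass_density g \<rho>"
  let ?V = "eigenspace G g \<rho>"
  have wt: "weights ?a ?w" by (rule admissible_weights[OF adm])
  have l: "sqrt (g e) > 0" if "e \<in> arcs G" for e using adm that by (auto simp: admissible_def)
  have \<mu>: "\<mu> > 0" using first by (simp add: first_eig_def)
  have out: "f e s = 0" if "f \<in> ?V \<nu>" "\<not> (e \<in> arcs G \<and> s \<in> {0..sqrt (g e)})" for f \<nu> e s
    using that unfolding eigenspace_def edge_length_def by blast
  have ext: "f = h" if f: "f \<in> ?V \<nu>" and h: "\<And>e s. \<not> (e \<in> arcs G \<and> s \<in> {0..sqrt (g e)}) \<Longrightarrow> h e s = 0"
    and eq: "\<And>e x. e \<in> arcs G \<Longrightarrow> x \<in> {0..1} \<Longrightarrow> f e (sqrt (g e) * x) = h e (sqrt (g e) * x)" for f h \<nu>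
  proof (intro ext)
    fix e s
    show "f e s = h e s"
    proof (cases "e \<in> arcs G \<and> s \<in> {0..sqrt (g e)}")
      case True
      then have "s / sqrt (g e) \<in> {0..1}" "sqrt (g e) * (s / sqrt (g e)) = s" using l[of e] by auto
      then show ?thesis using eq[of e "s / sqrt (g e)"] True by simp
    next
      case False then show ?thesis using out[OF f] h by auto
    qed
  qed
  have small: "multiplicity_of G g \<rho> \<nu> = 0" if \<nu>: "\<nu> \<noteq> 0" "\<nu> < \<mu>" for \<nu>
  proof -
    have "?V \<nu> \<subseteq> {0}"
    proof
      fix f assume f: "f \<in> ?V \<nu>"
      obtain u' where u: "eigfun ?a ?w \<nu> (\<lambda>e x. f e (sqrt (g e) * x)) u'"
        by (rule eigenspace_eigfun[OF adm f])
      have "f = (\<lambda>e s. 0)"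
        by (rule ext[OF f]) (use first_eig_least[OF wt first u \<nu>] in auto)
      then show "f \<in> {0}" by (auto simp: fun_eq_iff)
    qed
    then show ?thesis unfolding multiplicity_of_def
      using edge_fun.dim_unique[of "{}" "?V \<nu>" 0] by (simp add: edge_fun.independent_empty)
  qed
  have zero: "multiplicity_of G g \<rho> 0 = 1"
  proof -
    define k where "k = (\<lambda>e s. if e \<in> arcs G \<and> s \<in> {0..sqrt (g e)} then (\<lambda>e x. 1::real) e (s / sqrt (g e)) else 0)"
    have "eigfun ?a ?w 0 (\<lambda>e x. 1) (\<lambda>e x. 0)"
      unfolding eigfun_def using test_fun_const[of 1] C1_const[of 0] by simp
    then have k: "k \<in> ?V 0" unfolding k_def by (rule eigfun_eigenspace[OF adm])
    obtain e0 where e0: "e0 \<in> arcs G" using arcs_nonempty by auto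
    then have "k e0 0 = 1" using l[OF e0] by (simp add: k_def)
    then have k0: "k \<noteq> 0" by auto
    have "?V 0 \<subseteq> edge_fun.span {k}"
    proof
      fix f assume f: "f \<in> ?V 0"
      obtain u' where u: "eigfun ?a ?w 0 (\<lambda>e x. f e (sqrt (g e) * x)) u'"
        by (rule eigenspace_eigfun[OF adm f])
      have "energy ?a u' u' = 0" using eigfun_weak[OF wt u eigfun_test[OF u]] by simp
      then obtain c where c: "\<And>e x. e \<in> arcs G \<Longrightarrow> x \<in> {0..1} \<Longrightarrow> f e (sqrt (g e) * x) = c"
        using constant_if_energy_0[OF wt eigfun_test[OF u]] by blast
      have "f = (\<lambda>e s. c * k e s)"
        by (rule ext[OF f]) (use c l in \<open>auto simp: k_def mult_left_le less_imp_le\<close>)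
      then show "f \<in> edge_fun.span {k}"
        using edge_fun.span_scale[OF edge_fun.span_base[of k "{k}"], of c] by simp
    qed
    then show ?thesis unfolding multiplicity_of_def
      using edge_fun.dim_unique[of "{k}" "?V 0" 1] k k0 by simp
  qed
  have big: "multiplicity_of G g \<rho> \<mu> > 0"
  proof (rule ccontr)
    assume "\<not> ?thesis"
    then have d0: "edge_fun.dim (?V \<mu>) = 0" by (simp add: multiplicity_of_def)
    obtain B where B: "B \<subseteq> ?V \<mu>" "edge_fun.independent B" "?V \<mu> \<subseteq> edge_fun.span B" "card B = 0"
      by (rule edge_fun.basis_exists[of "?V \<mu>"]) (simp add: d0)
    \<comment> \<open>An infinite basis would also have \<open>card B = 0\<close>, so finiteness
      must be shown before concluding \<open>B = {}\<close>: any
      \<open>2 * card (arcs G) + 1\<close> of its members would be linearly dependent.\<close>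
    have "finite B"
    proof (rule ccontr)
      assume inf: "infinite B"
      then obtain I where I: "I \<subseteq> B" "finite I" "card I = Suc (2 * card (arcs G))"
        using infinite_arbitrarily_large by metis
      have "\<forall>f\<in>I. \<exists>u'. eigfun ?a ?w \<mu> (\<lambda>e x. f e (sqrt (g e) * x)) u'"
      proof
        fix f assume "f \<in> I"
        then have "f \<in> ?V \<mu>" using I(1) B(1) by auto
        from eigenspace_eigfun[OF adm this]
        show "\<exists>u'. eigfun ?a ?w \<mu> (\<lambda>e x. f e (sqrt (g e) * x)) u'" by metis
      qed
      then obtain U' where "\<forall>f\<in>I. eigfun ?a ?w \<mu> (\<lambda>e x. f e (sqrt (g e) * x)) (U' f)"
        unfolding bchoice_iff ..
      then have U': "\<And>f. f \<in> I \<Longrightarrow> eigfun ?a ?w \<mu> (\<lambda>e x. f e (sqrt (g e) * x)) (U' f)" by (rule bspec)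
      have lt: "2 * card (arcs G) < card I" using I(3) by simp
      have "\<exists>c. (\<exists>f\<in>I. c f \<noteq> 0) \<and> (\<forall>e\<in>arcs G. \<forall>x\<in>{0..1}.
          (\<Sum>f\<in>I. c f * f e (sqrt (g e) * x)) = 0 \<and> (\<Sum>f\<in>I. c f * U' f e x) = 0)"
        by (rule eigfun_dependent[OF wt I(2) lt U'])
      then obtain c where C: "(\<exists>f\<in>I. c f \<noteq> 0) \<and> (\<forall>e\<in>arcs G. \<forall>x\<in>{0..1}.
          (\<Sum>f\<in>I. c f * f e (sqrt (g e) * x)) = 0 \<and> (\<Sum>f\<in>I. c f * U' f e x) = 0)" ..
      have c: "\<exists>f\<in>I. c f \<noteq> 0" using C by (rule conjunct1)
      have c': "(\<Sum>f\<in>I. c f * f e (sqrt (g e) * x)) = 0" if "e \<in> arcs G" "x \<in> {0..1}" for e x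
        using conjunct1[OF bspec[OF bspec[OF conjunct2[OF C] that(1)] that(2)]] .
      have "(\<Sum>f\<in>I. c f * f e s) = 0" for e s
      proof (cases "e \<in> arcs G \<and> s \<in> {0..sqrt (g e)}")
        case True
        then have "s / sqrt (g e) \<in> {0..1}" "sqrt (g e) * (s / sqrt (g e)) = s" using l[of e] by auto
        then show ?thesis using c'[of e "s / sqrt (g e)"] True by simp
      next
        case False
        show ?thesis
        proof (intro sum.neutral ballI)
          fix f assume "f \<in> I"
          then have "f \<in> ?V \<mu>" using I(1) B(1) by auto
          then show "c f * f e s = 0" using out[OF _ False] by simp
        qed
      qed
      then have "(\<Sum>f\<in>I. (\<lambda>e s. c f * f e s)) = 0" unfolding sum_edge_fun by (auto simp: fun_eq_iff)
      then show False using edge_fun.independentD[OF B(2) I(2,1)] c by blast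
    qed
    with B(4) have "B = {}" by simp
    with B(3) have sub: "?V \<mu> \<subseteq> {0}" by simp
    obtain u u' where u: "eigfun ?a ?w \<mu> u u'" "mass ?w u u = 1" using first by (auto simp: first_eig_def)
    have "(\<lambda>e s. if e \<in> arcs G \<and> s \<in> {0..sqrt (g e)} then u e (s / sqrt (g e)) else 0) = 0"
      using eigfun_eigenspace[OF adm u(1)] sub by auto
    then have z: "(if e \<in> arcs G \<and> s \<in> {0..sqrt (g e)} then u e (s / sqrt (g e)) else 0) = 0" for e s
      by (auto simp: fun_eq_iff)
    have "u e x = 0" if e: "e \<in> arcs G" and x: "x \<in> {0..1}" for e x
      using z[of e "sqrt (g e) * x"] l[OF e] x e by (auto simp: mult_left_le split: if_splits)
    then have "integral {0..1} (\<lambda>x. ?w e x * (u e x * u e x)) = 0" if "e \<in> arcs G" for e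
      using that integral_cong[of "{0..1}" "\<lambda>x. ?w e x * (u e x * u e x)" "\<lambda>x. 0"] by simp
    then have "mass ?w u u = 0" unfolding mass_def by simp
    with u(2) show False by simp
  qed
  have "(\<exists>S. finite S \<and> S \<subseteq> {..\<nu>} \<and> 1 < (\<Sum>\<kappa>\<in>S. multiplicity_of G g \<rho> \<kappa>)) \<longleftrightarrow> \<mu> \<le> \<nu>" for \<nu>
  proof
    assume "\<exists>S. finite S \<and> S \<subseteq> {..\<nu>} \<and> 1 < (\<Sum>\<kappa>\<in>S. multiplicity_of G g \<rho> \<kappa>)"
    then obtain S where S: "finite S" "S \<subseteq> {..\<nu>}" "1 < (\<Sum>\<kappa>\<in>S. multiplicity_of G g \<rho> \<kappa>)" by blast
    show "\<mu> \<le> \<nu>"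
    proof (rule ccontr)
      assume "\<not> \<mu> \<le> \<nu>"
      have "(\<Sum>\<kappa>\<in>S. multiplicity_of G g \<rho> \<kappa>) \<le> (\<Sum>\<kappa>\<in>S. if \<kappa> = 0 then 1 else 0)"
      proof (rule sum_mono)
        fix \<kappa> assume "\<kappa> \<in> S"
        then have "\<kappa> < \<mu>" using S(2) \<open>\<not> \<mu> \<le> \<nu>\<close> by auto
        then show "multiplicity_of G g \<rho> \<kappa> \<le> (if \<kappa> = 0 then 1 else 0)" using small[of \<kappa>] zero by simp
      qed
      also have "\<dots> \<le> 1" using S(1) by (simp add: sum.delta)
      finally show False using S(3) by simp
    qed
  next
    assume "\<mu> \<le> \<nu>"
    then show "\<exists>S. finite S \<and> S \<subseteq> {..\<nu>} \<and> 1 < (\<Sum>\<kappa>\<in>S. multiplicity_of G g \<rho> \<kappa>)"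
      using zero big \<mu> by (intro exI[of _ "{0, \<mu>}"]) auto
  qed
  then have "{\<nu>. \<exists>S. finite S \<and> S \<subseteq> {..\<nu>} \<and> 1 < (\<Sum>\<kappa>\<in>S. multiplicity_of G g \<rho> \<kappa>)} = {\<mu>..}" by auto
  then show ?thesis by (simp add: eigval_def)
qed

subsection \<open>First variation of the eigenvalue\<close>

text \<open>Together with \<open>pert_mass\<close> these are exactly the weights of
  \<open>metric_family\<close> and \<open>density_family\<close>. Affine dependence of the mass
  density on \<open>t\<close> lets the perturbed mass form split without remainder.\<close>

definition pert_cond :: "('e \<Rightarrow> real) \<Rightarrow> ('e \<Rightarrow> real) \<Rightarrow> real \<Rightarrow> 'e \<Rightarrow> real" where
  "pert_cond a \<gamma> t e = a e * exp (t * \<gamma> e)"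

definition pert_mass :: "('e \<Rightarrow> real \<Rightarrow> real) \<Rightarrow> ('e \<Rightarrow> real \<Rightarrow> real) \<Rightarrow> real \<Rightarrow> 'e \<Rightarrow> real \<Rightarrow> real" where
  "pert_mass w \<eta> t e x = w e x + t * \<eta> e x"

text \<open>Derivative at \<open>0\<close> of \<open>A(t) D\<^sub>t(f) - A(0) \<mu> N\<^sub>t(f)\<close> for an eigenfunction \<open>f\<close> with eigenvalue \<open>\<mu>\<close>
  and \<open>N\<^sub>0(f) = 1\<close>, where \<open>D\<^sub>t\<close> and \<open>N\<^sub>t\<close> are the energy and mass forms of the perturbed weights.\<close>

definition variation ::
  "('e \<Rightarrow> real) \<Rightarrow> real \<Rightarrow> real \<Rightarrow> real \<Rightarrow> ('e \<Rightarrow> real) \<Rightarrow> ('e \<Rightarrow> real \<Rightarrow> real) \<Rightarrow>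
   ('e \<Rightarrow> real \<Rightarrow> real) \<Rightarrow> ('e \<Rightarrow> real \<Rightarrow> real) \<Rightarrow> real" where
  "variation a \<mu> A0 A' \<gamma> \<eta> f f' = A' * \<mu> + A0 * energy (\<lambda>e. a e * \<gamma> e) f' f' - A0 * \<mu> * mass \<eta> f f"

lemma mass_pert:
  assumes "edge_cont w" "edge_cont \<eta>" "edge_cont u" "edge_cont v"
  shows "mass (pert_mass w \<eta> t) u v = mass w u v + t * mass \<eta> u v"
proof -
  have "integral {0..1} (\<lambda>x. pert_mass w \<eta> t e x * (u e x * v e x)) =
      1 * integral {0..1} (\<lambda>x. w e x * (u e x * v e x)) + t * integral {0..1} (\<lambda>x. \<eta> e x * (u e x * v e x))"
    if "e \<in> arcs G" for e
    using assms that
    by (subst integral01_lin[symmetric]) (auto intro!: continuous_intros simp: algebra_simps pert_mass_def)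
  then show ?thesis by (simp add: mass_def sum_distrib_left sum.distrib)
qed

text \<open>Uniformity in \<open>t\<close> is the point: \<open>eigfun_compactness\<close> demands
  one lower bound along a whole sequence of perturbations.\<close>

lemma pert_bounds:
  assumes wt: "weights a w" and \<eta>: "edge_cont \<eta>"
  obtains b c where "0 < b" "0 < c"
    "\<And>t. \<bar>t\<bar> < b \<Longrightarrow> weights (pert_cond a \<gamma> t) (pert_mass w \<eta> t)"
    "\<And>t e. \<bar>t\<bar> < b \<Longrightarrow> e \<in> arcs G \<Longrightarrow> c \<le> pert_cond a \<gamma> t e"
    "\<And>t e x. \<bar>t\<bar> < b \<Longrightarrow> e \<in> arcs G \<Longrightarrow> x \<in> {0..1} \<Longrightarrow> c \<le> pert_mass w \<eta> t e x"
proof -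
  obtain c where c: "0 < c" "\<And>e. e \<in> arcs G \<Longrightarrow> c \<le> a e"
    "\<And>e x. e \<in> arcs G \<Longrightarrow> x \<in> {0..1} \<Longrightarrow> c \<le> w e x"
    using weights_lower_bound[OF wt] by blast
  have "\<exists>m. \<forall>x\<in>{0..1}. \<bar>\<eta> e x\<bar> \<le> m" if e: "e \<in> arcs G" for e
  proof -
    have "bounded (\<eta> e ` {0..1})" using \<eta> e by (intro compact_imp_bounded compact_continuous_image) auto
    then show ?thesis by (auto simp: bounded_iff)
  qed
  then obtain m where m: "\<And>e x. e \<in> arcs G \<Longrightarrow> x \<in> {0..1} \<Longrightarrow> \<bar>\<eta> e x\<bar> \<le> m e" by metis
  define L where "L = (\<Sum>e\<in>arcs G. \<bar>m e\<bar> + \<bar>\<gamma> e\<bar>) + 1"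
  have L: "\<bar>m e\<bar> + \<bar>\<gamma> e\<bar> \<le> L" if "e \<in> arcs G" for e
    using member_le_sum[OF that, of "\<lambda>e. \<bar>m e\<bar> + \<bar>\<gamma> e\<bar>"] by (simp add: L_def)
  have L1: "L \<ge> 1" unfolding L_def by (simp add: sum_nonneg)
  \<comment> \<open>For \<open>\<bar>t\<bar> < b\<close> both \<open>t * \<gamma> e\<close> and
    \<open>t * \<eta> e x\<close> are at most \<open>min 1 c / 2\<close> in modulus. Then
    \<open>exp y \<ge> 1 + y\<close> leaves at least half of the conductance, and the mass density
    loses at most \<open>c / 2\<close>.\<close>
  define b where "b = min 1 c / (2 * L)"
  have b: "b > 0" using c L1 by (simp add: b_def)
  have tb: "\<bar>t\<bar> * L \<le> 1 / 2" "\<bar>t\<bar> * L \<le> c / 2" if "\<bar>t\<bar> < b" for t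
  proof -
    have "\<bar>t\<bar> * L \<le> b * L" using that L1 by (intro mult_right_mono) auto
    also have "b * L = min 1 c / 2" using L1 by (simp add: b_def)
    finally show "\<bar>t\<bar> * L \<le> 1 / 2" "\<bar>t\<bar> * L \<le> c / 2" by auto
  qed
  have pc: "c / 2 \<le> pert_cond a \<gamma> t e" if t: "\<bar>t\<bar> < b" and e: "e \<in> arcs G" for t e
  proof -
    have "\<bar>t * \<gamma> e\<bar> \<le> \<bar>t\<bar> * L" unfolding abs_mult using L[OF e] by (intro mult_left_mono) auto
    then have "1 / 2 \<le> 1 + t * \<gamma> e" using tb(1)[OF t] by linarith
    also have "\<dots> \<le> exp (t * \<gamma> e)" by (rule exp_ge_add_one_self)
    finally have "c * (1 / 2) \<le> a e * exp (t * \<gamma> e)" using c(1) c(2)[OF e] by (intro mult_mono) auto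
    then show ?thesis by (simp add: pert_cond_def)
  qed
  have pm: "c / 2 \<le> pert_mass w \<eta> t e x" if t: "\<bar>t\<bar> < b" and e: "e \<in> arcs G" and x: "x \<in> {0..1}" for t e x
  proof -
    have "\<bar>t * \<eta> e x\<bar> \<le> \<bar>t\<bar> * L" unfolding abs_mult using L[OF e] m[OF e x] by (intro mult_left_mono) auto
    then show ?thesis using tb(2)[OF t] c(3)[OF e x] unfolding pert_mass_def by linarith
  qed
  have "weights (pert_cond a \<gamma> t) (pert_mass w \<eta> t)" if t: "\<bar>t\<bar> < b" for t
    unfolding weights_def
  proof (intro ballI conjI)
    fix e assume e: "e \<in> arcs G"
    show "0 < pert_cond a \<gamma> t e" using pc[OF t e] c(1) by linarith
    show "continuous_on {0..1} (pert_mass w \<eta> t e)"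
      using \<eta> weights_cont[OF wt] e unfolding pert_mass_def[abs_def] by (auto intro!: continuous_intros)
    show "0 < pert_mass w \<eta> t e x" if "x \<in> {0..1}" for x using pm[OF t e that] c(1) by linarith
  qed
  with b c(1) pc pm show thesis by (intro that[of b "c / 2"]) auto
qed

lemma eigfun_mean_zero:
  assumes "weights a w" "eigfun a w \<mu> u u'" "\<mu> \<noteq> 0"
  shows "mass w u (\<lambda>e x. 1) = 0"
  using eigfun_weak[OF assms(1,2) test_fun_const[of 1]] assms(3) by (simp add: energy_def)

text \<open>Testing the perturbed problem with the unperturbed eigenfunction gives an explicit
  quotient \<open>U\<close> that is differentiable at \<open>0\<close> and touches the product
  \<open>\<Lambda> t * A t\<close> there from above.\<close>

lemma variation_upper:
  assumes wt: "weights a w" and \<eta>: "edge_cont \<eta>" and f: "eigfun a w \<mu> f f'" "mass w f f = 1" and \<mu>: "\<mu> > 0"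
    and A: "(A has_real_derivative A') (at 0)" "A 0 > 0" and b: "0 < b"
    and \<Lambda>: "\<And>t. \<bar>t\<bar> < b \<Longrightarrow> first_eig (pert_cond a \<gamma> t) (pert_mass w \<eta> t) (\<Lambda> t)"
  obtains U where "(U has_real_derivative variation a \<mu> (A 0) A' \<gamma> \<eta> f f') (at 0)" "U 0 = \<mu> * A 0"
    and "\<forall>\<^sub>F t in nhds 0. \<Lambda> t * A t \<le> U t"
proof -
  let ?o = "\<lambda>(e::'e) (x::real). 1::real"
  have tf: "test_fun f f'" by (rule eigfun_test[OF f(1)])
  have fc: "edge_cont f" "edge_cont f'" using test_fun_cont[OF tf] test_fun_cont_deriv[OF tf] by auto
  have oc: "edge_cont ?o" by auto
  have wc: "edge_cont w" by (rule weights_cont[OF wt])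
  define K where "K e = integral {0..1} (\<lambda>x. f' e x * f' e x)" for e
  define p where "p = mass \<eta> f f"
  define r where "r = mass \<eta> f ?o"
  define s where "s = mass \<eta> ?o ?o"
  define M where "M = mass w ?o ?o"
  have M: "M > 0" unfolding M_def by (rule mass_one_pos[OF wt])
  define E where "E t = (\<Sum>e\<in>arcs G. pert_cond a \<gamma> t e * K e)" for t
  \<comment> \<open>Mass of \<open>f\<close> after centring with respect to the perturbed weights.
    The mean of \<open>f\<close> vanishes at \<open>t = 0\<close>, so the correction is quadratic in
    \<open>t\<close> and does not affect the derivative.\<close>
  define N where "N t = 1 + t * p - (t * r)\<^sup>2 / (M + t * s)" for t
  define U where "U t = A t * E t / N t" for t
  have E0: "E 0 = \<mu>"
    using eigfun_weak[OF wt f(1) tf] f(2) by (simp add: E_def K_def energy_def pert_cond_def)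
  have N0: "N 0 = 1" by (simp add: N_def)
  have dE: "(E has_real_derivative energy (\<lambda>e. a e * \<gamma> e) f' f') (at 0)"
    unfolding E_def[abs_def] pert_cond_def energy_def K_def[symmetric]
    by (rule DERIV_sum) (auto intro!: derivative_eq_intros)
  have dN: "(N has_real_derivative p) (at 0)"
    unfolding N_def[abs_def] using M by (auto intro!: derivative_eq_intros)
  have dU: "(U has_real_derivative variation a \<mu> (A 0) A' \<gamma> \<eta> f f') (at 0)"
    unfolding U_def[abs_def]
    by (rule derivative_eq_intros A dE dN refl | simp add: N0 E0)+
      (simp add: variation_def p_def algebra_simps)
  have "isCont N 0" using dN by (rule DERIV_isCont)
  then have "(N \<longlongrightarrow> N 0) (nhds 0)" by (simp add: isCont_def tendsto_at_iff_tendsto_nhds)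
  then have ev1: "\<forall>\<^sub>F t in nhds 0. N t > 0" by (rule order_tendstoD(1)) (simp add: N0)
  have "isCont A 0" using A(1) by (rule DERIV_isCont)
  then have "(A \<longlongrightarrow> A 0) (nhds 0)" by (simp add: isCont_def tendsto_at_iff_tendsto_nhds)
  then have ev2: "\<forall>\<^sub>F t in nhds 0. A t > 0" by (rule order_tendstoD(1)) (rule A(2))
  obtain b' c where b': "0 < b'" "0 < c"
    "\<And>t. \<bar>t\<bar> < b' \<Longrightarrow> weights (pert_cond a \<gamma> t) (pert_mass w \<eta> t)"
    "\<And>t e. \<bar>t\<bar> < b' \<Longrightarrow> e \<in> arcs G \<Longrightarrow> c \<le> pert_cond a \<gamma> t e"
    "\<And>t e x. \<bar>t\<bar> < b' \<Longrightarrow> e \<in> arcs G \<Longrightarrow> x \<in> {0..1} \<Longrightarrow> c \<le> pert_mass w \<eta> t e x"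
    using pert_bounds[OF wt \<eta>, of \<gamma>] by blast
  have ev3: "\<forall>\<^sub>F t in nhds (0::real). \<bar>t\<bar> < min b b'"
    unfolding eventually_nhds_metric using b b'(1) by (intro exI[of _ "min b b'"]) auto
  have "\<forall>\<^sub>F t in nhds 0. \<Lambda> t * A t \<le> U t"
    using ev1 ev2 ev3
  proof eventually_elim
    case (elim t)
    have t: "\<bar>t\<bar> < b" "\<bar>t\<bar> < b'" using elim by auto
    have "\<Lambda> t * (mass (pert_mass w \<eta> t) f f - (mass (pert_mass w \<eta> t) f ?o)\<^sup>2 / mass (pert_mass w \<eta> t) ?o ?o)
      \<le> energy (pert_cond a \<gamma> t) f' f'"
      by (rule first_eig_ineq[OF b'(3)[OF t(2)] \<Lambda>[OF t(1)] tf])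
    moreover have "mass (pert_mass w \<eta> t) f f - (mass (pert_mass w \<eta> t) f ?o)\<^sup>2 / mass (pert_mass w \<eta> t) ?o ?o = N t"
      using eigfun_mean_zero[OF wt f(1)] \<mu>
      by (simp add: mass_pert[OF wc \<eta> fc(1) fc(1)] mass_pert[OF wc \<eta> fc(1) oc] mass_pert[OF wc \<eta> oc oc]
          f(2) N_def p_def r_def s_def M_def)
    moreover have "energy (pert_cond a \<gamma> t) f' f' = E t" by (simp add: energy_def E_def K_def)
    ultimately have "\<Lambda> t * N t \<le> E t" by simp
    then have "\<Lambda> t * N t * A t \<le> E t * A t" using elim by (intro mult_right_mono) auto
    then show ?case using elim by (simp add: U_def field_simps)
  qed
  moreover have "U 0 = \<mu> * A 0" by (simp add: U_def N0 E0)
  ultimately show thesis using dU by (intro that[of U])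
qed

text \<open>Here perturbed eigenfunctions are tested in the unperturbed problem. They subconverge to
  an eigenfunction that cannot be prescribed, hence the existential conclusion.\<close>

lemma variation_lower:
  assumes wt: "weights a w" and \<eta>: "edge_cont \<eta>" and first: "first_eig a w \<mu>"
    and A: "(A has_real_derivative A') (at 0)" "A 0 > 0"
    and T: "T \<longlonglongrightarrow> 0" "\<And>k. 0 < T k"
    and \<Lambda>: "\<And>k. first_eig (pert_cond a \<gamma> (T k)) (pert_mass w \<eta> (T k)) (\<Lambda> k)"
    and r: "(\<lambda>k. R k / T k) \<longlonglongrightarrow> 0" and le: "\<And>k. \<Lambda> k * A (T k) \<le> \<mu> * A 0 + R k"
  obtains f f' where "eigfun a w \<mu> f f'" "mass w f f = 1" "variation a \<mu> (A 0) A' \<gamma> \<eta> f f' \<le> 0"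
proof -
  let ?o = "\<lambda>(e::'e) (x::real). 1::real"
  have oc: "edge_cont ?o" by auto
  have wc: "edge_cont w" by (rule weights_cont[OF wt])
  have \<mu>: "\<mu> > 0" using first by (simp add: first_eig_def)
  obtain b c where bc: "0 < b" "0 < c"
    "\<And>t. \<bar>t\<bar> < b \<Longrightarrow> weights (pert_cond a \<gamma> t) (pert_mass w \<eta> t)"
    "\<And>t e. \<bar>t\<bar> < b \<Longrightarrow> e \<in> arcs G \<Longrightarrow> c \<le> pert_cond a \<gamma> t e"
    "\<And>t e x. \<bar>t\<bar> < b \<Longrightarrow> e \<in> arcs G \<Longrightarrow> x \<in> {0..1} \<Longrightarrow> c \<le> pert_mass w \<eta> t e x"
    using pert_bounds[OF wt \<eta>, of \<gamma>] by blast
  have cA: "isCont A 0" using A(1) by (rule DERIV_isCont)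
  have AT: "(\<lambda>k. A (T k)) \<longlonglongrightarrow> A 0" by (rule isCont_tendsto_compose[OF cA T(1)])
  have R0: "R \<longlonglongrightarrow> 0"
  proof -
    have "(\<lambda>k. R k / T k * T k) \<longlonglongrightarrow> 0 * 0" by (intro tendsto_mult r T(1))
    moreover have "R k / T k * T k = R k" for k using T(2)[of k] by simp
    ultimately show ?thesis by simp
  qed
  have \<Lambda>pos: "\<Lambda> k > 0" for k using \<Lambda>[of k] by (simp add: first_eig_def)
  have "\<forall>\<^sub>F k in sequentially. A (T k) > A 0 / 2 \<and> T k < b \<and> R k < 1"
    using order_tendstoD(1)[OF AT, of "A 0 / 2"] order_tendstoD(2)[OF T(1) bc(1)]
      order_tendstoD(2)[OF R0, of 1] A(2) by (auto intro: eventually_conj)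
  then obtain n0 where n0: "\<And>k. k \<ge> n0 \<Longrightarrow> A (T k) > A 0 / 2 \<and> T k < b \<and> R k < 1"
    by (auto simp: eventually_sequentially)
  \<comment> \<open>Beyond \<open>n0\<close> the factor \<open>A (T k)\<close> exceeds
    \<open>A 0 / 2\<close> and the error is below \<open>1\<close>, so \<open>le\<close> bounds the
    perturbed eigenvalues and a subsequence of them converges.\<close>
  define C where "C = (\<mu> * A 0 + 1) / (A 0 / 2)"
  have \<Lambda>C: "\<Lambda> (k + n0) \<in> {0..C}" for k
  proof -
    have "\<Lambda> (k + n0) * (A 0 / 2) \<le> \<Lambda> (k + n0) * A (T (k + n0))"
      using n0[of "k + n0"] \<Lambda>pos[of "k + n0"] by (intro mult_left_mono) auto
    also have "\<dots> \<le> \<mu> * A 0 + 1" using le[of "k + n0"] n0[of "k + n0"] by linarith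
    finally have "\<Lambda> (k + n0) \<le> C" unfolding C_def using A(2) by (simp add: field_simps)
    then show ?thesis using \<Lambda>pos[of "k + n0"] by auto
  qed
  obtain \<mu>' s where s: "strict_mono (s :: nat \<Rightarrow> nat)" "(\<lambda>k. \<Lambda> (s k + n0)) \<longlonglongrightarrow> \<mu>'"
  proof -
    have "seq_compact {0..C}" by (rule compact_imp_seq_compact) simp
    from seq_compactE[OF this, of "\<lambda>k. \<Lambda> (k + n0)"] \<Lambda>C that show thesis
      by (metis (no_types, lifting) comp_apply ext)
  qed
  define j where "j k = s k + n0" for k
  have j: "strict_mono j" using s(1) by (auto simp: j_def strict_mono_def)
  have Tj: "(\<lambda>k. T (j k)) \<longlonglongrightarrow> 0" by (rule filterlim_compose[OF T(1) filterlim_subseq[OF j]])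
  have Tb: "\<bar>T (j k)\<bar> < b" for k using n0[of "j k"] T(2)[of "j k"] by (auto simp: j_def)
  have "\<forall>k. \<exists>u u'. eigfun (pert_cond a \<gamma> (T (j k))) (pert_mass w \<eta> (T (j k))) (\<Lambda> (j k)) u u' \<and>
      mass (pert_mass w \<eta> (T (j k))) u u = 1"
    using \<Lambda> unfolding first_eig_def by blast
  then obtain U U' where U: "\<And>k. eigfun (pert_cond a \<gamma> (T (j k))) (pert_mass w \<eta> (T (j k))) (\<Lambda> (j k)) (U k) (U' k)"
    and U1: "\<And>k. mass (pert_mass w \<eta> (T (j k))) (U k) (U k) = 1" by metis
  have Al: "(\<lambda>k. pert_cond a \<gamma> (T (j k)) e) \<longlonglongrightarrow> a e" for e
  proof -
    have "(\<lambda>k. a e * exp (T (j k) * \<gamma> e)) \<longlonglongrightarrow> a e * exp (0 * \<gamma> e)" by (intro tendsto_intros Tj)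
    then show ?thesis by (simp add: pert_cond_def)
  qed
  have Wl: "uniform_limit {0..1} (\<lambda>k. pert_mass w \<eta> (T (j k)) e) (w e) sequentially" if e: "e \<in> arcs G" for e
  proof -
    have "bounded (\<eta> e ` {0..1})" using \<eta> e by (intro compact_imp_bounded compact_continuous_image) auto
    moreover have "uniform_limit {0..1} (\<lambda>k (x::real). T (j k)) (\<lambda>x. 0) sequentially"
      using Tj by (auto simp: uniform_limit_iff tendsto_iff)
    ultimately have "uniform_limit {0..1} (\<lambda>k x. w e x + T (j k) * \<eta> e x) (\<lambda>x. w e x + 0 * \<eta> e x) sequentially"
      by (intro uniform_limit_add uniform_lim_mult uniform_limit_const)
        (auto simp: bounded_iff intro: exI[of _ 0])
    then show ?thesis by (simp add: pert_mass_def[abs_def])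
  qed
  have U1': "mass (pert_mass w \<eta> (T (j k))) (U k) (U k) \<le> 1" for k using U1 by simp
  have s2: "(\<lambda>k. \<Lambda> (j k)) \<longlonglongrightarrow> \<mu>'" using s(2) by (simp add: j_def)
  obtain q u u' where q: "strict_mono (q :: nat \<Rightarrow> nat)" and u: "eigfun a w \<mu>' u u'"
    and Ul: "\<And>e. e \<in> arcs G \<Longrightarrow> uniform_limit {0..1} (\<lambda>k. U (q k) e) (u e) sequentially"
    and Xl: "\<And>e. e \<in> arcs G \<Longrightarrow>
      (\<lambda>k. integral {0..1} (\<lambda>x. U' (q k) e x * U' (q k) e x)) \<longlonglongrightarrow> integral {0..1} (\<lambda>x. u' e x * u' e x)"
    by (rule eigfun_compactness[OF wt bc(3)[OF Tb] U bc(2) bc(4)[OF Tb] bc(5)[OF Tb] U1' Al Wl s2]) simp_all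
  define \<tau> where "\<tau> k = T (j (q k))" for k
  note sub = filterlim_subseq[OF q]
  have \<tau>: "\<tau> \<longlonglongrightarrow> 0" "\<And>k. \<tau> k > 0" "\<And>k. \<bar>\<tau> k\<bar> < b"
    using filterlim_compose[OF Tj sub] T(2) Tb by (auto simp: \<tau>_def[abs_def])
  have tU: "test_fun (U k) (U' k)" for k by (rule eigfun_test[OF U])
  have tu: "test_fun u u'" by (rule eigfun_test[OF u])
  have Uc: "edge_cont (U k)" for k by (rule test_fun_cont[OF tU])
  have uc: "edge_cont u" by (rule test_fun_cont[OF tu])
  have Wc: "edge_cont (pert_mass w \<eta> (T (j k)))" for k by (rule weights_cont[OF bc(3)[OF Tb]])
  have "(\<lambda>k. mass (pert_mass w \<eta> (T (j (q k)))) (U (q k)) (U (q k))) \<longlonglongrightarrow> mass w u u"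
    by (rule mass_limit[OF filterlim_compose[OF Wl sub] Ul Ul]) (use Wc Uc uc wc in auto)
  then have u1: "mass w u u = 1" using U1 by (simp add: LIMSEQ_const_iff)
  have Um: "mass (pert_mass w \<eta> (T (j k))) (U k) ?o = 0" for k
    using eigfun_mean_zero[OF bc(3)[OF Tb] U] \<Lambda>pos[of "j k"] by simp
  have "(\<lambda>k. mass (pert_mass w \<eta> (T (j (q k)))) (U (q k)) ?o) \<longlonglongrightarrow> mass w u ?o"
    by (rule mass_limit[OF filterlim_compose[OF Wl sub] Ul uniform_limit_const]) (use Wc Uc uc wc in auto)
  then have u0: "mass w u ?o = 0" using Um by (simp add: LIMSEQ_const_iff)
  have eu: "energy a u' u' = \<mu>'" using eigfun_weak[OF wt u tu] u1 by simp
  \<comment> \<open>The limit eigenvalue is \<open>\<mu>\<close> itself: at least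
    \<open>\<mu>\<close> because \<open>u\<close> is a mean-zero competitor, at most
    \<open>\<mu>\<close> by passing to the limit in \<open>le\<close>.\<close>
  have "\<mu> * mass w u u \<le> energy a u' u'" using first tu u0 unfolding first_eig_def by blast
  then have ge: "\<mu> \<le> \<mu>'" using eu u1 by simp
  have "\<mu>' * A 0 \<le> \<mu> * A 0 + 0"
  proof (rule LIMSEQ_le)
    show "(\<lambda>k. \<Lambda> (j k) * A (T (j k))) \<longlonglongrightarrow> \<mu>' * A 0"
      by (intro tendsto_mult s2 filterlim_compose[OF AT filterlim_subseq[OF j]])
    show "(\<lambda>k. \<mu> * A 0 + R (j k)) \<longlonglongrightarrow> \<mu> * A 0 + 0"
      by (intro tendsto_intros filterlim_compose[OF R0 filterlim_subseq[OF j]])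
  qed (use le in auto)
  with ge A(2) have \<mu>': "\<mu>' = \<mu>" by auto
  define X where "X k e = integral {0..1} (\<lambda>x. U' (q k) e x * U' (q k) e x)" for k e
  define Z where "Z e = integral {0..1} (\<lambda>x. u' e x * u' e x)" for e
  define P where "P k = mass \<eta> (U (q k)) (U (q k))" for k
  define S where "S k = mass \<eta> (U (q k)) ?o" for k
  define M where "M = mass w ?o ?o"
  have M: "M > 0" unfolding M_def by (rule mass_one_pos[OF wt])
  have Pl: "P \<longlonglongrightarrow> mass \<eta> u u" unfolding P_def[abs_def]
    by (rule mass_limit[OF uniform_limit_const Ul Ul]) (use \<eta> Uc uc in auto)
  have Sl: "S \<longlonglongrightarrow> mass \<eta> u ?o" unfolding S_def[abs_def]
    by (rule mass_limit[OF uniform_limit_const Ul uniform_limit_const]) (use \<eta> Uc uc in auto)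
  have Rl: "(\<lambda>k. R (j (q k)) / \<tau> k) \<longlonglongrightarrow> 0"
    using filterlim_compose[OF r filterlim_subseq[OF strict_mono_o[OF j q]]] by (simp add: \<tau>_def)
  \<comment> \<open>Subtract \<open>A 0\<close> times the Rayleigh bound for the unperturbed weights
    from \<open>A (\<tau> k)\<close> times the perturbed energy identity and divide by
    \<open>\<tau> k\<close>. The last factors on the left are then difference quotients, and the
    edge energies \<open>X k e\<close> only have to converge.\<close>
  have main: "(\<Sum>e\<in>arcs G. a e * X k e * ((A (\<tau> k) * exp (\<tau> k * \<gamma> e) - A 0) / \<tau> k)) \<le>
      R (j (q k)) / \<tau> k + A 0 * \<mu> * (P k + \<tau> k * (S k)\<^sup>2 / M)" for k
  proof -
    have m1: "mass w (U (q k)) (U (q k)) = 1 - \<tau> k * P k"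
      using U1[of "q k"] by (simp add: mass_pert[OF wc \<eta> Uc Uc] P_def \<tau>_def)
    have m2: "mass w (U (q k)) ?o = - (\<tau> k * S k)"
      using Um[of "q k"] by (simp add: mass_pert[OF wc \<eta> Uc oc] S_def \<tau>_def)
    have "\<mu> * (1 - \<tau> k * P k - (- (\<tau> k * S k))\<^sup>2 / M) \<le> energy a (U' (q k)) (U' (q k))"
      using first_eig_ineq[OF wt first tU[of "q k"]] unfolding m1 m2 M_def .
    then have "A 0 * (\<mu> * (1 - \<tau> k * P k - (\<tau> k * S k)\<^sup>2 / M)) \<le> A 0 * (\<Sum>e\<in>arcs G. a e * X k e)"
      using A(2) by (intro mult_left_mono) (auto simp: energy_def X_def)
    moreover have "A (\<tau> k) * (\<Sum>e\<in>arcs G. a e * exp (\<tau> k * \<gamma> e) * X k e) \<le> \<mu> * A 0 + R (j (q k))"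
    proof -
      have "(\<Sum>e\<in>arcs G. a e * exp (\<tau> k * \<gamma> e) * X k e) = \<Lambda> (j (q k))"
        using eigfun_weak[OF bc(3)[OF Tb] U tU, of "q k"] U1[of "q k"]
        by (simp add: energy_def X_def pert_cond_def \<tau>_def)
      then show ?thesis using le[of "j (q k)"] by (simp add: \<tau>_def mult.commute)
    qed
    moreover have "(\<Sum>e\<in>arcs G. a e * X k e * (A (\<tau> k) * exp (\<tau> k * \<gamma> e) - A 0)) =
       A (\<tau> k) * (\<Sum>e\<in>arcs G. a e * exp (\<tau> k * \<gamma> e) * X k e) - A 0 * (\<Sum>e\<in>arcs G. a e * X k e)"
      by (simp add: sum_distrib_left sum_subtractf[symmetric] algebra_simps)
    ultimately have "(\<Sum>e\<in>arcs G. a e * X k e * (A (\<tau> k) * exp (\<tau> k * \<gamma> e) - A 0)) \<le>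
       R (j (q k)) + A 0 * \<mu> * (\<tau> k * P k + (\<tau> k * S k)\<^sup>2 / M)"
      by (simp add: algebra_simps)
    then have "(\<Sum>e\<in>arcs G. a e * X k e * (A (\<tau> k) * exp (\<tau> k * \<gamma> e) - A 0)) / \<tau> k \<le>
       (R (j (q k)) + A 0 * \<mu> * (\<tau> k * P k + (\<tau> k * S k)\<^sup>2 / M)) / \<tau> k"
      using \<tau>(2)[of k] by (intro divide_right_mono) auto
    moreover have "(\<tau> k * P k + (\<tau> k * S k)\<^sup>2 / M) / \<tau> k = P k + \<tau> k * (S k)\<^sup>2 / M"
      using \<tau>(2)[of k] by (simp add: add_divide_distrib power2_eq_square)
    then have "(R (j (q k)) + A 0 * \<mu> * (\<tau> k * P k + (\<tau> k * S k)\<^sup>2 / M)) / \<tau> k =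
        R (j (q k)) / \<tau> k + A 0 * \<mu> * (P k + \<tau> k * (S k)\<^sup>2 / M)"
      by (metis add_divide_distrib times_divide_eq_right)
    ultimately show ?thesis by (simp add: sum_divide_distrib)
  qed
  have dq: "(\<lambda>k. (A (\<tau> k) * exp (\<tau> k * \<gamma> e) - A 0) / \<tau> k) \<longlonglongrightarrow> A' + A 0 * \<gamma> e" for e
  proof -
    have "((\<lambda>t. A t * exp (t * \<gamma> e)) has_real_derivative A' + A 0 * \<gamma> e) (at 0)"
      by (rule derivative_eq_intros A refl | simp)+
    then have "((\<lambda>t. (A t * exp (t * \<gamma> e) - A 0) / t) \<longlongrightarrow> A' + A 0 * \<gamma> e) (at 0)"
      by (simp add: has_field_derivative_iff)
    moreover have "filterlim \<tau> (at 0) sequentially"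
      using \<tau> by (intro filterlim_atI) (auto simp: less_imp_neq[symmetric])
    ultimately show ?thesis by (rule filterlim_compose)
  qed
  have "(\<Sum>e\<in>arcs G. a e * Z e * (A' + A 0 * \<gamma> e)) \<le> 0 + A 0 * \<mu> * (mass \<eta> u u + 0 * (mass \<eta> u ?o)\<^sup>2 / M)"
  proof (rule LIMSEQ_le)
    show "(\<lambda>k. \<Sum>e\<in>arcs G. a e * X k e * ((A (\<tau> k) * exp (\<tau> k * \<gamma> e) - A 0) / \<tau> k)) \<longlonglongrightarrow>
        (\<Sum>e\<in>arcs G. a e * Z e * (A' + A 0 * \<gamma> e))"
      unfolding X_def Z_def by (intro tendsto_sum tendsto_mult tendsto_const Xl dq)
    show "(\<lambda>k. R (j (q k)) / \<tau> k + A 0 * \<mu> * (P k + \<tau> k * (S k)\<^sup>2 / M)) \<longlonglongrightarrow>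
        0 + A 0 * \<mu> * (mass \<eta> u u + 0 * (mass \<eta> u ?o)\<^sup>2 / M)"
      using M by (intro tendsto_intros Rl Pl Sl \<tau>) auto
  qed (use main in auto)
  moreover have "(\<Sum>e\<in>arcs G. a e * Z e * (A' + A 0 * \<gamma> e)) =
      A' * energy a u' u' + A 0 * energy (\<lambda>e. a e * \<gamma> e) u' u'"
    by (simp add: energy_def Z_def sum_distrib_left sum.distrib[symmetric] algebra_simps)
  ultimately have "variation a \<mu> (A 0) A' \<gamma> \<eta> u u' \<le> 0"
    unfolding variation_def eu \<mu>' by simp
  then show thesis using u u1 unfolding \<mu>' by (intro that[of u u'])
qed

text \<open>The upper bound \<open>U\<close> dominates \<open>\<Lambda> t * A t\<close>, hence also
  its own value \<open>U 0 = \<mu> * A 0\<close>. So the differentiable function \<open>U\<close>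
  has a local minimum at \<open>0\<close>.\<close>

lemma variation_zero_of_minimum:
  assumes wt: "weights a w" and \<eta>: "edge_cont \<eta>" and f: "eigfun a w \<mu> f f'" "mass w f f = 1" and \<mu>: "\<mu> > 0"
    and A: "(A has_real_derivative A') (at 0)" "A 0 > 0" and b: "0 < b"
    and \<Lambda>: "\<And>t. \<bar>t\<bar> < b \<Longrightarrow> first_eig (pert_cond a \<gamma> t) (pert_mass w \<eta> t) (\<Lambda> t)"
    and min: "\<And>t. \<bar>t\<bar> < b \<Longrightarrow> \<mu> * A 0 \<le> \<Lambda> t * A t"
  shows "variation a \<mu> (A 0) A' \<gamma> \<eta> f f' = 0"
proof -
  obtain U where U: "(U has_real_derivative variation a \<mu> (A 0) A' \<gamma> \<eta> f f') (at 0)" "U 0 = \<mu> * A 0"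
    "\<forall>\<^sub>F t in nhds 0. \<Lambda> t * A t \<le> U t"
    by (rule variation_upper[OF wt \<eta> f \<mu> A b \<Lambda>])
  then obtain d where d: "d > 0" "\<And>t. \<bar>t\<bar> < d \<Longrightarrow> \<Lambda> t * A t \<le> U t"
    by (auto simp: eventually_nhds_metric)
  show ?thesis
  proof (rule DERIV_local_min[OF U(1)])
    show "0 < min b d" using b d by simp
    show "\<forall>y. \<bar>0 - y\<bar> < min b d \<longrightarrow> U 0 \<le> U y"
      using min d(2) U(2) by (auto intro: order_trans)
  qed
qed

text \<open>If the variation is positive on all normalised eigenfunctions, the product grows at a
  positive rate to the right of \<open>0\<close> by \<open>variation_lower\<close> and drops at one
  to the left by \<open>variation_upper\<close>. The first needs every eigenfunction, the second
  only one.\<close>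

lemma not_extremal_of_definite:
  assumes wt: "weights a w" and \<eta>: "edge_cont \<eta>" and first: "first_eig a w \<mu>"
    and A: "(A has_real_derivative A') (at 0)" "A 0 > 0" and b: "0 < b"
    and \<Lambda>: "\<And>t. \<bar>t\<bar> < b \<Longrightarrow> first_eig (pert_cond a \<gamma> t) (pert_mass w \<eta> t) (\<Lambda> t)"
    and def: "\<And>f f'. eigfun a w \<mu> f f' \<Longrightarrow> mass w f f = 1 \<Longrightarrow> 0 < variation a \<mu> (A 0) A' \<gamma> \<eta> f f'"
    and r: "r \<in> o[at 0](\<lambda>t. t)"
  shows "\<not> (\<forall>\<^sub>F t in at 0. \<Lambda> t * A t \<le> \<mu> * A 0 + r t)"
    and "\<not> (\<forall>\<^sub>F t in at 0. \<Lambda> t * A t \<ge> \<mu> * A 0 + r t)"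
proof -
  have \<mu>: "\<mu> > 0" using first by (simp add: first_eig_def)
  have r0: "((\<lambda>t. r t / t) \<longlongrightarrow> 0) (at 0)" using r by (rule smalloD_tendsto)
  show "\<not> (\<forall>\<^sub>F t in at 0. \<Lambda> t * A t \<le> \<mu> * A 0 + r t)"
  proof
    assume "\<forall>\<^sub>F t in at 0. \<Lambda> t * A t \<le> \<mu> * A 0 + r t"
    then obtain d where d: "d > 0" "\<And>t. t \<noteq> 0 \<Longrightarrow> \<bar>t\<bar> < d \<Longrightarrow> \<Lambda> t * A t \<le> \<mu> * A 0 + r t"
      by (auto simp: eventually_at)
    define m where "m = min b d"
    have m: "m > 0" "m \<le> b" "m \<le> d" using b d(1) by (auto simp: m_def)
    \<comment> \<open>The offset \<open>k + 2\<close> keeps \<open>T k\<close> strictly below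
      \<open>m\<close> already for \<open>k = 0\<close>.\<close>
    define T where "T k = m / real (k + 2)" for k
    have T: "T k > 0" "\<bar>T k\<bar> < b" "\<bar>T k\<bar> < d" for k
    proof -
      have "m * 1 < m * real (k + 2)" using m(1) by (intro mult_strict_left_mono) auto
      then have "T k < m" unfolding T_def using m(1) by (simp add: divide_less_eq)
      moreover show "T k > 0" using m(1) by (simp add: T_def)
      ultimately show "\<bar>T k\<bar> < b" "\<bar>T k\<bar> < d" using m by auto
    qed
    have "(\<lambda>k. m * inverse (real (Suc (k + 1)))) \<longlonglongrightarrow> m * 0"
      by (intro tendsto_intros LIMSEQ_ignore_initial_segment[OF LIMSEQ_inverse_real_of_nat, of 1])
    then have Tl: "T \<longlonglongrightarrow> 0" by (simp add: T_def[abs_def] divide_inverse)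
    have "filterlim T (at 0) sequentially"
      using Tl T(1) by (intro filterlim_atI) (auto simp: less_imp_neq[symmetric])
    then have rT: "(\<lambda>k. r (T k) / T k) \<longlonglongrightarrow> 0" by (rule filterlim_compose[OF r0])
    have le: "\<Lambda> (T k) * A (T k) \<le> \<mu> * A 0 + r (T k)" for k
      using T[of k] by (intro d(2)) auto
    obtain f f' where "eigfun a w \<mu> f f'" "mass w f f = 1" "variation a \<mu> (A 0) A' \<gamma> \<eta> f f' \<le> 0"
      by (rule variation_lower[OF wt \<eta> first A Tl T(1) \<Lambda>[OF T(2)] rT le])
    with def show False by fastforce
  qed
  show "\<not> (\<forall>\<^sub>F t in at 0. \<Lambda> t * A t \<ge> \<mu> * A 0 + r t)"
  proof
    assume ge: "\<forall>\<^sub>F t in at 0. \<Lambda> t * A t \<ge> \<mu> * A 0 + r t"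
    obtain f f' where f: "eigfun a w \<mu> f f'" "mass w f f = 1" using first by (auto simp: first_eig_def)
    obtain U where U: "(U has_real_derivative variation a \<mu> (A 0) A' \<gamma> \<eta> f f') (at 0)" "U 0 = \<mu> * A 0"
      "\<forall>\<^sub>F t in nhds 0. \<Lambda> t * A t \<le> U t"
      by (rule variation_upper[OF wt \<eta> f \<mu> A b \<Lambda>])
    \<comment> \<open>The limit is taken from the left: dividing \<open>r t \<le> U t - U 0\<close>
      by a negative \<open>t\<close> reverses it, so the derivative of \<open>U\<close> is at most
      \<open>0\<close>.\<close>
    have dq: "((\<lambda>t. (U t - U 0) / t) \<longlongrightarrow> variation a \<mu> (A 0) A' \<gamma> \<eta> f f') (at_left 0)"
      using U(1) unfolding has_field_derivative_iff by (simp add: tendsto_mono[OF at_le[of "{..<0}" UNIV]])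
    have r1: "((\<lambda>t. r t / t) \<longlongrightarrow> 0) (at_left 0)" using r0 by (rule tendsto_mono[OF at_le, rotated]) simp
    have "\<forall>\<^sub>F t in at_left 0. (U t - U 0) / t \<le> r t / t"
    proof -
      have "\<forall>\<^sub>F t in at_left 0. \<Lambda> t * A t \<ge> \<mu> * A 0 + r t"
        using ge by (rule filter_leD[OF at_le, rotated]) simp
      moreover have "\<forall>\<^sub>F t in at_left 0. \<Lambda> t * A t \<le> U t"
        using U(3) by (simp add: eventually_at_filter eventually_mono)
      moreover have "\<forall>\<^sub>F t in at_left (0::real). t < 0" by (simp add: eventually_at_filter)
      ultimately show ?thesis
      proof eventually_elim
        case (elim t)
        then have "r t \<le> U t - U 0" using U(2) by linarith
        then show ?case using elim by (intro divide_right_mono_neg) auto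
      qed
    qed
    then have "variation a \<mu> (A 0) A' \<gamma> \<eta> f f' \<le> 0"
      by (rule tendsto_le[OF _ r1 dq, rotated]) simp
    with def[OF f] show False by simp
  qed
qed

end

subsection \<open>Definite directions\<close>

lemma uniform_limit_sum_finite:
  fixes f :: "nat \<Rightarrow> 'i \<Rightarrow> real \<Rightarrow> real"
  assumes "\<And>i. i \<in> I \<Longrightarrow> uniform_limit S (\<lambda>n. f n i) (g i) sequentially"
  shows "uniform_limit S (\<lambda>n x. \<Sum>i\<in>I. f n i x) (\<lambda>x. \<Sum>i\<in>I. g i x) sequentially"
  using assms
  by (induction I rule: infinite_finite_induct) (auto intro!: uniform_limit_const uniform_limit_add)

context quantum_graph
begin

text \<open>One subsequence for all entries of a tuple, by refining it entry by entry.\<close>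

lemma eigfun_tuple_compactness:
  fixes U :: "nat \<Rightarrow> nat \<Rightarrow> 'e \<Rightarrow> real \<Rightarrow> real"
  assumes wt: "weights a w"
    and U: "\<And>k i. i < d \<Longrightarrow> eigfun a w \<mu> (U k i) (U' k i)"
    and K: "\<And>k i. i < d \<Longrightarrow> mass w (U k i) (U k i) \<le> K"
  shows "\<exists>r u u'. strict_mono (r :: nat \<Rightarrow> nat) \<and> (\<forall>i<d. eigfun a w \<mu> (u i) (u' i)) \<and>
    (\<forall>i<d. \<forall>e\<in>arcs G. uniform_limit {0..1} (\<lambda>k. U (r k) i e) (u i e) sequentially) \<and>
    (\<forall>i<d. \<forall>e\<in>arcs G. (\<lambda>k. integral {0..1} (\<lambda>x. U' (r k) i e x * U' (r k) i e x)) \<longlonglongrightarrow>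
        integral {0..1} (\<lambda>x. u' i e x * u' i e x))"
  using U K
proof (induction d)
  case 0
  show ?case by (rule exI[of _ id]) (auto simp: strict_mono_def)
next
  case (Suc d)
  have "\<exists>r u u'. strict_mono (r :: nat \<Rightarrow> nat) \<and> (\<forall>i<d. eigfun a w \<mu> (u i) (u' i)) \<and>
    (\<forall>i<d. \<forall>e\<in>arcs G. uniform_limit {0..1} (\<lambda>k. U (r k) i e) (u i e) sequentially) \<and>
    (\<forall>i<d. \<forall>e\<in>arcs G. (\<lambda>k. integral {0..1} (\<lambda>x. U' (r k) i e x * U' (r k) i e x)) \<longlonglongrightarrow>
        integral {0..1} (\<lambda>x. u' i e x * u' i e x))"
    by (rule Suc.IH) (use Suc.prems in auto)
  then obtain r u u' where r: "strict_mono (r :: nat \<Rightarrow> nat)" and u: "\<forall>i<d. eigfun a w \<mu> (u i) (u' i)"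
    and ul: "\<And>i e. i < d \<Longrightarrow> e \<in> arcs G \<Longrightarrow> uniform_limit {0..1} (\<lambda>k. U (r k) i e) (u i e) sequentially"
    and ue: "\<And>i e. i < d \<Longrightarrow> e \<in> arcs G \<Longrightarrow> (\<lambda>k. integral {0..1} (\<lambda>x. U' (r k) i e x * U' (r k) i e x)) \<longlonglongrightarrow>
        integral {0..1} (\<lambda>x. u' i e x * u' i e x)" by blast
  obtain c where c: "0 < c" "\<And>e. e \<in> arcs G \<Longrightarrow> c \<le> a e"
    "\<And>e x. e \<in> arcs G \<Longrightarrow> x \<in> {0..1} \<Longrightarrow> c \<le> w e x"
    using weights_lower_bound[OF wt] by blast
  have Ud: "eigfun a w \<mu> (U (r k) d) (U' (r k) d)" "mass w (U (r k) d) (U (r k) d) \<le> K" for k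
    using Suc.prems by auto
  obtain s v v' where s: "strict_mono (s :: nat \<Rightarrow> nat)" and v: "eigfun a w \<mu> v v'"
    and vl: "\<And>e. e \<in> arcs G \<Longrightarrow> uniform_limit {0..1} (\<lambda>k. U (r (s k)) d e) (v e) sequentially"
    and ve: "\<And>e. e \<in> arcs G \<Longrightarrow> (\<lambda>k. integral {0..1} (\<lambda>x. U' (r (s k)) d e x * U' (r (s k)) d e x)) \<longlonglongrightarrow>
        integral {0..1} (\<lambda>x. v' e x * v' e x)"
    by (rule eigfun_compactness[where U = "\<lambda>k. U (r k) d" and U' = "\<lambda>k. U' (r k) d",
          OF wt wt Ud(1) c Ud(2) tendsto_const uniform_limit_const tendsto_const]) simp_all
  note sub = filterlim_subseq[OF s]
  show ?case
  proof (intro exI conjI allI impI ballI)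
    show "strict_mono (r \<circ> s)" by (rule strict_mono_o[OF r s])
    fix i assume i: "i < Suc d"
    show "eigfun a w \<mu> ((u(d := v)) i) ((u'(d := v')) i)" using u v i by (auto simp: less_Suc_eq)
    fix e assume e: "e \<in> arcs G"
    show "uniform_limit {0..1} (\<lambda>k. U ((r \<circ> s) k) i e) ((u(d := v)) i e) sequentially"
      using filterlim_compose[OF ul[OF _ e] sub] vl[OF e] i by (auto simp: less_Suc_eq)
    show "(\<lambda>k. integral {0..1} (\<lambda>x. U' ((r \<circ> s) k) i e x * U' ((r \<circ> s) k) i e x)) \<longlonglongrightarrow>
        integral {0..1} (\<lambda>x. (u'(d := v')) i e x * (u'(d := v')) i e x)"
      using filterlim_compose[OF ue[OF _ e] sub] ve[OF e] i by (auto simp: less_Suc_eq)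
  qed
qed

text \<open>The first variation is linear in the direction and quadratic in the eigenfunction; \<open>Xq\<close> is
  its coefficient for the metric and \<open>Yq\<close> for the density, up to positive factors.\<close>

definition Xq ::
  "('e \<Rightarrow> real) \<Rightarrow> ('e \<Rightarrow> real \<Rightarrow> real) \<Rightarrow> ('e \<Rightarrow> real) \<Rightarrow> ('e \<Rightarrow> real \<Rightarrow> real) \<Rightarrow> ('e \<Rightarrow> real \<Rightarrow> real) \<Rightarrow> 'e \<Rightarrow> real" where
  "Xq a w \<kappa> f f' e = a e * integral {0..1} (\<lambda>x. f' e x * f' e x) + \<kappa> e * mass w f f"

definition Yq ::
  "('e \<Rightarrow> real \<Rightarrow> real) \<Rightarrow> ('e \<Rightarrow> real) \<Rightarrow> ('e \<Rightarrow> real) \<Rightarrow> ('e \<Rightarrow> real \<Rightarrow> real) \<Rightarrow> 'e \<Rightarrow> real \<Rightarrow> real" where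
  "Yq w \<beta> \<sigma> f e x = \<beta> e * mass w f f - \<sigma> e * (f e x)\<^sup>2"

text \<open>An inner product on pairs of metric and density directions. The factor
  \<open>\<mu>\<close> is the one with which the density enters the first variation, see
  \<open>variation_eq_pairing\<close>.\<close>

definition pairing ::
  "real \<Rightarrow> ('e \<Rightarrow> real) \<Rightarrow> ('e \<Rightarrow> real \<Rightarrow> real) \<Rightarrow> ('e \<Rightarrow> real) \<Rightarrow> ('e \<Rightarrow> real \<Rightarrow> real) \<Rightarrow> real" where
  "pairing \<mu> X Y X1 Y1 = (\<Sum>e\<in>arcs G. X e * X1 e) + \<mu> * (\<Sum>e\<in>arcs G. integral {0..1} (\<lambda>x. Y e x * Y1 e x))"

lemma pairing_commute: "pairing \<mu> X Y X1 Y1 = pairing \<mu> X1 Y1 X Y"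
  by (simp add: pairing_def mult.commute)

lemma pairing_lin:
  assumes "edge_cont Y" "edge_cont Z" "edge_cont V"
  shows "pairing \<mu> (\<lambda>e. c * X e + d * W e) (\<lambda>e x. c * Y e x + d * Z e x) Q V =
    c * pairing \<mu> X Y Q V + d * pairing \<mu> W Z Q V"
proof -
  have "integral {0..1} (\<lambda>x. (c * Y e x + d * Z e x) * V e x) =
      c * integral {0..1} (\<lambda>x. Y e x * V e x) + d * integral {0..1} (\<lambda>x. Z e x * V e x)" if "e \<in> arcs G" for e
    using assms that
    by (subst integral01_lin[symmetric]) (auto intro!: continuous_intros simp: algebra_simps)
  then show ?thesis
    by (simp add: pairing_def sum_distrib_left sum.distrib algebra_simps)
qed

lemma pairing_convex:
  assumes "edge_cont Y" "edge_cont Z"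
  shows "pairing \<mu> (\<lambda>e. c * X e + d * W e) (\<lambda>e x. c * Y e x + d * Z e x)
      (\<lambda>e. c * X e + d * W e) (\<lambda>e x. c * Y e x + d * Z e x) =
    c\<^sup>2 * pairing \<mu> X Y X Y + 2 * c * d * pairing \<mu> X Y W Z + d\<^sup>2 * pairing \<mu> W Z W Z"
proof -
  let ?X = "\<lambda>e. c * X e + d * W e" and ?Y = "\<lambda>e x. c * Y e x + d * Z e x"
  have 0: "edge_cont ?Y" using assms by (auto intro!: continuous_intros)
  have "pairing \<mu> ?X ?Y ?X ?Y = c * pairing \<mu> X Y ?X ?Y + d * pairing \<mu> W Z ?X ?Y"
    by (rule pairing_lin[OF assms 0])
  also have "pairing \<mu> X Y ?X ?Y = c * pairing \<mu> X Y X Y + d * pairing \<mu> W Z X Y"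
    unfolding pairing_commute[of \<mu> X Y ?X ?Y] by (rule pairing_lin[OF assms assms(1)])
  also have "pairing \<mu> W Z ?X ?Y = c * pairing \<mu> X Y W Z + d * pairing \<mu> W Z W Z"
    unfolding pairing_commute[of \<mu> W Z ?X ?Y] by (rule pairing_lin[OF assms assms(2)])
  also have "pairing \<mu> W Z X Y = pairing \<mu> X Y W Z" by (rule pairing_commute)
  finally show ?thesis by (simp add: power2_eq_square algebra_simps)
qed

lemma pairing_nonneg:
  assumes "0 \<le> \<mu>" "edge_cont Y" shows "0 \<le> pairing \<mu> X Y X Y"
  unfolding pairing_def using assms
  by (intro add_nonneg_nonneg mult_nonneg_nonneg[OF assms(1)] sum_nonneg integral01_nonneg)
    (auto intro!: continuous_intros)

lemma pairing_eq_0D: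
  assumes \<mu>: "0 < \<mu>" and Y: "edge_cont Y" and 0: "pairing \<mu> X Y X Y = 0" and e: "e \<in> arcs G"
  shows "X e = 0" "x \<in> {0..1} \<Longrightarrow> Y e x = 0"
proof -
  have nn: "0 \<le> integral {0..1} (\<lambda>x. Y e x * Y e x)" if "e \<in> arcs G" for e
    using Y that by (intro integral01_nonneg) (auto intro!: continuous_intros)
  have s1: "0 \<le> (\<Sum>e\<in>arcs G. X e * X e)" by (intro sum_nonneg) auto
  have s2: "0 \<le> (\<Sum>e\<in>arcs G. integral {0..1} (\<lambda>x. Y e x * Y e x))" using nn by (intro sum_nonneg) auto
  have m: "0 \<le> \<mu> * (\<Sum>e\<in>arcs G. integral {0..1} (\<lambda>x. Y e x * Y e x))" using s2 \<mu> by simp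
  have z1: "(\<Sum>e\<in>arcs G. X e * X e) = 0" using 0 s1 m unfolding pairing_def by linarith
  then have "\<mu> * (\<Sum>e\<in>arcs G. integral {0..1} (\<lambda>x. Y e x * Y e x)) = 0" using 0 by (simp add: pairing_def)
  then have z2: "(\<Sum>e\<in>arcs G. integral {0..1} (\<lambda>x. Y e x * Y e x)) = 0" using \<mu> by simp
  have "X e * X e = 0" using z1 e by (subst (asm) sum_nonneg_eq_0_iff) auto
  then show "X e = 0" by simp
  have "integral {0..1} (\<lambda>x. Y e x * Y e x) = 0" using z2 e nn by (subst (asm) sum_nonneg_eq_0_iff) auto
  then show "Y e x = 0" if "x \<in> {0..1}" using Y e that
    by (subst (asm) integral01_eq_0_iff) (auto intro!: continuous_intros)
qed

lemma Yq_cont: "edge_cont f \<Longrightarrow> edge_cont (Yq w \<beta> \<sigma> f)"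
  unfolding Yq_def[abs_def] by (auto intro!: continuous_intros)

lemma integral_sum_squares:
  fixes f :: "nat \<Rightarrow> real \<Rightarrow> real"
  assumes "\<And>i. i < d \<Longrightarrow> continuous_on {0..1} (f i)"
  shows "(\<Sum>i<d. integral {0..1} (\<lambda>x. f i x * f i x)) = integral {0..1} (\<lambda>x. \<Sum>i<d. (f i x)\<^sup>2)"
  using integral01_sum[of "{..<d}" "\<lambda>i x. f i x * f i x" "\<lambda>_. 1"] assms
  by (simp add: power2_eq_square continuous_on_mult)

lemma mass_sum_squares:
  assumes "edge_cont w" "\<And>i. i < (d::nat) \<Longrightarrow> edge_cont (f i)"
  shows "(\<Sum>i<d. mass w (f i) (f i)) = (\<Sum>e\<in>arcs G. integral {0..1} (\<lambda>x. w e x * (\<Sum>i<d. (f i e x)\<^sup>2)))"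
proof -
  have "(\<Sum>i<d. integral {0..1} (\<lambda>x. w e x * (f i e x * f i e x))) =
      integral {0..1} (\<lambda>x. w e x * (\<Sum>i<d. (f i e x)\<^sup>2))" if "e \<in> arcs G" for e
    using integral01_sum[of "{..<d}" "\<lambda>i x. w e x * (f i e x * f i e x)" "\<lambda>_. 1"] assms that
    by (simp add: power2_eq_square continuous_on_mult sum_distrib_left)
  then show ?thesis unfolding mass_def by (subst sum.swap) simp
qed

text \<open>Either some direction makes the first variation positive on the whole eigenspace, or the origin
  lies in the convex hull of the values of the vector-valued quadratic form \<open>(Xq, Yq)\<close>. The direction
  is the point of the convex hull that is closest to the origin.\<close>

lemma definite_direction_or_tuple:
  assumes wt: "weights a w" and \<mu>: "0 < \<mu>" and ex: "eigfun a w \<mu> u0 u0'" "mass w u0 u0 = 1"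
  defines "d \<equiv> 2 * card (arcs G)"
  obtains (direction) X Y c where "edge_cont Y" "0 < c"
      "\<And>f f'. eigfun a w \<mu> f f' \<Longrightarrow> mass w f f = 1 \<Longrightarrow>
        c \<le> pairing \<mu> X Y (Xq a w \<kappa> f f') (Yq w \<beta> \<sigma> f)"
  | (tuple) u u' where "\<And>i. i < d \<Longrightarrow> eigfun a w \<mu> (u i) (u' i)" "(\<Sum>i<d. mass w (u i) (u i)) = 1"
      "\<And>e. e \<in> arcs G \<Longrightarrow> (\<Sum>i<d. Xq a w \<kappa> (u i) (u' i) e) = 0"
      "\<And>e x. e \<in> arcs G \<Longrightarrow> x \<in> {0..1} \<Longrightarrow> (\<Sum>i<d. Yq w \<beta> \<sigma> (u i) e x) = 0"
proof -
  have wc: "edge_cont w" by (rule weights_cont[OF wt])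
  \<comment> \<open>A tuple of total mass \<open>1\<close> stands for a point of the convex hull:
    its entries, rescaled to mass \<open>1\<close>, are weighted by their masses. \<open>TX\<close>
    and \<open>TY\<close> are the coordinates of the point, and \<open>J\<close> is its squared
    distance from the origin.\<close>
  define TX where "TX u u' e = (\<Sum>i<d. Xq a w \<kappa> (u i) (u' i) e)" for u u' e
  define TY where "TY u e x = (\<Sum>i<d. Yq w \<beta> \<sigma> (u i) e x)" for u e x
  define J where "J u u' = pairing \<mu> (TX u u') (TY u) (TX u u') (TY u)" for u u'
  define T where "T = {(u, u'). (\<forall>i<d. eigfun a w \<mu> (u i) (u' i)) \<and> (\<Sum>i<d. mass w (u i) (u i)) = 1}"
  have Tc: "edge_cont (u i)" "edge_cont (u' i)" if "(u, u') \<in> T" "i < d" for u u' i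
    using that test_fun_cont[OF eigfun_test] test_fun_cont_deriv[OF eigfun_test] unfolding T_def by blast+
  have TYc: "edge_cont (TY u)" if "(u, u') \<in> T" for u u'
    unfolding TY_def[abs_def] using Yq_cont[OF Tc(1)[OF that]] by (auto intro!: continuous_intros)
  have J0: "0 \<le> J u u'" if "(u, u') \<in> T" for u u'
    unfolding J_def by (rule pairing_nonneg) (use \<mu> TYc[OF that] in auto)
  have dpos: "0 < d" using arcs_nonempty by (simp add: d_def card_gt_0_iff)
  have mass_zero: "mass w (\<lambda>e x. 0) (\<lambda>e x. 0) = 0" by (simp add: mass_def)
  have zero: "eigfun a w \<mu> (\<lambda>e x. 0) (\<lambda>e x. 0)"
    using eigfun_scale_add[OF ex(1) ex(1), of 0 0] by simp
  have "(\<lambda>i. if i = 0 then u0 else (\<lambda>e x. 0), \<lambda>i. if i = 0 then u0' else (\<lambda>e x. 0)) \<in> T"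
  proof -
    have "(\<Sum>i<d. mass w (if i = 0 then u0 else (\<lambda>e x. 0)) (if i = 0 then u0 else (\<lambda>e x. 0))) =
        (\<Sum>i<d. if i = 0 then 1 else 0)"
      using ex(2) mass_zero by (intro sum.cong) auto
    then show ?thesis using ex zero dpos by (auto simp: T_def sum.delta)
  qed
  then have ne: "T \<noteq> {}" by blast
  define m where "m = Inf ((\<lambda>(u, u'). J u u') ` T)"
  have bdd: "bdd_below ((\<lambda>(u, u'). J u u') ` T)"
    using J0 by (auto simp: bdd_below_def intro!: exI[of _ 0])
  have mle: "m \<le> J u u'" if "(u, u') \<in> T" for u u'
    unfolding m_def using that bdd by (intro cInf_lower) force+
  have "\<exists>p\<in>T. (\<lambda>(u, u'). J u u') p < m + inverse (real (Suc k))" for k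
  proof -
    have "m < m + inverse (real (Suc k))" by simp
    then show ?thesis unfolding m_def using ne
      by (subst (asm) cInf_less_iff) (use bdd in \<open>auto simp: m_def\<close>)
  qed
  then obtain p where p: "\<And>k. p k \<in> T" "\<And>k. (\<lambda>(u, u'). J u u') (p k) < m + inverse (real (Suc k))" by metis
  define U where "U k = fst (p k)" for k
  define U' where "U' k = snd (p k)" for k
  have UT: "(U k, U' k) \<in> T" "J (U k) (U' k) < m + inverse (real (Suc k))" for k
    using p[of k] by (auto simp: U_def U'_def split: prod.splits)
  have Ue: "eigfun a w \<mu> (U k i) (U' k i)" if "i < d" for k i using UT(1) that by (auto simp: T_def)
  have Um: "mass w (U k i) (U k i) \<le> 1" if i: "i < d" for k i
  proof -
    have "mass w (U k i) (U k i) \<le> (\<Sum>i<d. mass w (U k i) (U k i))"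
      by (rule member_le_sum) (use i mass_nonneg[OF wt Tc(1)[OF UT(1)]] in auto)
    then show ?thesis using UT(1)[of k] by (simp add: T_def)
  qed
  obtain r u u' where r: "strict_mono (r :: nat \<Rightarrow> nat)" and u: "\<And>i. i < d \<Longrightarrow> eigfun a w \<mu> (u i) (u' i)"
    and ul: "\<And>i e. i < d \<Longrightarrow> e \<in> arcs G \<Longrightarrow> uniform_limit {0..1} (\<lambda>k. U (r k) i e) (u i e) sequentially"
    and ue: "\<And>i e. i < d \<Longrightarrow> e \<in> arcs G \<Longrightarrow> (\<lambda>k. integral {0..1} (\<lambda>x. U' (r k) i e x * U' (r k) i e x)) \<longlonglongrightarrow>
        integral {0..1} (\<lambda>x. u' i e x * u' i e x)"
    using eigfun_tuple_compactness[OF wt, of d \<mu> U U' 1, OF Ue Um] by blast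
  have uc: "edge_cont (u i)" if "i < d" for i by (rule test_fun_cont[OF eigfun_test[OF u[OF that]]])
  have ml: "(\<lambda>k. mass w (U (r k) i) (U (r k) i)) \<longlonglongrightarrow> mass w (u i) (u i)" if i: "i < d" for i
    by (rule mass_limit[OF uniform_limit_const ul[OF i] ul[OF i]]) (use wc uc Tc(1)[OF UT(1)] i in auto)
  have "(\<lambda>k. \<Sum>i<d. mass w (U (r k) i) (U (r k) i)) \<longlonglongrightarrow> (\<Sum>i<d. mass w (u i) (u i))"
    by (intro tendsto_sum ml) auto
  moreover have "(\<Sum>i<d. mass w (U (r k) i) (U (r k) i)) = 1" for k using UT(1)[of "r k"] by (auto simp: T_def)
  ultimately have u1: "(\<Sum>i<d. mass w (u i) (u i)) = 1" by (simp add: LIMSEQ_const_iff)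
  have uT: "(u, u') \<in> T" using u u1 by (auto simp: T_def)
  have TXl: "(\<lambda>k. TX (U (r k)) (U' (r k)) e) \<longlonglongrightarrow> TX u u' e" if e: "e \<in> arcs G" for e
    unfolding TX_def Xq_def by (intro tendsto_intros ue ml e) auto
  have TYl: "uniform_limit {0..1} (\<lambda>k. TY (U (r k)) e) (TY u e) sequentially" if e: "e \<in> arcs G" for e
  proof -
    have "uniform_limit {0..1} (\<lambda>k. Yq w \<beta> \<sigma> (U (r k) i) e) (Yq w \<beta> \<sigma> (u i) e) sequentially" if i: "i < d" for i
    proof -
      have 1: "uniform_limit {0..1} (\<lambda>k (x::real). mass w (U (r k) i) (U (r k) i)) (\<lambda>x. mass w (u i) (u i)) sequentially"
        using ml[OF i] by (auto simp: uniform_limit_iff tendsto_iff)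
      have 2: "uniform_limit {0..1} (\<lambda>k x. U (r k) i e x * U (r k) i e x) (\<lambda>x. u i e x * u i e x) sequentially"
        by (intro uniform_limit_mult01 ul i e) (use uc[OF i] e in auto)
      have "uniform_limit {0..1} (\<lambda>k x. \<beta> e *\<^sub>R mass w (U (r k) i) (U (r k) i) - \<sigma> e *\<^sub>R (U (r k) i e x * U (r k) i e x))
          (\<lambda>x. \<beta> e *\<^sub>R mass w (u i) (u i) - \<sigma> e *\<^sub>R (u i e x * u i e x)) sequentially"
        by (intro uniform_limit_minus bounded_linear_uniform_limit_intros 1 2)
      then show ?thesis by (simp add: Yq_def[abs_def] power2_eq_square)
    qed
    then show ?thesis unfolding TY_def[abs_def]
      by (intro uniform_limit_sum_finite) auto
  qed
  have "(\<lambda>k. J (U (r k)) (U' (r k))) \<longlonglongrightarrow> J u u'"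
    unfolding J_def pairing_def
    by (intro tendsto_intros TXl integral01_uniform_limit uniform_limit_mult01 TYl)
      (use TYc[OF uT] TYc[OF UT(1)] in \<open>auto intro!: continuous_intros\<close>)
  moreover have "(\<lambda>k. m + inverse (real (Suc (r k)))) \<longlonglongrightarrow> m + 0"
    by (intro tendsto_intros filterlim_compose[OF LIMSEQ_inverse_real_of_nat filterlim_subseq[OF r]])
  ultimately have "J u u' \<le> m + 0"
    by (rule LIMSEQ_le) (use UT(2) in \<open>auto intro: less_imp_le\<close>)
  with mle[OF uT] have Jm: "J u u' = m" by simp
  have uc': "edge_cont (u' i)" if "i < d" for i by (rule test_fun_cont_deriv[OF eigfun_test[OF u[OF that]]])
  show thesis
  proof (cases "m = 0")
    case True
    then have P0: "pairing \<mu> (TX u u') (TY u) (TX u u') (TY u) = 0" using Jm by (simp add: J_def)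
    show thesis
      using pairing_eq_0D[OF \<mu> TYc[OF uT] P0] u u1 by (intro tuple[of u u']) (auto simp: TX_def TY_def)
  next
    case False
    with J0[OF uT] Jm have m: "0 < m" by simp
    \<comment> \<open>For the closest point of a convex set, the inner product with any other point
      is at least the squared distance. So the closest point itself is the direction and
      \<open>m\<close> the constant.\<close>
    have "m \<le> pairing \<mu> (TX u u') (TY u) (Xq a w \<kappa> f f') (Yq w \<beta> \<sigma> f)"
      if f: "eigfun a w \<mu> f f'" "mass w f f = 1" for f f'
    proof -
      have fc: "edge_cont f" "edge_cont f'"
        using test_fun_cont[OF eigfun_test[OF f(1)]] test_fun_cont_deriv[OF eigfun_test[OF f(1)]] by auto
      define B where "B = pairing \<mu> (TX u u') (TY u) (Xq a w \<kappa> f f') (Yq w \<beta> \<sigma> f)"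
      define Q where "Q = pairing \<mu> (Xq a w \<kappa> f f') (Yq w \<beta> \<sigma> f) (Xq a w \<kappa> f f') (Yq w \<beta> \<sigma> f)"
      have quad: "m \<le> (1 - s)\<^sup>2 * m + 2 * (1 - s) * s * B + s\<^sup>2 * Q" if s: "0 < s" "s < 1" for s
      proof -
        \<comment> \<open>Square roots because entries enter squared: these \<open>d + 1\<close>
          eigenfunctions represent the point at parameter \<open>s\<close> on the segment from the
          closest point to that of \<open>f\<close>. Afterwards \<open>eigfun_reduce_squares\<close>
          restores the length \<open>d\<close>.\<close>
        define V where "V i = (\<lambda>e x. if i < d then sqrt (1 - s) * u i e x else sqrt s * f e x)" for i
        define V' where "V' i = (\<lambda>e x. if i < d then sqrt (1 - s) * u' i e x else sqrt s * f' e x)" for i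
        have "eigfun a w \<mu> (V i) (V' i)" for i
          using eigfun_scale_add[OF u u, of i i "sqrt (1 - s)" 0] eigfun_scale_add[OF f(1) f(1), of "sqrt s" 0]
          by (cases "i < d") (auto simp: V_def V'_def)
        then obtain v v' where v: "\<And>i. i < d \<Longrightarrow> eigfun a w \<mu> (v i) (v' i)"
          and vs: "\<And>e x. e \<in> arcs G \<Longrightarrow> x \<in> {0..1} \<Longrightarrow> (\<Sum>i<d. (v i e x)\<^sup>2) = (\<Sum>i<d. (V i e x)\<^sup>2) + (V d e x)\<^sup>2"
          and vs': "\<And>e x. e \<in> arcs G \<Longrightarrow> x \<in> {0..1} \<Longrightarrow> (\<Sum>i<d. (v' i e x)\<^sup>2) = (\<Sum>i<d. (V' i e x)\<^sup>2) + (V' d e x)\<^sup>2"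
          using eigfun_reduce_squares[OF wt, of d \<mu> V V'] unfolding d_def by blast
        have sq: "(\<Sum>i<d. (v i e x)\<^sup>2) = (1 - s) * (\<Sum>i<d. (u i e x)\<^sup>2) + s * (f e x)\<^sup>2"
          "(\<Sum>i<d. (v' i e x)\<^sup>2) = (1 - s) * (\<Sum>i<d. (u' i e x)\<^sup>2) + s * (f' e x)\<^sup>2"
          if "e \<in> arcs G" "x \<in> {0..1}" for e x
          using vs[OF that] vs'[OF that] s
          by (simp_all add: V_def V'_def power_mult_distrib sum_distrib_left)
        have vc: "edge_cont (v i)" "edge_cont (v' i)" if "i < d" for i
          using test_fun_cont[OF eigfun_test[OF v[OF that]]] test_fun_cont_deriv[OF eigfun_test[OF v[OF that]]] by auto
        have cs: "continuous_on {0..1} (\<lambda>x. \<Sum>i<d. (u i e x)\<^sup>2)" "continuous_on {0..1} (\<lambda>x. \<Sum>i<d. (u' i e x)\<^sup>2)"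
          if "e \<in> arcs G" for e
          using uc uc' that by (auto intro!: continuous_intros)
        have mv: "(\<Sum>i<d. mass w (v i) (v i)) = (1 - s) * (\<Sum>i<d. mass w (u i) (u i)) + s * mass w f f"
        proof -
          have "integral {0..1} (\<lambda>x. w e x * (\<Sum>i<d. (v i e x)\<^sup>2)) =
              (1 - s) * integral {0..1} (\<lambda>x. w e x * (\<Sum>i<d. (u i e x)\<^sup>2)) + s * integral {0..1} (\<lambda>x. w e x * (f e x * f e x))"
            if e: "e \<in> arcs G" for e
          proof -
            have "integral {0..1} (\<lambda>x. w e x * (\<Sum>i<d. (v i e x)\<^sup>2)) =
                integral {0..1} (\<lambda>x. (1 - s) * (w e x * (\<Sum>i<d. (u i e x)\<^sup>2)) + s * (w e x * (f e x * f e x)))"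
              by (rule integral_cong, subst sq(1)[OF e], assumption) (simp add: power2_eq_square algebra_simps)
            also have "\<dots> = (1 - s) * integral {0..1} (\<lambda>x. w e x * (\<Sum>i<d. (u i e x)\<^sup>2)) + s * integral {0..1} (\<lambda>x. w e x * (f e x * f e x))"
              by (intro integral01_lin continuous_on_mult cs[OF e]) (use wc fc e in auto)
            finally show ?thesis .
          qed
          then show ?thesis
            by (simp add: mass_sum_squares[OF wc vc(1)] mass_sum_squares[OF wc uc] mass_def[of w f f]
                sum.distrib sum_distrib_left)
        qed
        then have v1: "(\<Sum>i<d. mass w (v i) (v i)) = 1" by (simp add: u1 f(2))
        then have vT: "(v, v') \<in> T" using v by (auto simp: T_def)
        have X: "TX v v' e = (1 - s) * TX u u' e + s * Xq a w \<kappa> f f' e" if e: "e \<in> arcs G" for e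
        proof -
          have "(\<Sum>i<d. integral {0..1} (\<lambda>x. v' i e x * v' i e x)) = integral {0..1} (\<lambda>x. \<Sum>i<d. (v' i e x)\<^sup>2)"
            using vc e by (intro integral_sum_squares) auto
          also have "\<dots> = integral {0..1} (\<lambda>x. (1 - s) * (\<Sum>i<d. (u' i e x)\<^sup>2) + s * (f' e x * f' e x))"
            by (rule integral_cong, subst sq(2)[OF e], assumption) (simp add: power2_eq_square)
          also have "\<dots> = (1 - s) * integral {0..1} (\<lambda>x. \<Sum>i<d. (u' i e x)\<^sup>2) + s * integral {0..1} (\<lambda>x. f' e x * f' e x)"
            by (intro integral01_lin continuous_on_mult cs[OF e]) (use fc e in auto)
          also have "integral {0..1} (\<lambda>x. \<Sum>i<d. (u' i e x)\<^sup>2) = (\<Sum>i<d. integral {0..1} (\<lambda>x. u' i e x * u' i e x))"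
            using uc' e by (intro integral_sum_squares[symmetric]) auto
          finally have eq: "(\<Sum>i<d. integral {0..1} (\<lambda>x. v' i e x * v' i e x)) =
              (1 - s) * (\<Sum>i<d. integral {0..1} (\<lambda>x. u' i e x * u' i e x)) + s * integral {0..1} (\<lambda>x. f' e x * f' e x)" .
          show ?thesis
            unfolding TX_def Xq_def sum.distrib sum_distrib_left[symmetric] v1 u1 f(2) eq
            by (simp add: algebra_simps)
        qed
        have Y: "TY v e x = (1 - s) * TY u e x + s * Yq w \<beta> \<sigma> f e x" if e: "e \<in> arcs G" and x: "x \<in> {0..1}" for e x
          unfolding TY_def Yq_def sum_subtractf sum_distrib_left[symmetric] v1 u1 f(2) sq[OF e x]
          by (simp add: algebra_simps)
        have "m \<le> J v v'" by (rule mle[OF vT])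
        also have "J v v' = pairing \<mu> (\<lambda>e. (1 - s) * TX u u' e + s * Xq a w \<kappa> f f' e) (\<lambda>e x. (1 - s) * TY u e x + s * Yq w \<beta> \<sigma> f e x)
          (\<lambda>e. (1 - s) * TX u u' e + s * Xq a w \<kappa> f f' e) (\<lambda>e x. (1 - s) * TY u e x + s * Yq w \<beta> \<sigma> f e x)"
          unfolding J_def pairing_def
          by (intro arg_cong2[where f = "(+)"] arg_cong2[where f = "(*)"] sum.cong refl integral_cong) (simp_all add: X Y)
        also have "\<dots> = (1 - s)\<^sup>2 * m + 2 * (1 - s) * s * B + s\<^sup>2 * Q"
          by (subst pairing_convex[OF TYc[OF uT] Yq_cont[OF fc(1)]]) (simp add: Jm[symmetric] J_def B_def Q_def)
        finally show ?thesis .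
      qed
      \<comment> \<open>The terms of order zero in \<open>quad\<close> cancel and one factor
        \<open>s\<close> divides out; the limit \<open>s \<rightarrow> 0\<close> then reads
        \<open>m \<le> B\<close>.\<close>
      have "0 \<le> - 2 * m + s * m + 2 * (1 - s) * B + s * Q" if s: "0 < s" "s < 1" for s
      proof -
        have "0 \<le> s * (- 2 * m + s * m + 2 * (1 - s) * B + s * Q)"
          using quad[OF s] by (simp add: power2_eq_square algebra_simps)
        then show ?thesis using s(1) by (simp add: zero_le_mult_iff)
      qed
      then have "\<forall>\<^sub>F s in at_right 0. 0 \<le> - 2 * m + s * m + 2 * (1 - s) * B + s * Q"
        unfolding eventually_at_right_field by (intro exI[of _ 1]) auto
      moreover have "((\<lambda>s. - 2 * m + s * m + 2 * (1 - s) * B + s * Q) \<longlongrightarrow> - 2 * m + 0 * m + 2 * (1 - 0) * B + 0 * Q) (at_right 0)"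
        by (intro tendsto_intros)
      ultimately have "0 \<le> - 2 * m + 0 * m + 2 * (1 - 0) * B + 0 * Q"
        by (intro tendsto_lowerbound) auto
      then show ?thesis by (simp add: B_def)
    qed
    then show thesis by (rule direction[OF TYc[OF uT] m])
  qed
qed

end

subsection \<open>Variations of metric and density\<close>

lemma smooth_on_polynomial:
  assumes "real_polynomial_function p"
  shows "smooth_on S p"
proof -
  \<comment> \<open>A derivative map for all polynomials at once, so that its iterates supply the
    whole sequence \<open>D\<close>.\<close>
  have "\<forall>f. \<exists>f'. real_polynomial_function f \<longrightarrow>
      real_polynomial_function f' \<and> (\<forall>x. (f has_real_derivative f' x) (at x))"
    using has_real_derivative_polynomial_function by blast
  then obtain d where d: "\<And>f. real_polynomial_function f \<Longrightarrow>
      real_polynomial_function (d f) \<and> (\<forall>x. (f has_real_derivative d f x) (at x))"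
    unfolding choice_iff by blast
  define D where "D n = (d ^^ n) p" for n
  have D: "real_polynomial_function (D n)" for n
    using assms d by (induction n) (auto simp: D_def)
  have "(D n has_real_derivative D (Suc n) x) (at x within S)" for n x
    using d[OF D[of n]] by (auto simp: D_def intro: DERIV_subset)
  then show ?thesis unfolding smooth_on_def
    by (intro exI[of _ D]) (auto simp: D_def)
qed

lemma smooth_on_scaled_exp: "smooth_on S (\<lambda>t. g * exp (k * t))"
  unfolding smooth_on_def
  by (rule exI[of _ "\<lambda>n t. g * k ^ n * exp (k * t)"]) (auto intro!: derivative_eq_intros)

lemma smooth2_on_exp_affine:
  assumes "smooth_on J \<rho>" "smooth_on J \<delta>"
  shows "smooth2_on (I \<times> J) (\<lambda>t x. exp (k * t) * (\<rho> x + t * \<delta> x))"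
proof -
  obtain R where R: "R 0 = \<rho>" "\<And>j x. x \<in> J \<Longrightarrow> (R j has_real_derivative R (Suc j) x) (at x within J)"
    using assms(1) by (auto simp: smooth_on_def)
  obtain E where E: "E 0 = \<delta>" "\<And>j x. x \<in> J \<Longrightarrow> (E j has_real_derivative E (Suc j) x) (at x within J)"
    using assms(2) by (auto simp: smooth_on_def)
  \<comment> \<open>Leibniz rule for \<open>exp (k * t) * (R + t * E)\<close>. For
    \<open>i = 0\<close> the truncated exponent \<open>i - 1\<close> is harmless, because the factor
    \<open>real i\<close> removes the term.\<close>
  define D where "D i j t x = exp (k * t) * (k ^ i * R j x + (k ^ i * t + real i * k ^ (i - 1)) * E j x)"
    for i j t x
  have "((\<lambda>p. D i j (fst p) (snd p)) has_derivative
      (\<lambda>p. D (Suc i) j t x * fst p + D i (Suc j) t x * snd p)) (at (t, x) within I \<times> J)"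
    if t: "t \<in> I" and x: "x \<in> J" for i j t x
  proof -
    have sub: "snd ` (I \<times> J) \<subseteq> J" by auto
    have comp: "((\<lambda>p. F (snd p)) has_derivative (\<lambda>p. F' * snd p)) (at (t, x) within I \<times> J)"
      if "(F has_real_derivative F') (at x within J)" for F F'
    proof -
      have "(F has_derivative (\<lambda>h. F' * h)) (at (snd (t, x)) within snd ` (I \<times> J))"
        using that sub unfolding has_field_derivative_def by (auto intro: has_derivative_subset)
      from has_derivative_in_compose[OF has_derivative_snd[OF has_derivative_ident] this]
      show ?thesis by simp
    qed
    have "k * (real i * k ^ (i - 1)) = real i * k ^ i" by (cases i) auto
    then have key: "D (Suc i) j t x = exp (k * t) * k * (k ^ i * R j x + (k ^ i * t + real i * k ^ (i - 1)) * E j x)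
        + exp (k * t) * (k ^ i * E j x)"
      unfolding D_def by (cases i) (simp_all add: algebra_simps)
    show ?thesis
      unfolding key unfolding D_def
      by (rule derivative_eq_intros comp R(2) E(2) x refl)+ (cases i; auto simp: fun_eq_iff algebra_simps)
  qed
  then have "\<forall>i j. \<forall>(t, x)\<in>I \<times> J. ((\<lambda>(s, y). D i j s y) has_derivative
            (\<lambda>(ds, dy). D (Suc i) j t x * ds + D i (Suc j) t x * dy)) (at (t, x) within I \<times> J)"
    by (auto simp: case_prod_unfold)
  moreover have "D 0 0 = (\<lambda>t x. exp (k * t) * (\<rho> x + t * \<delta> x))"
    by (auto simp: D_def fun_eq_iff R E)
  ultimately show ?thesis unfolding smooth2_on_def by blast
qed

lemma smooth_on_cont: "smooth_on S f \<Longrightarrow> continuous_on S f"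
  unfolding smooth_on_def by (metis DERIV_continuous_on)

lemma smooth2_on_slice:
  assumes "smooth2_on (I \<times> J) h" "t \<in> I"
  shows "smooth_on J (h t)"
proof -
  obtain D where D: "D 0 0 = h" "\<And>i j t x. t \<in> I \<Longrightarrow> x \<in> J \<Longrightarrow> ((\<lambda>(s, y). D i j s y) has_derivative
            (\<lambda>(ds, dy). D (Suc i) j t x * ds + D i (Suc j) t x * dy)) (at (t, x) within I \<times> J)"
    using assms(1) unfolding smooth2_on_def by blast
  have "(D 0 j t has_real_derivative D 0 (Suc j) t x) (at x within J)" if x: "x \<in> J" for j x
  proof -
    have "((\<lambda>y. (t, y)) has_derivative (\<lambda>h. (0, h))) (at x within J)"
      by (auto intro!: derivative_eq_intros)
    moreover have "((\<lambda>(s, y). D 0 j s y) has_derivative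
        (\<lambda>(ds, dy). D (Suc 0) j t x * ds + D 0 (Suc j) t x * dy)) (at (t, x) within (\<lambda>y. (t, y)) ` J)"
      by (rule has_derivative_subset[OF D(2)[OF assms(2) x]]) (use assms(2) in auto)
    ultimately have "((\<lambda>y. (\<lambda>(s, y). D 0 j s y) (t, y)) has_derivative
        (\<lambda>h. (\<lambda>(ds, dy). D (Suc 0) j t x * ds + D 0 (Suc j) t x * dy) (0, h))) (at x within J)"
      by (rule has_derivative_in_compose)
    then show ?thesis by (simp add: has_field_derivative_def)
  qed
  then show ?thesis unfolding smooth_on_def using D(1) by (intro exI[of _ "\<lambda>j. D 0 j t"]) auto
qed

lemma DERIV_unique_within01:
  fixes f :: "real \<Rightarrow> real"
  assumes "(f has_real_derivative a) (at x within {0..1})" "(f has_real_derivative b) (at x within {0..1})" "x \<in> {0..1}"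
  shows "a = b"
  using vector_derivative_unique_within_closed_interval[of 0 1 x f a b] assms
  by (simp add: has_real_derivative_iff_has_vector_derivative)

section \<open>Families of metrics and densities\<close>

text \<open>The exponent turns the conductance \<open>1 / sqrt g\<close> into itself times
  \<open>exp (t * \<gamma> e)\<close>. The factor \<open>exp (\<gamma> e * t)\<close> in
  \<open>density_family\<close> cancels the one that \<open>sqrt g\<close> loses and leaves a mass
  density affine in \<open>t\<close>.\<close>

definition metric_family :: "'e metric \<Rightarrow> ('e \<Rightarrow> real) \<Rightarrow> real \<Rightarrow> 'e metric" where
  "metric_family g \<gamma> t e = g e * exp (- 2 * \<gamma> e * t)"

definition density_family :: "'e density \<Rightarrow> ('e \<Rightarrow> real) \<Rightarrow> ('e \<Rightarrow> real \<Rightarrow> real) \<Rightarrow> real \<Rightarrow> 'e density" where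
  "density_family \<rho> \<gamma> \<delta> t e x = exp (\<gamma> e * t) * (\<rho> e x + t * \<delta> e x)"

definition normaliser :: "('v, 'e) pre_digraph \<Rightarrow> real \<Rightarrow> 'e metric \<Rightarrow> 'e density \<Rightarrow> real" where
  "normaliser G \<alpha> g \<rho> = (\<Sum>e\<in>arcs G. g e powr (1 - \<alpha>)) * (\<Sum>e\<in>arcs G. g e powr \<alpha> * integral {0..1} (\<rho> e))"

context quantum_graph
begin

lemma conductance_family: "conductance (metric_family g \<gamma> t) = pert_cond (conductance g) \<gamma> t"
proof
  fix e
  have "sqrt (exp (- 2 * \<gamma> e * t)) = exp (- (\<gamma> e * t))"
    by (rule real_sqrt_unique) (simp_all add: exp_double[symmetric] mult.assoc)
  then show "conductance (metric_family g \<gamma> t) e = pert_cond (conductance g) \<gamma> t e"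
    unfolding conductance_def metric_family_def pert_cond_def real_sqrt_mult
    by (simp add: exp_minus divide_inverse mult.commute)
qed

lemma mass_density_family:
  "mass_density (metric_family g \<gamma> t) (density_family \<rho> \<gamma> \<delta> t) =
   pert_mass (mass_density g \<rho>) (mass_density g \<delta>) t"
proof (intro ext)
  fix e x
  have s: "sqrt (exp (- 2 * \<gamma> e * t)) = exp (- (\<gamma> e * t))"
    by (rule real_sqrt_unique) (simp_all add: exp_double[symmetric] mult.assoc)
  have "exp (- (\<gamma> e * t)) * exp (\<gamma> e * t) = 1" by (simp add: exp_minus)
  then show "mass_density (metric_family g \<gamma> t) (density_family \<rho> \<gamma> \<delta> t) e x =
      pert_mass (mass_density g \<rho>) (mass_density g \<delta>) t e x"
    unfolding mass_density_def metric_family_def density_family_def pert_mass_def real_sqrt_mult s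
    by (simp add: algebra_simps)
qed

lemma family_admissible:
  assumes adm: "(g, \<rho>) \<in> admissible G" and \<delta>: "\<And>e. e \<in> arcs G \<Longrightarrow> smooth_on {0..1} (\<delta> e)"
  shows "\<exists>b>0. (\<forall>t. \<bar>t\<bar> < b \<longrightarrow> (metric_family g \<gamma> t, density_family \<rho> \<gamma> \<delta> t) \<in> admissible G) \<and>
    smooth_family G (- b) b (metric_family g \<gamma>) (density_family \<rho> \<gamma> \<delta>)"
proof -
  have \<eta>: "edge_cont (mass_density g \<delta>)"
    using \<delta> smooth_on_cont unfolding mass_density_def[abs_def] by (auto intro!: continuous_intros)
  have l: "g e > 0" if "e \<in> arcs G" for e using adm that by (auto simp: admissible_def)
  have sm\<rho>: "smooth_on {0..1} (\<rho> e)" if "e \<in> arcs G" for e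
    using adm that by (auto simp: admissible_def densities_def)
  obtain b c where b: "0 < b" "0 < c"
    "\<And>t. \<bar>t\<bar> < b \<Longrightarrow> weights (pert_cond (conductance g) \<gamma> t) (pert_mass (mass_density g \<rho>) (mass_density g \<delta>) t)"
    "\<And>t e. \<bar>t\<bar> < b \<Longrightarrow> e \<in> arcs G \<Longrightarrow> c \<le> pert_cond (conductance g) \<gamma> t e"
    "\<And>t e x. \<bar>t\<bar> < b \<Longrightarrow> e \<in> arcs G \<Longrightarrow> x \<in> {0..1} \<Longrightarrow> c \<le> pert_mass (mass_density g \<rho>) (mass_density g \<delta>) t e x"
    using pert_bounds[OF admissible_weights[OF adm] \<eta>, of \<gamma>] by blast
  have s2: "smooth2_on ({- b<..<b} \<times> {0..1}) (\<lambda>t x. density_family \<rho> \<gamma> \<delta> t e x)" if e: "e \<in> arcs G" for e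
    unfolding density_family_def by (rule smooth2_on_exp_affine[OF sm\<rho>[OF e] \<delta>[OF e]])
  have pos: "density_family \<rho> \<gamma> \<delta> t e x > 0" if t: "\<bar>t\<bar> < b" and e: "e \<in> arcs G" and x: "x \<in> {0..1}" for t e x
  proof -
    have "0 < pert_mass (mass_density g \<rho>) (mass_density g \<delta>) t e x" using b(5)[OF t e x] b(2) by linarith
    also have "\<dots> = sqrt (g e) * (\<rho> e x + t * \<delta> e x)"
      by (simp add: pert_mass_def mass_density_def algebra_simps)
    finally show ?thesis using l[OF e] by (simp add: zero_less_mult_iff density_family_def)
  qed
  have ad: "(metric_family g \<gamma> t, density_family \<rho> \<gamma> \<delta> t) \<in> admissible G" if t: "\<bar>t\<bar> < b" for t
  proof -
    have "t \<in> {- b<..<b}" using t by auto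
    then have "smooth_on {0..1} (density_family \<rho> \<gamma> \<delta> t e)" if "e \<in> arcs G" for e
      using smooth2_on_slice[OF s2[OF that]] by blast
    then show ?thesis unfolding admissible_def densities_def
      using l pos[OF t] by (auto simp: metric_family_def)
  qed
  moreover have "smooth_family G (- b) b (metric_family g \<gamma>) (density_family \<rho> \<gamma> \<delta>)"
  proof -
    have "smooth_on {- b<..<b} (\<lambda>t. metric_family g \<gamma> t e)" for e
      unfolding metric_family_def by (rule smooth_on_scaled_exp)
    then show ?thesis unfolding smooth_family_def using ad s2 by auto
  qed
  ultimately show ?thesis using b(1) by blast
qed

lemma normaliser_pos:
  assumes adm: "(g, \<rho>) \<in> admissible G"
  shows "0 < (\<Sum>e\<in>arcs G. g e powr (1 - \<alpha>))" "e \<in> arcs G \<Longrightarrow> 0 < integral {0..1} (\<rho> e)"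
    "0 < (\<Sum>e\<in>arcs G. g e powr \<alpha> * integral {0..1} (\<rho> e))" "0 < normaliser G \<alpha> g \<rho>"
proof -
  have l: "g e > 0" if "e \<in> arcs G" for e using adm that by (auto simp: admissible_def)
  have \<rho>: "continuous_on {0..1} (\<rho> e)" "\<And>x. x \<in> {0..1} \<Longrightarrow> 0 < \<rho> e x" if "e \<in> arcs G" for e
    using adm that densities_cont[of \<rho>] by (auto simp: admissible_def densities_def)
  have I: "0 < integral {0..1} (\<rho> e)" if e: "e \<in> arcs G" for e
  proof -
    have "0 \<le> integral {0..1} (\<rho> e)" using \<rho>[OF e] by (intro integral01_nonneg) (auto intro: less_imp_le)
    moreover have "integral {0..1} (\<rho> e) \<noteq> 0"
    proof
      assume "integral {0..1} (\<rho> e) = 0"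
      then have "\<rho> e 0 = 0" using \<rho>[OF e]
        by (subst (asm) integral01_eq_0_iff) (auto intro: less_imp_le)
      then show False using \<rho>(2)[OF e, of 0] by simp
    qed
    ultimately show ?thesis by linarith
  qed
  then show "0 < integral {0..1} (\<rho> e)" if "e \<in> arcs G" using that .
  show 1: "0 < (\<Sum>e\<in>arcs G. g e powr (1 - \<alpha>))" using l arcs_nonempty by (intro sum_pos) (auto simp: less_imp_neq[symmetric])
  show 2: "0 < (\<Sum>e\<in>arcs G. g e powr \<alpha> * integral {0..1} (\<rho> e))"
    using l I arcs_nonempty by (intro sum_pos) (auto simp: less_imp_neq[symmetric])
  show "0 < normaliser G \<alpha> g \<rho>" unfolding normaliser_def using 1 2 by simp
qed

lemma normaliser_family_deriv:
  assumes adm: "(g, \<rho>) \<in> admissible G" and \<delta>: "edge_cont \<delta>"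
  shows "((\<lambda>t. normaliser G \<alpha> (metric_family g \<gamma> t) (density_family \<rho> \<gamma> \<delta> t)) has_real_derivative
     (\<Sum>e\<in>arcs G. g e powr (1 - \<alpha>)) *
       (\<Sum>e\<in>arcs G. g e powr \<alpha> * ((1 - 2 * \<alpha>) * \<gamma> e * integral {0..1} (\<rho> e) + integral {0..1} (\<delta> e)))
     - 2 * (1 - \<alpha>) * (\<Sum>e\<in>arcs G. \<gamma> e * g e powr (1 - \<alpha>)) * (\<Sum>e\<in>arcs G. g e powr \<alpha> * integral {0..1} (\<rho> e))) (at 0)"
proof -
  have l: "g e > 0" if "e \<in> arcs G" for e using adm that by (auto simp: admissible_def)
  have \<rho>: "continuous_on {0..1} (\<rho> e)" if "e \<in> arcs G" for e
    using adm that densities_cont[of \<rho>] by (auto simp: admissible_def)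
  have pw: "metric_family g \<gamma> t e powr z = g e powr z * exp (- 2 * z * \<gamma> e * t)" if e: "e \<in> arcs G" for e t z
    using l[OF e] by (simp add: metric_family_def powr_mult powr_def exp_add[symmetric] ln_mult algebra_simps)
  have I: "integral {0..1} (density_family \<rho> \<gamma> \<delta> t e) =
      exp (\<gamma> e * t) * (integral {0..1} (\<rho> e) + t * integral {0..1} (\<delta> e))" if e: "e \<in> arcs G" for e t
  proof -
    have "density_family \<rho> \<gamma> \<delta> t e = (\<lambda>x. exp (\<gamma> e * t) * \<rho> e x + (exp (\<gamma> e * t) * t) * \<delta> e x)"
      by (auto simp: density_family_def fun_eq_iff algebra_simps)
    then have "integral {0..1} (density_family \<rho> \<gamma> \<delta> t e) =
        exp (\<gamma> e * t) * integral {0..1} (\<rho> e) + (exp (\<gamma> e * t) * t) * integral {0..1} (\<delta> e)"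
      using integral01_lin[OF \<rho>[OF e], of "\<delta> e"] \<delta> e by (simp only:)
    then show ?thesis by (simp add: algebra_simps)
  qed
  define P where "P t = (\<Sum>e\<in>arcs G. g e powr (1 - \<alpha>) * exp (- 2 * (1 - \<alpha>) * \<gamma> e * t))" for t
  define Q where "Q t = (\<Sum>e\<in>arcs G. g e powr \<alpha> * exp (- 2 * \<alpha> * \<gamma> e * t) *
        (exp (\<gamma> e * t) * (integral {0..1} (\<rho> e) + t * integral {0..1} (\<delta> e))))" for t
  define S where "S = (\<Sum>e\<in>arcs G. \<gamma> e * g e powr (1 - \<alpha>))"
  define R where "R = (\<Sum>e\<in>arcs G. g e powr \<alpha> * ((1 - 2 * \<alpha>) * \<gamma> e * integral {0..1} (\<rho> e) + integral {0..1} (\<delta> e)))"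
  have N: "(\<lambda>t. normaliser G \<alpha> (metric_family g \<gamma> t) (density_family \<rho> \<gamma> \<delta> t)) = (\<lambda>t. P t * Q t)"
    unfolding normaliser_def P_def Q_def
    by (intro ext arg_cong2[where f = "(*)"] sum.cong refl) (simp_all only: pw I)
  have "(P has_real_derivative (\<Sum>e\<in>arcs G. - 2 * (1 - \<alpha>) * (\<gamma> e * g e powr (1 - \<alpha>)))) (at 0)"
    unfolding P_def[abs_def] by (rule DERIV_sum) (auto intro!: derivative_eq_intros)
  then have P': "(P has_real_derivative - 2 * (1 - \<alpha>) * S) (at 0)"
    unfolding S_def sum_distrib_left .
  have Q': "(Q has_real_derivative R) (at 0)"
    unfolding Q_def[abs_def] R_def by (rule DERIV_sum) (auto intro!: derivative_eq_intros simp: algebra_simps)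
  have 0: "P 0 = (\<Sum>e\<in>arcs G. g e powr (1 - \<alpha>))" "Q 0 = (\<Sum>e\<in>arcs G. g e powr \<alpha> * integral {0..1} (\<rho> e))"
    by (simp_all add: P_def Q_def)
  have "- 2 * (1 - \<alpha>) * S * Q 0 + R * P 0 = P 0 * R - 2 * (1 - \<alpha>) * S * Q 0" by (simp add: algebra_simps)
  then show ?thesis
    using DERIV_mult[OF P' Q'] unfolding N 0[symmetric] S_def[symmetric] R_def[symmetric] by (simp only:)
qed

text \<open>The coefficients \<open>\<kappa>\<close>, \<open>\<beta>\<close>, \<open>\<sigma>\<close> with which \<open>Xq\<close> and \<open>Yq\<close> describe the first variation
  of the normalised eigenvalue.\<close>

definition kap :: "real \<Rightarrow> real \<Rightarrow> 'e metric \<Rightarrow> 'e density \<Rightarrow> 'e \<Rightarrow> real" where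
  "kap \<mu> \<alpha> g \<rho> e = \<mu> * ((1 - 2 * \<alpha>) * g e powr \<alpha> * integral {0..1} (\<rho> e) /
      (\<Sum>e\<in>arcs G. g e powr \<alpha> * integral {0..1} (\<rho> e)) -
      2 * (1 - \<alpha>) * g e powr (1 - \<alpha>) / (\<Sum>e\<in>arcs G. g e powr (1 - \<alpha>)))"

definition bet :: "real \<Rightarrow> 'e metric \<Rightarrow> 'e density \<Rightarrow> 'e \<Rightarrow> real" where
  "bet \<alpha> g \<rho> e = g e powr \<alpha> / (\<Sum>e\<in>arcs G. g e powr \<alpha> * integral {0..1} (\<rho> e))"

abbreviation varX ::
  "real \<Rightarrow> real \<Rightarrow> 'e metric \<Rightarrow> 'e density \<Rightarrow> ('e \<Rightarrow> real \<Rightarrow> real) \<Rightarrow> ('e \<Rightarrow> real \<Rightarrow> real) \<Rightarrow> 'e \<Rightarrow> real" where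
  "varX \<mu> \<alpha> g \<rho> \<equiv> Xq (conductance g) (mass_density g \<rho>) (kap \<mu> \<alpha> g \<rho>)"

abbreviation varY :: "real \<Rightarrow> 'e metric \<Rightarrow> 'e density \<Rightarrow> ('e \<Rightarrow> real \<Rightarrow> real) \<Rightarrow> 'e \<Rightarrow> real \<Rightarrow> real" where
  "varY \<alpha> g \<rho> \<equiv> Yq (mass_density g \<rho>) (bet \<alpha> g \<rho>) (\<lambda>e. sqrt (g e))"

text \<open>Dividing the variation by the normaliser sorts its terms: those with
  \<open>\<gamma>\<close> make up \<open>varX\<close>, those with \<open>\<delta>\<close> make up
  \<open>varY\<close>.\<close>

lemma variation_eq_pairing:
  assumes adm: "(g, \<rho>) \<in> admissible G" and \<delta>: "edge_cont \<delta>"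
    and f: "eigfun (conductance g) (mass_density g \<rho>) \<mu> f f'" "mass (mass_density g \<rho>) f f = 1"
    and A: "((\<lambda>t. normaliser G \<alpha> (metric_family g \<gamma> t) (density_family \<rho> \<gamma> \<delta> t)) has_real_derivative A') (at 0)"
  shows "variation (conductance g) \<mu> (normaliser G \<alpha> g \<rho>) A' \<gamma> (mass_density g \<delta>) f f' =
    normaliser G \<alpha> g \<rho> * pairing \<mu> \<gamma> \<delta> (varX \<mu> \<alpha> g \<rho> f f') (varY \<alpha> g \<rho> f)"
proof -
  define A1 where "A1 = (\<Sum>e\<in>arcs G. g e powr (1 - \<alpha>))"
  define A2 where "A2 = (\<Sum>e\<in>arcs G. g e powr \<alpha> * integral {0..1} (\<rho> e))"
  have pos: "A1 > 0" "A2 > 0" unfolding A1_def A2_def using normaliser_pos[OF adm] by auto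
  have N: "normaliser G \<alpha> g \<rho> = A1 * A2" by (simp add: normaliser_def A1_def A2_def)
  have A': "A' = A1 * (\<Sum>e\<in>arcs G. g e powr \<alpha> * ((1 - 2 * \<alpha>) * \<gamma> e * integral {0..1} (\<rho> e) + integral {0..1} (\<delta> e)))
     - 2 * (1 - \<alpha>) * (\<Sum>e\<in>arcs G. \<gamma> e * g e powr (1 - \<alpha>)) * A2"
    using DERIV_unique[OF A normaliser_family_deriv[OF adm \<delta>]] by (simp add: A1_def A2_def)
  have fc: "edge_cont f" using test_fun_cont[OF eigfun_test[OF f(1)]] .
  have IY: "integral {0..1} (\<lambda>x. \<delta> e x * varY \<alpha> g \<rho> f e x) =
      g e powr \<alpha> / A2 * integral {0..1} (\<delta> e) - integral {0..1} (\<lambda>x. mass_density g \<delta> e x * (f e x * f e x))"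
    if e: "e \<in> arcs G" for e
  proof -
    have "(\<lambda>x. \<delta> e x * varY \<alpha> g \<rho> f e x) = (\<lambda>x. g e powr \<alpha> / A2 * \<delta> e x + (- 1) * (mass_density g \<delta> e x * (f e x * f e x)))"
      by (auto simp: fun_eq_iff Yq_def f(2) bet_def A2_def mass_density_def power2_eq_square algebra_simps)
    moreover have "continuous_on {0..1} (\<lambda>x. mass_density g \<delta> e x * (f e x * f e x))"
      unfolding mass_density_def using \<delta> fc e by (auto intro!: continuous_intros)
    ultimately have "integral {0..1} (\<lambda>x. \<delta> e x * varY \<alpha> g \<rho> f e x) = g e powr \<alpha> / A2 * integral {0..1} (\<delta> e) +
        (- 1) * integral {0..1} (\<lambda>x. mass_density g \<delta> e x * (f e x * f e x))"
      using \<delta> e by (simp only: integral01_lin)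
    then show ?thesis by simp
  qed
  define S1 where "S1 = (\<Sum>e\<in>arcs G. \<gamma> e * (g e powr \<alpha> * integral {0..1} (\<rho> e)))"
  define S2 where "S2 = (\<Sum>e\<in>arcs G. \<gamma> e * g e powr (1 - \<alpha>))"
  define S3 where "S3 = (\<Sum>e\<in>arcs G. g e powr \<alpha> * integral {0..1} (\<delta> e))"
  have "(\<Sum>e\<in>arcs G. \<gamma> e * varX \<mu> \<alpha> g \<rho> f f' e) =
      (\<Sum>e\<in>arcs G. conductance g e * \<gamma> e * integral {0..1} (\<lambda>x. f' e x * f' e x)
        + \<mu> * (1 - 2 * \<alpha>) / A2 * (\<gamma> e * (g e powr \<alpha> * integral {0..1} (\<rho> e)))
        - \<mu> * 2 * (1 - \<alpha>) / A1 * (\<gamma> e * g e powr (1 - \<alpha>)))"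
    unfolding Xq_def f(2) kap_def A1_def[symmetric] A2_def[symmetric]
    by (rule sum.cong[OF refl]) (simp add: algebra_simps diff_divide_distrib)
  also have "\<dots> = energy (\<lambda>e. conductance g e * \<gamma> e) f' f' + \<mu> * (1 - 2 * \<alpha>) / A2 * S1 - \<mu> * 2 * (1 - \<alpha>) / A1 * S2"
    unfolding sum_subtractf sum.distrib sum_distrib_left[symmetric] S1_def S2_def energy_def ..
  finally have X: "(\<Sum>e\<in>arcs G. \<gamma> e * varX \<mu> \<alpha> g \<rho> f f' e) =
      energy (\<lambda>e. conductance g e * \<gamma> e) f' f' + \<mu> * (1 - 2 * \<alpha>) / A2 * S1 - \<mu> * 2 * (1 - \<alpha>) / A1 * S2" .
  have Y: "(\<Sum>e\<in>arcs G. integral {0..1} (\<lambda>x. \<delta> e x * varY \<alpha> g \<rho> f e x)) = S3 / A2 - mass (mass_density g \<delta>) f f"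
    by (simp add: IY S3_def mass_def sum_subtractf sum_divide_distrib)
  have "(\<Sum>e\<in>arcs G. g e powr \<alpha> * ((1 - 2 * \<alpha>) * \<gamma> e * integral {0..1} (\<rho> e) + integral {0..1} (\<delta> e))) =
      (1 - 2 * \<alpha>) * S1 + S3"
    unfolding S1_def S3_def sum_distrib_left sum.distrib[symmetric]
    by (rule sum.cong[OF refl]) (simp add: algebra_simps)
  then have A'': "A' = A1 * ((1 - 2 * \<alpha>) * S1 + S3) - 2 * (1 - \<alpha>) * S2 * A2" using A' by (simp only: S2_def)
  show ?thesis unfolding variation_def pairing_def N X Y A'' using pos by (simp add: field_simps)
qed

section \<open>The normalised eigenvalue and smooth approximation of directions\<close>

lemma eigval_first_eig:
  assumes adm: "(g, \<rho>) \<in> admissible G"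
  shows "first_eig (conductance g) (mass_density g \<rho>) (eigval G g \<rho> 1)"
  using first_eig_exists[OF admissible_weights[OF adm]] eigval_1_eq_first_eig[OF adm] by metis

lemma lambda1_bar_eq: "lambda1_bar G \<alpha> (g, \<rho>) = eigval G g \<rho> 1 * normaliser G \<alpha> g \<rho>"
  by (simp add: lambda1_bar_def normaliser_def mult.assoc)

lemma family_0: "metric_family g \<gamma> 0 = g" "density_family \<rho> \<gamma> \<delta> 0 = \<rho>"
  by (auto simp: fun_eq_iff metric_family_def density_family_def)

text \<open>The directions that arise are only continuous on each edge, whereas the density family
  has to be smooth.\<close>

lemma polynomial_approx:
  assumes Y: "edge_cont Y" and \<epsilon>: "0 < \<epsilon>"
  shows "\<exists>\<delta>. \<forall>e\<in>arcs G. smooth_on {0..1} (\<delta> e) \<and> (\<forall>x\<in>{0..1}. \<bar>Y e x - \<delta> e x\<bar> \<le> \<epsilon>)"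
proof -
  have "\<exists>p. real_polynomial_function p \<and> (\<forall>x\<in>{0..1}. \<bar>Y e x - p x\<bar> < \<epsilon>)" if "e \<in> arcs G" for e
    using Stone_Weierstrass_real_polynomial_function[of "{0..1}" "Y e" \<epsilon>] Y that \<epsilon> by (metis compact_Icc)
  then obtain \<delta> where "\<And>e. e \<in> arcs G \<Longrightarrow> real_polynomial_function (\<delta> e) \<and> (\<forall>x\<in>{0..1}. \<bar>Y e x - \<delta> e x\<bar> < \<epsilon>)"
    by metis
  then show ?thesis by (intro exI[of _ \<delta>]) (auto intro: smooth_on_polynomial less_imp_le)
qed

lemma pairing_perturb:
  assumes \<mu>: "0 \<le> \<mu>" and c: "edge_cont Y" "edge_cont \<delta>" "edge_cont V"
    and d: "\<And>e x. e \<in> arcs G \<Longrightarrow> x \<in> {0..1} \<Longrightarrow> \<bar>Y e x - \<delta> e x\<bar> \<le> \<epsilon>"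
    and C: "(\<Sum>e\<in>arcs G. integral {0..1} (\<lambda>x. \<bar>V e x\<bar>)) \<le> C" and \<epsilon>: "0 \<le> \<epsilon>"
  shows "\<bar>pairing \<mu> X Y W V - pairing \<mu> X \<delta> W V\<bar> \<le> \<mu> * (\<epsilon> * C)"
proof -
  have "\<bar>integral {0..1} (\<lambda>x. Y e x * V e x) - integral {0..1} (\<lambda>x. \<delta> e x * V e x)\<bar> \<le>
      \<epsilon> * integral {0..1} (\<lambda>x. \<bar>V e x\<bar>)" if e: "e \<in> arcs G" for e
  proof -
    have "integral {0..1} (\<lambda>x. 1 * (Y e x * V e x) + (- 1) * (\<delta> e x * V e x)) =
        1 * integral {0..1} (\<lambda>x. Y e x * V e x) + (- 1) * integral {0..1} (\<lambda>x. \<delta> e x * V e x)"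
      by (rule integral01_lin) (use c e in \<open>auto intro!: continuous_intros\<close>)
    then have "\<bar>integral {0..1} (\<lambda>x. Y e x * V e x) - integral {0..1} (\<lambda>x. \<delta> e x * V e x)\<bar> =
        norm (integral {0..1} (\<lambda>x. (Y e x - \<delta> e x) * V e x))" by (simp add: algebra_simps)
    also have "\<dots> \<le> integral {0..1} (\<lambda>x. \<epsilon> * \<bar>V e x\<bar>)"
    proof (rule integral_norm_bound_integral)
      show "norm ((Y e x - \<delta> e x) * V e x) \<le> \<epsilon> * \<bar>V e x\<bar>" if "x \<in> {0..1}" for x
        using d[OF e that] by (simp add: abs_mult mult_right_mono)
    qed (use c e in \<open>auto intro!: integrable01 continuous_intros\<close>)
    finally show ?thesis by simp
  qed
  then have "\<bar>(\<Sum>e\<in>arcs G. integral {0..1} (\<lambda>x. Y e x * V e x) - integral {0..1} (\<lambda>x. \<delta> e x * V e x))\<bar> \<le>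
      (\<Sum>e\<in>arcs G. \<epsilon> * integral {0..1} (\<lambda>x. \<bar>V e x\<bar>))"
    by (intro order_trans[OF sum_abs] sum_mono)
  also have "\<dots> \<le> \<epsilon> * C" using C \<epsilon> by (simp add: sum_distrib_left[symmetric] mult_left_mono)
  finally have "\<mu> * \<bar>(\<Sum>e\<in>arcs G. integral {0..1} (\<lambda>x. Y e x * V e x) - integral {0..1} (\<lambda>x. \<delta> e x * V e x))\<bar> \<le> \<mu> * (\<epsilon> * C)"
    using \<mu> by (rule mult_left_mono)
  moreover have "pairing \<mu> X Y W V - pairing \<mu> X \<delta> W V =
      \<mu> * (\<Sum>e\<in>arcs G. integral {0..1} (\<lambda>x. Y e x * V e x) - integral {0..1} (\<lambda>x. \<delta> e x * V e x))"
    by (simp add: pairing_def sum_subtractf algebra_simps)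
  ultimately show ?thesis using \<mu> by (simp add: abs_mult)
qed

text \<open>The approximation error must be controlled for all normalised eigenfunctions at once.
  Mass \<open>1\<close> and the positive lower bound of the weights bound the integral of
  \<open>f^2\<close>, which is all that \<open>pairing_perturb\<close> requires.\<close>

lemma varY_bound:
  assumes adm: "(g, \<rho>) \<in> admissible G"
  shows "\<exists>C>0. \<forall>f. edge_cont f \<longrightarrow> mass (mass_density g \<rho>) f f = 1 \<longrightarrow>
      (\<Sum>e\<in>arcs G. integral {0..1} (\<lambda>x. \<bar>varY \<alpha> g \<rho> f e x\<bar>)) \<le> C"
proof -
  let ?w = "mass_density g \<rho>"
  have wt: "weights (conductance g) ?w" by (rule admissible_weights[OF adm])
  have wc: "edge_cont ?w" by (rule weights_cont[OF wt])
  obtain c where c: "0 < c" "\<And>e. e \<in> arcs G \<Longrightarrow> c \<le> conductance g e"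
    "\<And>e x. e \<in> arcs G \<Longrightarrow> x \<in> {0..1} \<Longrightarrow> c \<le> ?w e x"
    using weights_lower_bound[OF wt] by blast
  define s where "s = (\<Sum>e\<in>arcs G. sqrt (g e)) + 1"
  have l: "g e > 0" if "e \<in> arcs G" for e using adm that by (auto simp: admissible_def)
  have s: "sqrt (g e) \<le> s" if e: "e \<in> arcs G" for e
    using member_le_sum[OF e, of "\<lambda>e. sqrt (g e)"] l by (auto simp: s_def less_imp_le)
  have s0: "s \<ge> 1" using l by (auto simp: s_def less_imp_le intro!: sum_nonneg)
  have A2: "(\<Sum>e\<in>arcs G. g e powr \<alpha> * integral {0..1} (\<rho> e)) > 0" by (rule normaliser_pos(3)[OF adm])
  have bet: "0 \<le> bet \<alpha> g \<rho> e" for e unfolding bet_def using A2 by simp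
  define C where "C = (\<Sum>e\<in>arcs G. bet \<alpha> g \<rho> e) + s / c"
  have C: "C > 0" unfolding C_def using bet s0 c(1) by (intro add_nonneg_pos sum_nonneg) auto
  have "(\<Sum>e\<in>arcs G. integral {0..1} (\<lambda>x. \<bar>varY \<alpha> g \<rho> f e x\<bar>)) \<le> C"
    if f: "edge_cont f" "mass ?w f f = 1" for f
  proof -
    have "integral {0..1} (\<lambda>x. \<bar>varY \<alpha> g \<rho> f e x\<bar>) \<le>
        bet \<alpha> g \<rho> e + s / c * integral {0..1} (\<lambda>x. ?w e x * (f e x * f e x))" if e: "e \<in> arcs G" for e
    proof -
      have cw: "continuous_on {0..1} (\<lambda>x. ?w e x * (f e x * f e x))"
        using wc f(1) e by (auto intro!: continuous_intros)
      have "integral {0..1} (\<lambda>x. \<bar>varY \<alpha> g \<rho> f e x\<bar>) \<le>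
          integral {0..1} (\<lambda>x. bet \<alpha> g \<rho> e * 1 + s / c * (?w e x * (f e x * f e x)))"
      proof (rule integral01_mono)
        show "continuous_on {0..1} (\<lambda>x. \<bar>varY \<alpha> g \<rho> f e x\<bar>)"
          using Yq_cont[OF f(1)] e by (auto intro!: continuous_intros)
        show "continuous_on {0..1} (\<lambda>x. bet \<alpha> g \<rho> e * 1 + s / c * (?w e x * (f e x * f e x)))"
          by (intro continuous_intros) (use wc f(1) e in auto)
        fix x :: real assume x: "x \<in> {0..1}"
        have "\<bar>varY \<alpha> g \<rho> f e x\<bar> \<le> bet \<alpha> g \<rho> e + sqrt (g e) * (f e x)\<^sup>2"
          using bet[of e] l[OF e] zero_le_power2[of "f e x"]
          by (simp add: Yq_def f(2) abs_le_iff)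
        also have "sqrt (g e) * (f e x)\<^sup>2 \<le> s * (f e x)\<^sup>2" using s[OF e] by (intro mult_right_mono) auto
        also have "s * (f e x)\<^sup>2 \<le> s / c * (?w e x * (f e x * f e x))"
        proof -
          have "s * (f e x)\<^sup>2 = s / c * (c * (f e x * f e x))" using c(1) by (simp add: power2_eq_square)
          also have "\<dots> \<le> s / c * (?w e x * (f e x * f e x))"
            using c(1) c(3)[OF e x] s0 by (intro mult_left_mono mult_right_mono) auto
          finally show ?thesis .
        qed
        finally show "\<bar>varY \<alpha> g \<rho> f e x\<bar> \<le> bet \<alpha> g \<rho> e * 1 + s / c * (?w e x * (f e x * f e x))" by simp
      qed
      also have "\<dots> = bet \<alpha> g \<rho> e + s / c * integral {0..1} (\<lambda>x. ?w e x * (f e x * f e x))"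
        by (subst integral01_lin[OF _ cw]) auto
      finally show ?thesis .
    qed
    then have "(\<Sum>e\<in>arcs G. integral {0..1} (\<lambda>x. \<bar>varY \<alpha> g \<rho> f e x\<bar>)) \<le>
        (\<Sum>e\<in>arcs G. bet \<alpha> g \<rho> e + s / c * integral {0..1} (\<lambda>x. ?w e x * (f e x * f e x)))"
      by (rule sum_mono)
    also have "\<dots> = C" using f(2)
      by (simp add: C_def sum.distrib sum_distrib_left[symmetric] sum_divide_distrib[symmetric] mass_def)
    finally show ?thesis .
  qed
  with C show ?thesis by blast
qed

section \<open>Minimisers and extremal pairs\<close>

lemma no_minimiser: "\<not> minimiser G (lambda1_bar G \<alpha>) p"
proof
  assume min: "minimiser G (lambda1_bar G \<alpha>) p"
  obtain g \<rho> where p: "p = (g, \<rho>)" by fastforce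
  let ?a = "conductance g" and ?w = "mass_density g \<rho>"
  have adm: "(g, \<rho>) \<in> admissible G" using min p by (auto simp: minimiser_def)
  have wt: "weights ?a ?w" by (rule admissible_weights[OF adm])
  define \<mu> where "\<mu> = eigval G g \<rho> 1"
  have first: "first_eig ?a ?w \<mu>" unfolding \<mu>_def by (rule eigval_first_eig[OF adm])
  then have \<mu>: "\<mu> > 0" by (simp add: first_eig_def)
  obtain f f' where f: "eigfun ?a ?w \<mu> f f'" "mass ?w f f = 1" using first by (auto simp: first_eig_def)
  have fc: "edge_cont f" by (rule test_fun_cont[OF eigfun_test[OF f(1)]])
  define A0 where "A0 = normaliser G \<alpha> g \<rho>"
  have A0: "A0 > 0" unfolding A0_def by (rule normaliser_pos(4)[OF adm])
  have l: "g e > 0" if "e \<in> arcs G" for e using adm that by (auto simp: admissible_def)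
  have key: "pairing \<mu> (\<lambda>e. 0) \<delta> (varX \<mu> \<alpha> g \<rho> f f') (varY \<alpha> g \<rho> f) = 0"
    if \<delta>: "\<And>e. e \<in> arcs G \<Longrightarrow> smooth_on {0..1} (\<delta> e)" for \<delta>
  proof -
    let ?g = "metric_family g (\<lambda>e. 0)" and ?\<rho> = "density_family \<rho> (\<lambda>e. 0) \<delta>"
    have \<delta>c: "edge_cont \<delta>" using \<delta> smooth_on_cont by auto
    have \<eta>: "edge_cont (mass_density g \<delta>)"
      unfolding mass_density_def[abs_def] using \<delta>c by (auto intro!: continuous_intros)
    obtain b where "b > 0 \<and> (\<forall>t. \<bar>t\<bar> < b \<longrightarrow> (?g t, ?\<rho> t) \<in> admissible G)"
      using family_admissible[where \<gamma> = "\<lambda>e. 0" and \<delta> = \<delta>, OF adm \<delta>] by blast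
    then have b: "0 < b" "\<And>t. \<bar>t\<bar> < b \<Longrightarrow> (?g t, ?\<rho> t) \<in> admissible G" by auto
    define A where "A t = normaliser G \<alpha> (?g t) (?\<rho> t)" for t
    have A_0: "A 0 = A0" by (simp add: A_def A0_def family_0)
    obtain A' where A': "(A has_real_derivative A') (at 0)"
      unfolding A_def[abs_def] using normaliser_family_deriv[OF adm \<delta>c] by blast
    have "variation ?a \<mu> (A 0) A' (\<lambda>e. 0) (mass_density g \<delta>) f f' = 0"
    proof (rule variation_zero_of_minimum[OF wt \<eta> f \<mu> A' _ b(1)])
      show "0 < A 0" using A0 A_0 by simp
      show "first_eig (pert_cond ?a (\<lambda>e. 0) t) (pert_mass ?w (mass_density g \<delta>) t) (eigval G (?g t) (?\<rho> t) 1)"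
        if "\<bar>t\<bar> < b" for t
        using eigval_first_eig[OF b(2)[OF that]] by (simp only: conductance_family mass_density_family)
      show "\<mu> * A 0 \<le> eigval G (?g t) (?\<rho> t) 1 * A t" if "\<bar>t\<bar> < b" for t
      proof -
        have "lambda1_bar G \<alpha> (g, \<rho>) \<le> lambda1_bar G \<alpha> (?g t, ?\<rho> t)"
          using min b(2)[OF that] p by (auto simp: minimiser_def)
        then show ?thesis by (simp add: lambda1_bar_eq A_def \<mu>_def family_0)
      qed
    qed
    then show ?thesis
      using variation_eq_pairing[OF adm \<delta>c f A'[unfolded A_def[abs_def]]] A0 unfolding A_0 A0_def by simp
  qed
  let ?Y = "varY \<alpha> g \<rho> f"
  have Yc: "edge_cont ?Y" by (rule Yq_cont[OF fc])
  obtain C where C: "0 < C" "(\<Sum>e\<in>arcs G. integral {0..1} (\<lambda>x. \<bar>?Y e x\<bar>)) \<le> C"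
    using varY_bound[OF adm, of \<alpha>] fc f(2) by metis
  \<comment> \<open>The wanted direction is \<open>?Y\<close> itself, which makes the pairing a
    squared norm. It is merely continuous, so the identity \<open>key\<close> reaches it through
    smooth approximations.\<close>
  have small: "\<bar>pairing \<mu> (\<lambda>e. 0) ?Y (varX \<mu> \<alpha> g \<rho> f f') ?Y\<bar> \<le> \<mu> * (\<epsilon> * C)" if \<epsilon>: "0 < \<epsilon>" for \<epsilon>
  proof -
    obtain \<delta> where "\<forall>e\<in>arcs G. smooth_on {0..1} (\<delta> e) \<and> (\<forall>x\<in>{0..1}. \<bar>?Y e x - \<delta> e x\<bar> \<le> \<epsilon>)"
      using polynomial_approx[OF Yc \<epsilon>] ..
    then have \<delta>: "\<And>e. e \<in> arcs G \<Longrightarrow> smooth_on {0..1} (\<delta> e)"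
      "\<And>e x. e \<in> arcs G \<Longrightarrow> x \<in> {0..1} \<Longrightarrow> \<bar>?Y e x - \<delta> e x\<bar> \<le> \<epsilon>" by auto
    have \<delta>c: "edge_cont \<delta>" using \<delta>(1) smooth_on_cont by auto
    have "\<bar>pairing \<mu> (\<lambda>e. 0) ?Y (varX \<mu> \<alpha> g \<rho> f f') ?Y - pairing \<mu> (\<lambda>e. 0) \<delta> (varX \<mu> \<alpha> g \<rho> f f') ?Y\<bar> \<le> \<mu> * (\<epsilon> * C)"
      by (rule pairing_perturb[OF _ Yc \<delta>c Yc \<delta>(2) C(2)]) (use \<mu> \<epsilon> in auto)
    then show ?thesis using key[of \<delta>, OF \<delta>(1)] by simp
  qed
  have "pairing \<mu> (\<lambda>e. 0) ?Y (varX \<mu> \<alpha> g \<rho> f f') ?Y = 0"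
  proof (rule ccontr)
    assume ne: "pairing \<mu> (\<lambda>e. 0) ?Y (varX \<mu> \<alpha> g \<rho> f f') ?Y \<noteq> 0" (is "?P \<noteq> 0")
    define \<epsilon> where "\<epsilon> = \<bar>?P\<bar> / (2 * (\<mu> * C))"
    have "\<epsilon> > 0" using ne \<mu> C(1) by (simp add: \<epsilon>_def)
    from small[OF this] have "\<bar>?P\<bar> \<le> \<bar>?P\<bar> / 2" using \<mu> C(1) by (simp add: \<epsilon>_def field_simps)
    then show False using ne by simp
  qed
  then have "pairing \<mu> (\<lambda>e. 0) ?Y (\<lambda>e. 0) ?Y = 0" by (simp add: pairing_def)
  note Y0 = pairing_eq_0D(2)[OF \<mu> Yc this]
  obtain e where e: "e \<in> arcs G" using arcs_nonempty by auto
  define k where "k = bet \<alpha> g \<rho> e / sqrt (g e)"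
  have k: "k > 0" unfolding k_def bet_def using normaliser_pos(3)[OF adm, of \<alpha>] l[OF e] by simp
  have sq: "(f e x)\<^sup>2 = k" if "x \<in> {0..1}" for x
    using Y0[OF e that] l[OF e] by (simp add: Yq_def f(2) k_def field_simps)
  have df: "(f e has_real_derivative f' e x) (at x within {0..1})"
    "(f' e has_real_derivative - (\<mu> / ?a e) * (?w e x * f e x)) (at x within {0..1})" if "x \<in> {0..1}" for x
    using f(1) e that by (auto simp: eigfun_def test_fun_def C1_def)
  have f'0: "f' e x = 0" if x: "x \<in> {0..1}" for x
  proof -
    have "((\<lambda>x. (f e x)\<^sup>2) has_real_derivative 2 * f e x * f' e x) (at x within {0..1})"
      by (auto intro!: derivative_eq_intros df[OF x])
    moreover have "((\<lambda>x. (f e x)\<^sup>2) has_real_derivative 0) (at x within {0..1})"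
      by (rule has_field_derivative_transform_within[OF DERIV_const zero_less_one x]) (use sq in auto)
    ultimately have "2 * f e x * f' e x = 0"
      using x by (intro DERIV_unique_within01) auto
    moreover have "f e x \<noteq> 0" using sq[OF x] k by auto
    ultimately show ?thesis by simp
  qed
  \<comment> \<open>Since \<open>f'\<close> vanishes on the edge, so does its derivative, while the
    equation at \<open>x = 0\<close> makes that a nonzero multiple of \<open>f e 0\<close>.\<close>
  have "(f' e has_real_derivative 0) (at 0 within {0..1})"
    by (rule has_field_derivative_transform_within[OF DERIV_const zero_less_one]) (use f'0 in auto)
  then have "- (\<mu> / ?a e) * (?w e 0 * f e 0) = 0"
    using df(2)[of 0] by (intro DERIV_unique_within01) auto
  moreover have "f e 0 \<noteq> 0" using sq[of 0] k by auto
  moreover have "?a e > 0" "?w e 0 > 0" using wt e by (auto simp: weights_def)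
  ultimately show False using \<mu> by simp
qed

text \<open>A definite direction stays definite when its density part is replaced by a nearby smooth
  one, and \<open>not_extremal_of_definite\<close> then refutes both alternatives of
  \<open>extremal\<close>. Only the tuple remains.\<close>

lemma extremal_imp_null_tuple:
  assumes adm: "(g, \<rho>) \<in> admissible G" and ext: "extremal G (lambda1_bar G \<alpha>) (g, \<rho>)"
  defines "\<mu> \<equiv> eigval G g \<rho> 1"
  obtains d u u' where "\<And>i. i < d \<Longrightarrow> eigfun (conductance g) (mass_density g \<rho>) \<mu> (u i) (u' i)"
    "(\<Sum>i<(d::nat). mass (mass_density g \<rho>) (u i) (u i)) = 1"
    "\<And>e. e \<in> arcs G \<Longrightarrow> (\<Sum>i<d. varX \<mu> \<alpha> g \<rho> (u i) (u' i) e) = 0"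
    "\<And>e x. e \<in> arcs G \<Longrightarrow> x \<in> {0..1} \<Longrightarrow> (\<Sum>i<d. varY \<alpha> g \<rho> (u i) e x) = 0"
proof -
  let ?a = "conductance g" and ?w = "mass_density g \<rho>"
  have wt: "weights ?a ?w" by (rule admissible_weights[OF adm])
  have first: "first_eig ?a ?w \<mu>" unfolding \<mu>_def by (rule eigval_first_eig[OF adm])
  then have \<mu>: "\<mu> > 0" by (simp add: first_eig_def)
  obtain u0 u0' where u0: "eigfun ?a ?w \<mu> u0 u0'" "mass ?w u0 u0 = 1" using first by (auto simp: first_eig_def)
  show thesis
  proof (cases rule: definite_direction_or_tuple[OF wt \<mu> u0, of "kap \<mu> \<alpha> g \<rho>" "bet \<alpha> g \<rho>" "\<lambda>e. sqrt (g e)", case_names direction tuple])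
    case (tuple u u')
    then show thesis by (rule that)
  next
    case (direction X Y c)
    obtain C where "C > 0 \<and> (\<forall>f. edge_cont f \<longrightarrow> mass ?w f f = 1 \<longrightarrow>
      (\<Sum>e\<in>arcs G. integral {0..1} (\<lambda>x. \<bar>varY \<alpha> g \<rho> f e x\<bar>)) \<le> C)"
      using varY_bound[OF adm, of \<alpha>] by blast
    then have C: "0 < C" "\<And>f. edge_cont f \<Longrightarrow> mass ?w f f = 1 \<Longrightarrow>
      (\<Sum>e\<in>arcs G. integral {0..1} (\<lambda>x. \<bar>varY \<alpha> g \<rho> f e x\<bar>)) \<le> C" by auto
    \<comment> \<open>With this error the pairing with the smooth \<open>\<delta>\<close> is still
      at least \<open>c / 2\<close> for every normalised eigenfunction.\<close>
    define \<epsilon> where "\<epsilon> = c / (2 * (\<mu> * C))"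
    have \<epsilon>: "\<epsilon> > 0" using direction(2) \<mu> C(1) by (simp add: \<epsilon>_def)
    have \<epsilon>C: "\<mu> * (\<epsilon> * C) = c / 2" using \<mu> C(1) by (simp add: \<epsilon>_def field_simps)
    obtain \<delta> where "\<forall>e\<in>arcs G. smooth_on {0..1} (\<delta> e) \<and> (\<forall>x\<in>{0..1}. \<bar>Y e x - \<delta> e x\<bar> \<le> \<epsilon>)"
      using polynomial_approx[OF direction(1) \<epsilon>] ..
    then have \<delta>: "\<And>e. e \<in> arcs G \<Longrightarrow> smooth_on {0..1} (\<delta> e)"
      "\<And>e x. e \<in> arcs G \<Longrightarrow> x \<in> {0..1} \<Longrightarrow> \<bar>Y e x - \<delta> e x\<bar> \<le> \<epsilon>" by auto
    have \<delta>c: "edge_cont \<delta>" using \<delta>(1) smooth_on_cont by auto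
    have \<eta>: "edge_cont (mass_density g \<delta>)"
      unfolding mass_density_def[abs_def] using \<delta>c by (auto intro!: continuous_intros)
    let ?g = "metric_family g X" and ?\<rho> = "density_family \<rho> X \<delta>"
    obtain b where "b > 0 \<and> (\<forall>t. \<bar>t\<bar> < b \<longrightarrow> (?g t, ?\<rho> t) \<in> admissible G) \<and> smooth_family G (- b) b ?g ?\<rho>"
      using family_admissible[where \<gamma> = X and \<delta> = \<delta>, OF adm \<delta>(1)] by blast
    then have b: "0 < b" "\<And>t. \<bar>t\<bar> < b \<Longrightarrow> (?g t, ?\<rho> t) \<in> admissible G"
      "smooth_family G (- b) b ?g ?\<rho>" by auto
    define A where "A t = normaliser G \<alpha> (?g t) (?\<rho> t)" for t
    define \<Lambda> where "\<Lambda> t = eigval G (?g t) (?\<rho> t) 1" for t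
    have A_0: "A 0 = normaliser G \<alpha> g \<rho>" by (simp add: A_def family_0)
    have Apos: "A 0 > 0" unfolding A_0 by (rule normaliser_pos(4)[OF adm])
    obtain A' where A': "(A has_real_derivative A') (at 0)"
      unfolding A_def[abs_def] using normaliser_family_deriv[OF adm \<delta>c] by blast
    have \<Lambda>: "first_eig (pert_cond ?a X t) (pert_mass ?w (mass_density g \<delta>) t) (\<Lambda> t)" if "\<bar>t\<bar> < b" for t
      using eigval_first_eig[OF b(2)[OF that]] unfolding \<Lambda>_def by (simp only: conductance_family mass_density_family)
    have def: "0 < variation ?a \<mu> (A 0) A' X (mass_density g \<delta>) f f'"
      if f: "eigfun ?a ?w \<mu> f f'" "mass ?w f f = 1" for f f'
    proof -
      have fc: "edge_cont f" by (rule test_fun_cont[OF eigfun_test[OF f(1)]])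
      have "\<bar>pairing \<mu> X Y (varX \<mu> \<alpha> g \<rho> f f') (varY \<alpha> g \<rho> f) - pairing \<mu> X \<delta> (varX \<mu> \<alpha> g \<rho> f f') (varY \<alpha> g \<rho> f)\<bar> \<le> \<mu> * (\<epsilon> * C)"
        by (rule pairing_perturb[OF _ direction(1) \<delta>c Yq_cont[OF fc] \<delta>(2) C(2)[OF fc f(2)]]) (use \<mu> \<epsilon> in auto)
      then have "0 < pairing \<mu> X \<delta> (varX \<mu> \<alpha> g \<rho> f f') (varY \<alpha> g \<rho> f)"
        using direction(3)[OF f] direction(2) unfolding \<epsilon>C by linarith
      then show ?thesis
        using variation_eq_pairing[OF adm \<delta>c f A'[unfolded A_def[abs_def]]] Apos unfolding A_0 by simp
    qed
    note ne = not_extremal_of_definite[OF wt \<eta> first A' Apos b(1) \<Lambda> def]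
    have F: "lambda1_bar G \<alpha> (?g t, ?\<rho> t) = \<Lambda> t * A t" for t by (simp add: lambda1_bar_eq \<Lambda>_def A_def)
    have F0: "lambda1_bar G \<alpha> (g, \<rho>) = \<mu> * A 0" by (simp add: lambda1_bar_eq \<mu>_def A_0)
    have "(\<exists>r \<in> o[at 0](\<lambda>t. t). \<forall>\<^sub>F t in at 0. lambda1_bar G \<alpha> (?g t, ?\<rho> t) \<le> lambda1_bar G \<alpha> (g, \<rho>) + r t) \<or>
        (\<exists>r \<in> o[at 0](\<lambda>t. t). \<forall>\<^sub>F t in at 0. lambda1_bar G \<alpha> (?g t, ?\<rho> t) \<ge> lambda1_bar G \<alpha> (g, \<rho>) + r t)"
      using ext b(1,3) family_0(1)[of g X] family_0(2)[of \<rho> X \<delta>] unfolding extremal_def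
      by (elim conjE allE[of _ "- b"] allE[of _ b] allE[of _ ?g] allE[of _ ?\<rho>]) simp
    then show thesis unfolding F F0 using ne by blast
  qed
qed

end

subsection \<open>Necklace graphs\<close>

text \<open>Edges may point towards a terminal vertex or away from it; reflection lets both be read
  outwards.\<close>

lemma C1_reflect:
  assumes "C1 u u'"
  shows "C1 (\<lambda>x. u (1 - x)) (\<lambda>x. - u' (1 - x))"
  unfolding C1_def
proof (intro conjI ballI)
  have im: "(\<lambda>x. 1 - x) ` {0..1} \<subseteq> {0..1::real}" by auto
  fix x :: real assume x: "x \<in> {0..1}"
  have "(u has_real_derivative u' (1 - x)) (at (1 - x) within (\<lambda>x. 1 - x) ` {0..1})"
    by (rule DERIV_subset[OF C1_deriv[OF assms] im]) (use x in auto)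
  moreover have "((\<lambda>x. 1 - x) has_real_derivative - 1) (at x within {0..1})"
    by (auto intro!: derivative_eq_intros)
  ultimately show "((\<lambda>x. u (1 - x)) has_real_derivative - u' (1 - x)) (at x within {0..1})"
    using DERIV_image_chain[of u "u' (1 - x)" "\<lambda>x. 1 - x" x "{0..1}" "- 1"] by (simp add: o_def)
next
  have "continuous_on {0..1} (\<lambda>x. u' (1 - x))"
    by (rule continuous_on_compose2[OF C1_cont_deriv[OF assms]]) (auto intro!: continuous_intros)
  then show "continuous_on {0..1} (\<lambda>x. - u' (1 - x))" by (intro continuous_intros)
qed

text \<open>\<open>W\<close> is the Wronskian of \<open>d\<close> and
  \<open>sin (\<omega> * (1 - x))\<close>, two solutions of one equation, hence constant. Its values
  at the ends are \<open>d' 0 * sin \<omega>\<close> and \<open>\<omega> * d 1 = 0\<close>.\<close>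

lemma harmonic_Dirichlet_zero:
  assumes d: "C1 d d'" and d': "C1 d' (\<lambda>x. - \<omega>\<^sup>2 * d x)" and bd: "d 0 = 0" "d 1 = 0" and s: "sin \<omega> \<noteq> 0"
  shows "d' 0 = 0"
proof -
  define W where "W x = d' x * sin (\<omega> * (1 - x)) + \<omega> * d x * cos (\<omega> * (1 - x))" for x
  have "(W has_real_derivative 0) (at x within {0..1})" if x: "x \<in> {0..1}" for x
    unfolding W_def[abs_def]
    by (rule derivative_eq_intros C1_deriv[OF d x] C1_deriv[OF d' x] refl)+
      (simp add: power2_eq_square algebra_simps)
  then obtain c where "\<And>x. x \<in> {0..1} \<Longrightarrow> W x = c"
    using has_field_derivative_zero_constant[of "{0..1::real}" W] by auto
  from this[of 0] this[of 1] show ?thesis using bd s by (simp add: W_def)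
qed

definition necklace_enum :: "('v, 'e) pre_digraph \<Rightarrow> nat \<Rightarrow> (nat \<Rightarrow> 'v) \<Rightarrow> bool" where
  "necklace_enum G n v \<longleftrightarrow> 3 \<le> n \<and> inj_on v {1..n} \<and> v ` {1..n} = verts G \<and>
    (\<forall>j\<in>{1..<n}. card {e \<in> arcs G. {tail G e, head G e} = {v j, v (j + 1)}} = 2) \<and>
    (\<forall>e\<in>arcs G. \<exists>j\<in>{1..<n}. {tail G e, head G e} = {v j, v (j + 1)})"

text \<open>Counting excludes further edges: since \<open>v\<close> is injective, the
  \<open>n - 1\<close> classes are disjoint, and with two edges each they already contain all
  \<open>2 * (n - 1)\<close> edges. In particular there are no loops.\<close>

lemma necklace_classes:
  assumes "necklace_graph G" "card (verts G) \<ge> 3"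
  shows "\<exists>n v. necklace_enum G n v"
proof -
  interpret fin_digraph G using assms(1) by (simp add: necklace_graph_def)
  obtain n v where v: "bij_betw v {1..n} (verts G)" and c: "card (arcs G) = 2 * (n - 1)"
    and c2: "\<And>j. j \<in> {1..<n} \<Longrightarrow> card {e \<in> arcs G. {tail G e, head G e} = {v j, v (j + 1)}} = 2"
    using assms(1) unfolding necklace_graph_def by blast
  have n: "n = card (verts G)" using bij_betw_same_card[OF v] by simp
  have inj: "inj_on v {1..n}" using v by (rule bij_betw_imp_inj_on)
  define E where "E j = {e \<in> arcs G. {tail G e, head G e} = {v j, v (j + 1)}}" for j
  have fE: "finite (E j)" for j by (simp add: E_def)
  have "j = i" if "{v j, v (j + 1)} = {v i, v (i + 1)}" and ij: "i \<in> {1..<n}" "j \<in> {1..<n}" for i j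
  proof -
    have "v j = v i \<or> (v j = v (i + 1) \<and> v (j + 1) = v i)" using that(1) by (auto simp: doubleton_eq_iff)
    then show ?thesis
      using inj_onD[OF inj, of j i] inj_onD[OF inj, of j "i + 1"] inj_onD[OF inj, of "j + 1" i] ij by auto
  qed
  then have "E i \<inter> E j = {}" if "i \<in> {1..<n}" "j \<in> {1..<n}" "i \<noteq> j" for i j
    using that unfolding E_def by fastforce
  then have "card (\<Union>j\<in>{1..<n}. E j) = (\<Sum>j\<in>{1..<n}. card (E j))"
    by (intro card_UN_disjoint) (use fE in auto)
  also have "\<dots> = (\<Sum>j\<in>{1..<n}. 2)" by (rule sum.cong) (use c2 in \<open>auto simp: E_def\<close>)
  also have "\<dots> = card (arcs G)" using c by simp
  finally have "card (\<Union>j\<in>{1..<n}. E j) = card (arcs G)" .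
  then have "(\<Union>j\<in>{1..<n}. E j) = arcs G" by (intro card_subset_eq) (auto simp: E_def)
  then have "\<exists>j\<in>{1..<n}. {tail G e, head G e} = {v j, v (j + 1)}" if "e \<in> arcs G" for e
    using that by (auto simp: E_def)
  then have "necklace_enum G n v"
    unfolding necklace_enum_def using assms(2) n inj bij_betw_imp_surj_on[OF v] c2 by auto
  then show ?thesis by blast
qed

lemma necklace_quantum_graph:
  fixes G :: "('v, 'e) pre_digraph"
  assumes "necklace_graph G" "card (verts G) \<ge> 3"
  shows "quantum_graph G"
proof -
  interpret fin_digraph G using assms(1) by (simp add: necklace_graph_def)
  obtain n v where "necklace_enum G n v" using necklace_classes[OF assms] by blast
  then have v: "3 \<le> n" "inj_on v {1..n}" "v ` {1..n} = verts G"
    "\<And>j. j \<in> {1..<n} \<Longrightarrow> card {e \<in> arcs G. {tail G e, head G e} = {v j, v (j + 1)}} = 2"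
    "\<And>e. e \<in> arcs G \<Longrightarrow> \<exists>j\<in>{1..<n}. {tail G e, head G e} = {v j, v (j + 1)}"
    by (auto simp: necklace_enum_def)
  have ex: "\<exists>e\<in>arcs G. {tail G e, head G e} = {v j, v (j + 1)}" if "j \<in> {1..<n}" for j
  proof (rule ccontr)
    assume "\<not> ?thesis"
    then have "card {e \<in> arcs G. {tail G e, head G e} = {v j, v (j + 1)}} = 0"
      by (auto simp: card_eq_0_iff)
    then show False unfolding v(4)[OF that] by simp
  qed
  show ?thesis
  proof
    show "arcs G \<noteq> {}" using ex[of 1] v(1) by auto
    fix \<phi> :: "'v \<Rightarrow> real" assume \<phi>: "\<And>e. e \<in> arcs G \<Longrightarrow> \<phi> (tail G e) = \<phi> (head G e)"
    have step: "\<phi> (v j) = \<phi> (v (j + 1))" if "j \<in> {1..<n}" for j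
    proof -
      obtain e where "e \<in> arcs G" "{tail G e, head G e} = {v j, v (j + 1)}" using ex[OF \<open>j \<in> {1..<n}\<close>] by blast
      then show ?thesis using \<phi>[of e] by (auto simp: doubleton_eq_iff)
    qed
    have const: "j \<le> n \<longrightarrow> \<phi> (v j) = \<phi> (v 1)" if "1 \<le> j" for j
      using that
    proof (induction j rule: dec_induct)
      case (step m) then show ?case using \<open>\<And>j. j \<in> {1..<n} \<Longrightarrow> \<phi> (v j) = \<phi> (v (j + 1))\<close>[of m] by auto
    qed auto
    show "\<exists>c. \<forall>e\<in>arcs G. \<phi> (tail G e) = c"
    proof (intro exI ballI)
      fix e assume "e \<in> arcs G"
      then have "tail G e \<in> v ` {1..n}" using v(3) by simp
      then obtain j where "1 \<le> j" "j \<le> n" "tail G e = v j" by auto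
      then show "\<phi> (tail G e) = \<phi> (v 1)" using const[of j] by (simp only:)
    qed
  qed
qed

context quantum_graph
begin

section \<open>Null tuples on a necklace graph\<close>

lemma no_null_tuple:
  fixes u u' :: "nat \<Rightarrow> 'e \<Rightarrow> real \<Rightarrow> real" and v :: "nat \<Rightarrow> 'v"
  assumes adm: "(g, \<rho>) \<in> admissible G" and \<alpha>: "\<alpha> \<noteq> 1 / 2" "\<alpha> \<noteq> 1"
    and first: "first_eig (conductance g) (mass_density g \<rho>) \<mu>"
    and u: "\<And>i. i < d \<Longrightarrow> eigfun (conductance g) (mass_density g \<rho>) \<mu> (u i) (u' i)"
    and N: "(\<Sum>i<d. mass (mass_density g \<rho>) (u i) (u i)) = 1"
    and X: "\<And>e. e \<in> arcs G \<Longrightarrow> (\<Sum>i<d. varX \<mu> \<alpha> g \<rho> (u i) (u' i) e) = 0"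
    and Y: "\<And>e x. e \<in> arcs G \<Longrightarrow> x \<in> {0..1} \<Longrightarrow> (\<Sum>i<d. varY \<alpha> g \<rho> (u i) e x) = 0"
    and enum: "necklace_enum G n v"
  shows False
proof -
  have v: "3 \<le> n" "inj_on v {1..n}" "v ` {1..n} = verts G"
    "\<And>j. j \<in> {1..<n} \<Longrightarrow> card {e \<in> arcs G. {tail G e, head G e} = {v j, v (j + 1)}} = 2"
    "\<And>e. e \<in> arcs G \<Longrightarrow> \<exists>j\<in>{1..<n}. {tail G e, head G e} = {v j, v (j + 1)}"
    using enum by (auto simp: necklace_enum_def)
  let ?a = "conductance g" and ?w = "mass_density g \<rho>"
  have wt: "weights ?a ?w" by (rule admissible_weights[OF adm])
  have \<mu>: "\<mu> > 0" using first by (simp add: first_eig_def)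
  have l: "g e > 0" if "e \<in> arcs G" for e using adm that by (auto simp: admissible_def)
  have \<rho>pos: "\<rho> e x > 0" if "e \<in> arcs G" "x \<in> {0..1}" for e x
    using adm that by (auto simp: admissible_def densities_def)
  define A1 where "A1 = (\<Sum>e\<in>arcs G. g e powr (1 - \<alpha>))"
  define A2 where "A2 = (\<Sum>e\<in>arcs G. g e powr \<alpha> * integral {0..1} (\<rho> e))"
  have A: "A1 > 0" "A2 > 0" unfolding A1_def A2_def using normaliser_pos[OF adm] by auto
  have S: "(\<Sum>i<d. (u i e x)\<^sup>2) = g e powr (\<alpha> - 1 / 2) / A2" if e: "e \<in> arcs G" and x: "x \<in> {0..1}" for e x
  proof -
    have "bet \<alpha> g \<rho> e * 1 - sqrt (g e) * (\<Sum>i<d. (u i e x)\<^sup>2) = 0"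
      using Y[OF e x] N unfolding Yq_def sum_subtractf sum_distrib_left[symmetric] by simp
    then have "sqrt (g e) * (\<Sum>i<d. (u i e x)\<^sup>2) = g e powr \<alpha> / A2" by (simp add: bet_def A2_def)
    then have "sqrt (g e) * (\<Sum>i<d. (u i e x)\<^sup>2) / sqrt (g e) = g e powr \<alpha> / sqrt (g e) / A2" by simp
    then have "(\<Sum>i<d. (u i e x)\<^sup>2) = g e powr \<alpha> / sqrt (g e) / A2" using l[OF e] by simp
    then show ?thesis using l[OF e] by (simp add: powr_diff powr_half_sqrt)
  qed
  have "\<forall>i\<in>{..<d}. \<exists>\<phi>. \<forall>e\<in>arcs G. u i e 0 = \<phi> (tail G e) \<and> u i e 1 = \<phi> (head G e)"
    using u by (auto simp: eigfun_def test_fun_def)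
  then obtain \<phi> where "\<forall>i\<in>{..<d}. \<forall>e\<in>arcs G. u i e 0 = \<phi> i (tail G e) \<and> u i e 1 = \<phi> i (head G e)"
    unfolding bchoice_iff ..
  then have \<phi>: "\<And>i e. i < d \<Longrightarrow> e \<in> arcs G \<Longrightarrow> u i e 0 = \<phi> i (tail G e)"
    "\<And>i e. i < d \<Longrightarrow> e \<in> arcs G \<Longrightarrow> u i e 1 = \<phi> i (head G e)" by auto
  \<comment> \<open>The sum of squares at a vertex is the same seen from every edge there. Thus a
    quantity constant on each edge becomes constant on the graph.\<close>
  define \<psi> where "\<psi> z = (\<Sum>i<d. (\<phi> i z)\<^sup>2)" for z
  have \<psi>: "\<psi> (tail G e) = g e powr (\<alpha> - 1 / 2) / A2" "\<psi> (head G e) = g e powr (\<alpha> - 1 / 2) / A2" if e: "e \<in> arcs G" for e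
    using S[OF e, of 0] S[OF e, of 1] \<phi>[OF _ e] by (simp_all add: \<psi>_def)
  then obtain c where "\<forall>e\<in>arcs G. \<psi> (tail G e) = c" using connected_graph[of \<psi>] by auto
  with \<psi> have c: "g e powr (\<alpha> - 1 / 2) / A2 = c" if "e \<in> arcs G" for e using that by auto
  \<comment> \<open>Inverts \<open>g e powr (\<alpha> - 1 / 2) = c * A2\<close>, which is where
    \<open>\<alpha> \<noteq> 1 / 2\<close> enters.\<close>
  define \<gamma> where "\<gamma> = (c * A2) powr (1 / (\<alpha> - 1 / 2))"
  have g: "g e = \<gamma>" if e: "e \<in> arcs G" for e
  proof -
    have "c * A2 = g e powr (\<alpha> - 1 / 2)" using c[OF e] A by (simp add: field_simps)
    then show ?thesis using \<alpha>(1) l[OF e] by (simp add: \<gamma>_def powr_powr)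
  qed
  obtain e0 where e0: "e0 \<in> arcs G" using arcs_nonempty by auto
  have \<gamma>: "\<gamma> > 0" using l[OF e0] g[OF e0] by simp
  have cpos: "c > 0" using c[OF e0] l[OF e0] A by auto
  have c_eq: "c = \<gamma> powr \<alpha> / sqrt \<gamma> / A2"
    using c[OF e0] g[OF e0] \<gamma> by (simp add: powr_diff powr_half_sqrt)
  have a: "?a e = 1 / sqrt \<gamma>" if "e \<in> arcs G" for e using g[OF that] by (simp add: conductance_def)
  have Sc: "(\<Sum>i<d. (u i e x)\<^sup>2) = c" if "e \<in> arcs G" "x \<in> {0..1}" for e x using S[OF that] c[OF that(1)] by simp
  have du: "(u i e has_real_derivative u' i e x) (at x within {0..1})"
    "(u' i e has_real_derivative - (\<mu> * \<gamma> * \<rho> e x) * u i e x) (at x within {0..1})"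
    if "i < d" "e \<in> arcs G" "x \<in> {0..1}" for i e x
  proof -
    show "(u i e has_real_derivative u' i e x) (at x within {0..1})"
      using u[OF that(1)] that by (auto simp: eigfun_def test_fun_def C1_def)
    have "(u' i e has_real_derivative - (\<mu> / ?a e) * (?w e x * u i e x)) (at x within {0..1})"
      using u[OF that(1)] that by (auto simp: eigfun_def C1_def)
    moreover have "- (\<mu> / ?a e) * (?w e x * u i e x) = - (\<mu> * \<gamma> * \<rho> e x) * u i e x"
      using \<gamma> by (simp add: a[OF that(2)] mass_density_def g[OF that(2)])
    ultimately show "(u' i e has_real_derivative - (\<mu> * \<gamma> * \<rho> e x) * u i e x) (at x within {0..1})" by simp
  qed
  \<comment> \<open>The tuple traces a curve on a sphere. Differentiating \<open>|u|^2 = c\<close>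
    once gives \<open>u\<close> orthogonal to \<open>u'\<close>, twice the squared speed
    \<open>\<mu> * \<gamma> * \<rho> * c\<close>. As \<open>u''\<close> is parallel to
    \<open>u\<close>, the speed is constant, and with it \<open>\<rho>\<close> on the edge.\<close>
  have uu': "(\<Sum>i<d. u i e x * u' i e x) = 0" if e: "e \<in> arcs G" and x: "x \<in> {0..1}" for e x
  proof -
    have "((\<lambda>x. \<Sum>i<d. (u i e x)\<^sup>2) has_real_derivative (\<Sum>i<d. 2 * (u i e x * u' i e x))) (at x within {0..1})"
      by (rule DERIV_sum) (auto intro!: derivative_eq_intros du[OF _ e x])
    moreover have "((\<lambda>x. \<Sum>i<d. (u i e x)\<^sup>2) has_real_derivative 0) (at x within {0..1})"
      by (rule has_field_derivative_transform_within[OF DERIV_const zero_less_one x, of c]) (use Sc[OF e] in auto)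
    ultimately have "(\<Sum>i<d. 2 * (u i e x * u' i e x)) = 0" using x by (rule DERIV_unique_within01)
    then show ?thesis unfolding sum_distrib_left[symmetric] by simp
  qed
  have S': "(\<Sum>i<d. (u' i e x)\<^sup>2) = \<mu> * \<gamma> * \<rho> e x * c" if e: "e \<in> arcs G" and x: "x \<in> {0..1}" for e x
  proof -
    have "((\<lambda>x. \<Sum>i<d. u i e x * u' i e x) has_real_derivative
        (\<Sum>i<d. (u' i e x)\<^sup>2 - (\<mu> * \<gamma> * \<rho> e x) * (u i e x)\<^sup>2)) (at x within {0..1})"
    proof (rule DERIV_sum)
      fix i assume "i \<in> {..<d}"
      then have i: "i < d" by simp
      have "u' i e x * u' i e x + - (\<mu> * \<gamma> * \<rho> e x) * u i e x * u i e x =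
          (u' i e x)\<^sup>2 - (\<mu> * \<gamma> * \<rho> e x) * (u i e x)\<^sup>2" by (simp add: power2_eq_square)
      with DERIV_mult[OF du[OF i e x]]
      show "((\<lambda>x. u i e x * u' i e x) has_real_derivative
          (u' i e x)\<^sup>2 - (\<mu> * \<gamma> * \<rho> e x) * (u i e x)\<^sup>2) (at x within {0..1})" by (simp only:)
    qed
    moreover have "((\<lambda>x. \<Sum>i<d. u i e x * u' i e x) has_real_derivative 0) (at x within {0..1})"
      by (rule has_field_derivative_transform_within[OF DERIV_const zero_less_one x, of 0]) (use uu'[OF e] in auto)
    ultimately have "(\<Sum>i<d. (u' i e x)\<^sup>2 - (\<mu> * \<gamma> * \<rho> e x) * (u i e x)\<^sup>2) = 0" using x by (rule DERIV_unique_within01)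
    then show ?thesis unfolding sum_subtractf sum_distrib_left[symmetric] Sc[OF e x] by simp
  qed
  have \<rho>const: "\<rho> e x = \<rho> e 0" if e: "e \<in> arcs G" and x: "x \<in> {0..1}" for e x
  proof -
    have "((\<lambda>x. \<Sum>i<d. (u' i e x)\<^sup>2) has_real_derivative 0) (at y within {0..1})" if y: "y \<in> {0..1}" for y
    proof -
      have "((\<lambda>x. \<Sum>i<d. (u' i e x)\<^sup>2) has_real_derivative
          (\<Sum>i<d. - 2 * (\<mu> * \<gamma> * \<rho> e y) * (u i e y * u' i e y))) (at y within {0..1})"
        by (rule DERIV_sum) (auto intro!: derivative_eq_intros du[OF _ e y])
      then show ?thesis unfolding sum_distrib_left[symmetric] uu'[OF e y] by simp
    qed
    then obtain k where k: "\<And>y. y \<in> {0..1} \<Longrightarrow> (\<Sum>i<d. (u' i e y)\<^sup>2) = k"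
      using has_field_derivative_zero_constant[of "{0..1::real}" "\<lambda>x. \<Sum>i<d. (u' i e x)\<^sup>2"] by auto
    have "\<mu> * \<gamma> * \<rho> e x * c = \<mu> * \<gamma> * \<rho> e 0 * c" using k[OF x] k[of 0] S'[OF e x] S'[OF e, of 0] by simp
    then show ?thesis using \<mu> \<gamma> cpos by simp
  qed
  \<comment> \<open>Solves the vanishing trace of \<open>varX\<close> for the density. Because
    \<open>1 + (1 - 2 * \<alpha>) = 2 * (1 - \<alpha>)\<close>, all terms share the factor
    \<open>2 * (1 - \<alpha>)\<close>, which cancels for \<open>\<alpha> \<noteq> 1\<close>.\<close>
  define r where "r = \<gamma> powr (1 - \<alpha>) * A2 / (A1 * \<gamma> powr \<alpha>)"
  have r: "\<rho> e x = r" if e: "e \<in> arcs G" and x: "x \<in> {0..1}" for e x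
  proof -
    have I\<rho>: "integral {0..1} (\<rho> e) = \<rho> e 0"
    proof -
      have "integral {0..1} (\<rho> e) = integral {0..1} (\<lambda>x::real. \<rho> e 0)" by (rule integral_cong) (rule \<rho>const[OF e])
      then show ?thesis by simp
    qed
    have "(\<Sum>i<d. integral {0..1} (\<lambda>x. u' i e x * u' i e x)) = integral {0..1} (\<lambda>x. \<Sum>i<d. (u' i e x)\<^sup>2)"
      by (rule integral_sum_squares) (use test_fun_cont_deriv[OF eigfun_test[OF u]] e in auto)
    also have "\<dots> = integral {0..1} (\<lambda>x::real. \<mu> * \<gamma> * \<rho> e 0 * c)"
    proof (rule integral_cong)
      fix x :: real assume x: "x \<in> {0..1}"
      show "(\<Sum>i<d. (u' i e x)\<^sup>2) = \<mu> * \<gamma> * \<rho> e 0 * c" unfolding S'[OF e x] \<rho>const[OF e x] ..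
    qed
    also have "\<dots> = \<mu> * \<gamma> * \<rho> e 0 * c" by simp
    finally have K: "(\<Sum>i<d. integral {0..1} (\<lambda>x. u' i e x * u' i e x)) = \<mu> * \<gamma> * \<rho> e 0 * c" .
    have "?a e * (\<mu> * \<gamma> * \<rho> e 0 * c) + kap \<mu> \<alpha> g \<rho> e * 1 = 0"
      using X[OF e] unfolding Xq_def sum.distrib sum_distrib_left[symmetric] K N .
    moreover have "?a e * (\<mu> * \<gamma> * \<rho> e 0 * c) = \<mu> * (\<gamma> powr \<alpha> * \<rho> e 0 / A2)"
    proof -
      have "\<gamma> = sqrt \<gamma> * sqrt \<gamma>" using \<gamma> by simp
      then show ?thesis unfolding a[OF e] c_eq using \<gamma> A by (simp add: field_simps)
    qed
    moreover have "kap \<mu> \<alpha> g \<rho> e = \<mu> * ((1 - 2 * \<alpha>) * \<gamma> powr \<alpha> * \<rho> e 0 / A2 - 2 * (1 - \<alpha>) * \<gamma> powr (1 - \<alpha>) / A1)"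
      by (simp add: kap_def g[OF e] I\<rho> A1_def A2_def)
    ultimately have "\<mu> * (\<gamma> powr \<alpha> * \<rho> e 0 / A2 + ((1 - 2 * \<alpha>) * \<gamma> powr \<alpha> * \<rho> e 0 / A2 - 2 * (1 - \<alpha>) * \<gamma> powr (1 - \<alpha>) / A1)) = 0"
      by (simp add: distrib_left)
    then have "\<gamma> powr \<alpha> * \<rho> e 0 / A2 + ((1 - 2 * \<alpha>) * \<gamma> powr \<alpha> * \<rho> e 0 / A2 - 2 * (1 - \<alpha>) * \<gamma> powr (1 - \<alpha>) / A1) = 0"
      using \<mu> by simp
    moreover have "\<gamma> powr \<alpha> * \<rho> e 0 / A2 + ((1 - 2 * \<alpha>) * \<gamma> powr \<alpha> * \<rho> e 0 / A2 - 2 * (1 - \<alpha>) * \<gamma> powr (1 - \<alpha>) / A1) =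
        2 * (1 - \<alpha>) * (\<gamma> powr \<alpha> * \<rho> e 0 / A2 - \<gamma> powr (1 - \<alpha>) / A1)"
      by (simp add: algebra_simps add_divide_distrib diff_divide_distrib)
    ultimately have "\<gamma> powr \<alpha> * \<rho> e 0 / A2 = \<gamma> powr (1 - \<alpha>) / A1" using \<alpha>(2) by simp
    then have "\<rho> e 0 = r" unfolding r_def using A \<gamma> by (simp add: field_simps)
    then show ?thesis using \<rho>const[OF e x] by simp
  qed
  have rpos: "r > 0" using r[OF e0, of 0] \<rho>pos[OF e0, of 0] by simp
  \<comment> \<open>The common angular speed: on every edge the equation now reads
    \<open>u'' = - \<omega>^2 * u\<close>.\<close>
  define \<omega> where "\<omega> = sqrt (\<mu> * \<gamma> * r)"
  have \<omega>2: "\<omega>\<^sup>2 = \<mu> * \<gamma> * r" using \<mu> \<gamma> rpos by (simp add: \<omega>_def)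
  have \<omega>0: "\<omega> > 0" using \<mu> \<gamma> rpos by (simp add: \<omega>_def)
  define w0 where "w0 = sqrt \<gamma> * r"
  have w: "?w e x = w0" if "e \<in> arcs G" "x \<in> {0..1}" for e x
    using g[OF that(1)] r[OF that] by (simp add: mass_density_def w0_def)
  define E where "E j = {e \<in> arcs G. {tail G e, head G e} = {v j, v (j + 1)}}" for j
  have fE: "finite (E j)" for j by (simp add: E_def)
  have EG: "E j \<subseteq> arcs G" for j by (auto simp: E_def)
  have vi: "v i = v j \<longleftrightarrow> i = j" if "i \<in> {1..n}" "j \<in> {1..n}" for i j using inj_on_eq_iff[OF v(2) that] .
  \<comment> \<open>Opposite values at the two ends of the necklace give mean zero, since two edges
    hang at each end. As \<open>n \<ge> 3\<close>, no edge touches both ends, and products of end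
    values vanish.\<close>
  define \<tau> where "\<tau> z = (if z = v 1 then 1 else if z = v n then - 1 else (0::real))" for z
  have \<tau>v: "\<tau> (v j) = (if j = 1 then 1 else if j = n then - 1 else 0)" if "j \<in> {1..n}" for j
    using vi[OF that, of 1] vi[OF that, of n] v(1) by (auto simp: \<tau>_def)
  have cls: "\<tau> (tail G e) + \<tau> (head G e) = (if e \<in> E 1 then 1 else 0) - (if e \<in> E (n - 1) then 1 else 0)"
    "(\<tau> (tail G e))\<^sup>2 + (\<tau> (head G e))\<^sup>2 = (if e \<in> E 1 then 1 else 0) + (if e \<in> E (n - 1) then 1 else 0)"
    "\<tau> (tail G e) * \<tau> (head G e) = 0" if e: "e \<in> arcs G" for e
  proof -
    obtain j where j: "j \<in> {1..<n}" "{tail G e, head G e} = {v j, v (j + 1)}" using v(5)[OF e] by blast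
    have uniq: "e \<in> E i \<longleftrightarrow> i = j" if i: "i \<in> {1..<n}" for i
    proof
      assume "e \<in> E i"
      then have "{v i, v (i + 1)} = {v j, v (j + 1)}" using j(2) by (simp add: E_def)
      then show "i = j" using vi[of i j] vi[of i "j + 1"] vi[of "i + 1" j] i j(1) by (auto simp: doubleton_eq_iff)
    qed (use j e in \<open>simp add: E_def\<close>)
    have E1: "e \<in> E 1 \<longleftrightarrow> j = 1" "e \<in> E (n - 1) \<longleftrightarrow> j = n - 1" using uniq[of 1] uniq[of "n - 1"] v(1) by auto
    have th: "(tail G e = v j \<and> head G e = v (j + 1)) \<or> (tail G e = v (j + 1) \<and> head G e = v j)"
      using j(2) by (auto simp: doubleton_eq_iff)
    have t1: "\<tau> (v j) = (if j = 1 then 1 else 0)" using \<tau>v[of j] j(1) by auto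
    have t2: "\<tau> (v (j + 1)) = (if j = n - 1 then - 1 else 0)" using \<tau>v[of "j + 1"] j(1) by auto
    have ne: "\<not> (j = 1 \<and> j = n - 1)" using v(1) by auto
    show "\<tau> (tail G e) + \<tau> (head G e) = (if e \<in> E 1 then 1 else 0) - (if e \<in> E (n - 1) then 1 else 0)"
      unfolding E1 using th t1 t2 by auto
    show "(\<tau> (tail G e))\<^sup>2 + (\<tau> (head G e))\<^sup>2 = (if e \<in> E 1 then 1 else 0) + (if e \<in> E (n - 1) then 1 else 0)"
      unfolding E1 using th t1 t2 by auto
    show "\<tau> (tail G e) * \<tau> (head G e) = 0" using th t1 t2 ne by auto
  qed
  have cE: "(\<Sum>e\<in>arcs G. if e \<in> E j then 1 else 0 :: real) = 2" if "j \<in> {1..<n}" for j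
  proof -
    have "(\<Sum>e\<in>arcs G. if e \<in> E j then 1 else 0 :: real) = (\<Sum>e\<in>E j. 1)"
      using EG[of j] by (subst sum.inter_restrict[symmetric]) (auto simp: Int_absorb1)
    then show ?thesis using v(4)[OF that] by (simp add: E_def)
  qed
  have rng: "1 \<in> {1..<n}" "n - 1 \<in> {1..<n}" using v(1) by auto
  define h where "h = (\<lambda>e (x::real). \<tau> (tail G e) + x * (\<tau> (head G e) - \<tau> (tail G e)))"
  define h' where "h' = (\<lambda>e (x::real). \<tau> (head G e) - \<tau> (tail G e))"
  have th: "test_fun h h'" unfolding h_def h'_def by (rule test_fun_vertex)
  have Iaff: "integral {0..1} (\<lambda>x::real. p + x * (q - p)) = (p + q) / 2"
    "integral {0..1} (\<lambda>x::real. (p + x * (q - p)) * (p + x * (q - p))) = (p\<^sup>2 + p * q + q\<^sup>2) / 3" for p q :: real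
  proof -
    have "((\<lambda>x::real. p + x * (q - p)) has_integral (p * 1 + 1\<^sup>2 / 2 * (q - p)) - (p * 0 + 0\<^sup>2 / 2 * (q - p))) {0..1}"
      by (rule fundamental_theorem_of_calculus)
        (auto intro!: derivative_eq_intros simp: has_real_derivative_iff_has_vector_derivative[symmetric])
    then show "integral {0..1} (\<lambda>x::real. p + x * (q - p)) = (p + q) / 2"
      by (simp add: integral_unique field_simps)
    have "((\<lambda>x::real. (p + x * (q - p)) * (p + x * (q - p))) has_integral
        (p\<^sup>2 * 1 + 1\<^sup>2 * p * (q - p) + 1 ^ 3 / 3 * (q - p)\<^sup>2) - (p\<^sup>2 * 0 + 0\<^sup>2 * p * (q - p) + 0 ^ 3 / 3 * (q - p)\<^sup>2)) {0..1}"
      by (rule fundamental_theorem_of_calculus)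
        (auto intro!: derivative_eq_intros simp: has_real_derivative_iff_has_vector_derivative[symmetric] power2_eq_square algebra_simps)
    then show "integral {0..1} (\<lambda>x::real. (p + x * (q - p)) * (p + x * (q - p))) = (p\<^sup>2 + p * q + q\<^sup>2) / 3"
      by (simp add: integral_unique power2_eq_square field_simps)
  qed
  have m1: "mass ?w h (\<lambda>e x. 1) = 0"
  proof -
    have F: "integral {0..1} (\<lambda>x. ?w e x * (h e x * 1)) = w0 / 2 * (\<tau> (tail G e) + \<tau> (head G e))" if e: "e \<in> arcs G" for e
    proof -
      have "integral {0..1} (\<lambda>x. ?w e x * (h e x * 1)) = integral {0..1} (\<lambda>x. w0 * (\<tau> (tail G e) + x * (\<tau> (head G e) - \<tau> (tail G e))))"
        by (rule integral_cong) (simp add: w[OF e] h_def)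
      then show ?thesis by (simp add: Iaff)
    qed
    have "mass ?w h (\<lambda>e x. 1) = w0 / 2 * (\<Sum>e\<in>arcs G. (if e \<in> E 1 then 1 else 0) - (if e \<in> E (n - 1) then 1 else 0))"
      unfolding mass_def sum_distrib_left by (intro sum.cong refl) (simp only: F cls(1))
    then show ?thesis unfolding sum_subtractf using cE[OF rng(1)] cE[OF rng(2)] by simp
  qed
  \<comment> \<open>Four edges carry \<open>h\<close>, with values \<open>\<plusminus>1\<close> and
    \<open>0\<close> at their ends. Each contributes \<open>w0 / 3\<close> to the mass and, below,
    \<open>1 / sqrt \<gamma>\<close> to the energy.\<close>
  have m2: "mass ?w h h = w0 * (4 / 3)"
  proof -
    have F: "integral {0..1} (\<lambda>x. ?w e x * (h e x * h e x)) = w0 / 3 * ((if e \<in> E 1 then 1 else 0) + (if e \<in> E (n - 1) then 1 else 0))"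
      if e: "e \<in> arcs G" for e
    proof -
      have "integral {0..1} (\<lambda>x. ?w e x * (h e x * h e x)) = integral {0..1} (\<lambda>x. w0 *
         ((\<tau> (tail G e) + x * (\<tau> (head G e) - \<tau> (tail G e))) * (\<tau> (tail G e) + x * (\<tau> (head G e) - \<tau> (tail G e)))))"
        by (rule integral_cong) (simp add: w[OF e] h_def)
      also have "\<dots> = w0 / 3 * ((\<tau> (tail G e))\<^sup>2 + (\<tau> (head G e))\<^sup>2 + \<tau> (tail G e) * \<tau> (head G e))"
        by (simp add: Iaff add.commute add.left_commute)
      finally show ?thesis unfolding cls(2,3)[OF e] by simp
    qed
    have "mass ?w h h = w0 / 3 * (\<Sum>e\<in>arcs G. (if e \<in> E 1 then 1 else 0) + (if e \<in> E (n - 1) then 1 else 0))"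
      unfolding mass_def sum_distrib_left by (intro sum.cong refl F)
    then show ?thesis unfolding sum.distrib using cE[OF rng(1)] cE[OF rng(2)] by simp
  qed
  have e2: "energy ?a h' h' = 1 / sqrt \<gamma> * 4"
  proof -
    have F: "?a e * integral {0..1} (\<lambda>x. h' e x * h' e x) = 1 / sqrt \<gamma> * ((if e \<in> E 1 then 1 else 0) + (if e \<in> E (n - 1) then 1 else 0))"
      if e: "e \<in> arcs G" for e
    proof -
      have "integral {0..1} (\<lambda>x. h' e x * h' e x) = (\<tau> (head G e) - \<tau> (tail G e))\<^sup>2" by (simp add: h'_def power2_eq_square)
      also have "\<dots> = (\<tau> (tail G e))\<^sup>2 + (\<tau> (head G e))\<^sup>2 - 2 * (\<tau> (tail G e) * \<tau> (head G e))"
        by (simp add: power2_eq_square algebra_simps)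
      finally show ?thesis unfolding cls(2,3)[OF e] a[OF e] by simp
    qed
    have "energy ?a h' h' = 1 / sqrt \<gamma> * (\<Sum>e\<in>arcs G. (if e \<in> E 1 then 1 else 0) + (if e \<in> E (n - 1) then 1 else 0))"
      unfolding energy_def sum_distrib_left by (intro sum.cong refl F)
    then show ?thesis unfolding sum.distrib using cE[OF rng(1)] cE[OF rng(2)] by simp
  qed
  \<comment> \<open>The Rayleigh bound for \<open>h\<close>. It amounts to
    \<open>\<omega>^2 \<le> 3\<close>, which puts \<open>\<omega>\<close> strictly between
    \<open>0\<close> and \<open>pi\<close>.\<close>
  have "\<mu> * (w0 * (4 / 3)) \<le> 1 / sqrt \<gamma> * 4"
    using first th m1 unfolding first_eig_def m2[symmetric] e2[symmetric] by blast
  then have "sqrt \<gamma> * (\<mu> * (w0 * (4 / 3))) \<le> sqrt \<gamma> * (1 / sqrt \<gamma> * 4)" using \<gamma> by (intro mult_left_mono) auto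
  also have "\<dots> = 4" using \<gamma> by simp
  also have "sqrt \<gamma> * (\<mu> * (w0 * (4 / 3))) = \<omega>\<^sup>2 * (4 / 3)"
  proof -
    have "sqrt \<gamma> * sqrt \<gamma> = \<gamma>" using \<gamma> by simp
    then have "sqrt \<gamma> * (\<mu> * (sqrt \<gamma> * r * (4 / 3))) = \<mu> * \<gamma> * r * (4 / 3)" by (metis mult.assoc mult.commute)
    then show ?thesis unfolding w0_def \<omega>2 .
  qed
  finally have "\<omega>\<^sup>2 \<le> 3" by simp
  then have "\<omega>\<^sup>2 < 3\<^sup>2" by simp
  then have "\<omega> < 3" by (rule power_less_imp_less_base) simp
  then have "\<omega> < pi" using pi_gt3 by linarith
  then have sin: "sin \<omega> \<noteq> 0" using sin_gt_zero[OF \<omega>0] by simp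
  \<comment> \<open>Both edges at \<open>v 1\<close> are parametrised from \<open>v 1\<close> to
    \<open>v 2\<close>, whatever their orientation in \<open>G\<close>; \<open>out'\<close> is the
    matching derivative.\<close>
  define out where "out e f x = (if tail G e = v 1 then f e x else f e (1 - x) :: real)" for e :: 'e and f :: "'e \<Rightarrow> real \<Rightarrow> real" and x
  define out' where "out' e f x = (if tail G e = v 1 then f e x else - f e (1 - x) :: real)" for e :: 'e and f :: "'e \<Rightarrow> real \<Rightarrow> real" and x
  have ends: "(tail G e = v 1 \<and> head G e = v 2) \<or> (tail G e = v 2 \<and> head G e = v 1)" if "e \<in> E 1" for e
    using that by (auto simp: E_def doubleton_eq_iff numeral_2_eq_2)
  have v12: "v 1 \<noteq> v 2" using vi[of 1 2] v(1) by auto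
  obtain ea eb where ab: "E 1 = {ea, eb}" "ea \<noteq> eb"
    using v(4)[OF rng(1)] unfolding E_def[symmetric] card_2_iff by auto
  have abE: "ea \<in> E 1" "eb \<in> E 1" "ea \<in> arcs G" "eb \<in> arcs G" using ab(1) EG[of 1] by auto
  have o1: "C1 (out e (u i)) (out' e (u' i))" "C1 (out' e (u' i)) (\<lambda>x. - \<omega>\<^sup>2 * out e (u i) x)"
    "out e (u i) 0 = \<phi> i (v 1)" "out e (u i) 1 = \<phi> i (v 2)" if i: "i < d" and e: "e \<in> E 1" for i e
  proof -
    have eG: "e \<in> arcs G" using e EG by auto
    have 1: "C1 (u i e) (u' i e)" using u[OF i] eG by (auto simp: eigfun_def test_fun_def)
    have 2: "C1 (u' i e) (\<lambda>x. - \<omega>\<^sup>2 * u i e x)"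
      unfolding C1_def
    proof (intro conjI ballI)
      show "(u' i e has_real_derivative - \<omega>\<^sup>2 * u i e x) (at x within {0..1})" if "x \<in> {0..1}" for x
        using du(2)[OF i eG that] r[OF eG that] by (simp add: \<omega>2)
      show "continuous_on {0..1} (\<lambda>x. - \<omega>\<^sup>2 * u i e x)" using C1_cont[OF 1] by (intro continuous_intros)
    qed
    have 3: "C1 (\<lambda>x. - u' i e (1 - x)) (\<lambda>x. - \<omega>\<^sup>2 * u i e (1 - x))"
      using C1_lin[OF C1_reflect[OF 2] C1_const[of 0], of "- 1" 0] by simp
    show "C1 (out e (u i)) (out' e (u' i))" "C1 (out' e (u' i)) (\<lambda>x. - \<omega>\<^sup>2 * out e (u i) x)"
      using 1 2 3 C1_reflect[OF 1] by (cases "tail G e = v 1"; simp add: out_def[abs_def] out'_def[abs_def])+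
    show "out e (u i) 0 = \<phi> i (v 1)" "out e (u i) 1 = \<phi> i (v 2)"
      using ends[OF e] v12 \<phi>[OF i eG] by (auto simp: out_def)
  qed
  \<comment> \<open>All conductances equal \<open>1 / sqrt \<gamma>\<close>, so the Kirchhoff
    condition at \<open>v 1\<close> says that the two outward derivatives are opposite.\<close>
  have kir: "out' ea (u' i) 0 + out' eb (u' i) 0 = 0" if i: "i < d" for i
  proof -
    have T: "{e \<in> arcs G. tail G e = v 1} = {e \<in> E 1. tail G e = v 1}"
      "{e \<in> arcs G. head G e = v 1} = {e \<in> E 1. tail G e \<noteq> v 1}"
    proof -
      have at1: "e \<in> E 1" if e: "e \<in> arcs G" and "tail G e = v 1 \<or> head G e = v 1" for e
      proof -
        obtain j where j: "j \<in> {1..<n}" "{tail G e, head G e} = {v j, v (j + 1)}" using v(5)[OF e] by blast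
        then have "v 1 = v j \<or> v 1 = v (j + 1)" using that(2) by (auto simp: doubleton_eq_iff)
        then have "j = 1" using vi[of 1 j] vi[of 1 "j + 1"] j(1) by auto
        then show ?thesis using j e by (simp add: E_def)
      qed
      have nl: "tail G e = v 1 \<longleftrightarrow> head G e \<noteq> v 1" if "e \<in> E 1" for e
        using ends[OF that] v12 by auto
      show "{e \<in> arcs G. tail G e = v 1} = {e \<in> E 1. tail G e = v 1}"
        "{e \<in> arcs G. head G e = v 1} = {e \<in> E 1. tail G e \<noteq> v 1}"
        using at1 nl EG[of 1] by blast+
    qed
    have "v 1 \<in> verts G" using v(1) v(3) by auto
    then have "(\<Sum>e | e \<in> arcs G \<and> tail G e = v 1. ?a e * u' i e 0) +
        (\<Sum>e | e \<in> arcs G \<and> head G e = v 1. - (?a e * u' i e 1)) = 0"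
      using u[OF i] by (simp add: eigfun_def)
    then have "(\<Sum>e\<in>{e \<in> E 1. tail G e = v 1}. ?a e * u' i e 0) + (\<Sum>e\<in>{e \<in> E 1. tail G e \<noteq> v 1}. - (?a e * u' i e 1)) = 0"
      unfolding T .
    moreover have "(\<Sum>e\<in>{e \<in> E 1. tail G e = v 1}. ?a e * u' i e 0) = (\<Sum>e\<in>{e \<in> E 1. tail G e = v 1}. 1 / sqrt \<gamma> * out' e (u' i) 0)"
      by (rule sum.cong) (use EG[of 1] a in \<open>auto simp: out'_def\<close>)
    moreover have "(\<Sum>e\<in>{e \<in> E 1. tail G e \<noteq> v 1}. - (?a e * u' i e 1)) = (\<Sum>e\<in>{e \<in> E 1. tail G e \<noteq> v 1}. 1 / sqrt \<gamma> * out' e (u' i) 0)"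
      by (rule sum.cong) (use EG[of 1] a in \<open>auto simp: out'_def\<close>)
    moreover have "(\<Sum>e\<in>E 1. 1 / sqrt \<gamma> * out' e (u' i) 0) =
       (\<Sum>e\<in>{e \<in> E 1. tail G e = v 1}. 1 / sqrt \<gamma> * out' e (u' i) 0) + (\<Sum>e\<in>{e \<in> E 1. tail G e \<noteq> v 1}. 1 / sqrt \<gamma> * out' e (u' i) 0)"
      by (subst sum.union_disjoint[symmetric]) (use fE in \<open>auto intro!: sum.cong\<close>)
    ultimately have "1 / sqrt \<gamma> * (\<Sum>e\<in>E 1. out' e (u' i) 0) = 0" unfolding sum_distrib_left by linarith
    then show ?thesis using \<gamma> ab by simp
  qed
  \<comment> \<open>The two outward branches share their values at \<open>v 1\<close> and
    \<open>v 2\<close>, so their difference solves a Dirichlet problem with zero data and their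
    initial derivatives agree. Being also opposite, they vanish.\<close>
  have "out' ea (u' i) 0 = 0" if i: "i < d" for i
  proof -
    note A = o1[OF i abE(1)] and B = o1[OF i abE(2)]
    have "C1 (\<lambda>x. 1 * out ea (u i) x + (- 1) * out eb (u i) x) (\<lambda>x. 1 * out' ea (u' i) x + (- 1) * out' eb (u' i) x)"
      by (rule C1_lin[OF A(1) B(1)])
    moreover have "C1 (\<lambda>x. 1 * out' ea (u' i) x + (- 1) * out' eb (u' i) x)
        (\<lambda>x. 1 * (- \<omega>\<^sup>2 * out ea (u i) x) + (- 1) * (- \<omega>\<^sup>2 * out eb (u i) x))"
      by (rule C1_lin[OF A(2) B(2)])
    then have "C1 (\<lambda>x. 1 * out' ea (u' i) x + (- 1) * out' eb (u' i) x)
        (\<lambda>x. - \<omega>\<^sup>2 * (1 * out ea (u i) x + (- 1) * out eb (u i) x))" by (simp add: algebra_simps)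
    ultimately have "1 * out' ea (u' i) 0 + (- 1) * out' eb (u' i) 0 = 0"
      by (rule harmonic_Dirichlet_zero) (use A(3,4) B(3,4) sin in auto)
    then show ?thesis using kir[OF i] by simp
  qed
  \<comment> \<open>Zero speed at \<open>v 1\<close> contradicts the constant positive squared speed
    \<open>\<mu> * \<gamma> * r * c\<close>.\<close>
  then have z: "(\<Sum>i<d. (out' ea (u' i) 0)\<^sup>2) = 0" by simp
  have "(\<Sum>i<d. (out' ea (u' i) 0)\<^sup>2) = \<mu> * \<gamma> * r * c"
    using S'[OF abE(3), of 0] S'[OF abE(3), of 1] r[OF abE(3)] by (cases "tail G ea = v 1") (simp_all add: out'_def)
  with z show False using \<mu> \<gamma> rpos cpos by simp
qed

end

theorem corollary6p3:
  fixes G :: "('v, 'e) pre_digraph"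
  assumes "necklace_graph G" and "card (verts G) \<ge> 3"
  shows "(\<forall>\<alpha>::real. \<alpha> \<noteq> 1 \<longrightarrow> \<not> (\<exists>p. minimiser G (lambda1_bar G \<alpha>) p)) \<and>
         (\<forall>\<alpha>::real. \<alpha> \<notin> {1/2, 1} \<longrightarrow> \<not> (\<exists>p. extremal G (lambda1_bar G \<alpha>) p))"
proof -
  interpret quantum_graph G by (rule necklace_quantum_graph[OF assms])
  obtain n v where v: "necklace_enum G n v" using necklace_classes[OF assms] by blast
  have "\<not> extremal G (lambda1_bar G \<alpha>) p" if \<alpha>: "\<alpha> \<noteq> 1 / 2" "\<alpha> \<noteq> 1" for \<alpha> p
  proof
    assume ext: "extremal G (lambda1_bar G \<alpha>) p"
    obtain g \<rho> where p: "p = (g, \<rho>)" by fastforce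
    have adm: "(g, \<rho>) \<in> admissible G" using ext p by (simp add: extremal_def)
    show False
      by (rule extremal_imp_null_tuple[OF adm ext[unfolded p]])
        (rule no_null_tuple[OF adm \<alpha> eigval_first_eig[OF adm] _ _ _ _ v]; assumption)
  qed
  then show ?thesis using no_minimiser by auto
qed

end
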